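(* Let $(S,\mathcal S)$ be a measurable space and let $(\mathfrak X,\mathcal A)$ be the associated measurable space of point measures (see context). Let $n\in\mathbb N$ and let $N_j,X_j,X_{j,k},Z_j$ $(j\in\{1,\dots,n\},\,k\in\mathbb N)$ be independent random variables, where the $X_j$ and $X_{j,k}$ are $S$-valued with distributions $P^{X_j}=P^{X_{j,k}}$, the $Z_j$ are Bernoulli random variables with $P(Z_j=1)=1-P(Z_j=0)=p_j\in(0,1]$, and $N_j$ has Poisson distribution with mean $p_j$. Suppose that, for all $j\in\{1,\dots,n\}$, $P^{X_j}$ has a density $\widetilde h_j$ with respect to a $\sigma$-finite measure $\nu$ on $(S,\mathcal S)$. Let $\lambda=\sum_{j=1}^n p_j$ and $\widetilde h=\frac1\lambda\sum_{j=1}^n p_j\widetilde h_j$. Consider the point processes $$\xi=\sum_{j=1}^n Z_j\delta_{X_j},\qquad \zeta=\sum_{j=1}^n\sum_{k=1}^{N_j}\delta_{X_{j,k}}$$ (so that $\zeta$ is a Poisson point process with the same intensity measure as $\xi$, having $\nu$-density $\lambda\widetilde h$). Let $g(z)=2\sum_{m=2}^\infty\frac{m-1}{m!}z^{m-2}$ and $$\widetilde\alpha_1=\sum_{j=1}^n g(2p_j)\,p_j^2\int_{\{\widetilde h>0\}}\widetilde h_j\min\Bigl\{\frac{\widetilde h_j}{2^{3/2}\lambda\widetilde h},\,2\Bigr\}\,d\nu,\qquad \widetilde\beta_1=\sum_{j=1}^n p_j^2\int_{\{\widetilde h>0\}}\widetilde h_j\min\Bigl\{\frac{\widetilde h_j}{\lambda\widetilde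 h},\,1\Bigr\}\,d\nu.$$ If $\widetilde\alpha_1<\frac1{2^{3/2}}$, then $$d_{\mathrm{TV}}(P^\xi,P^\zeta)\le\frac{\widetilde\alpha_1}{1-2^{3/2}\widetilde\alpha_1};$$ and, in general, $$d_{\mathrm{TV}}(P^\xi,P^\zeta)\le 7.8\,\widetilde\beta_1.$$
   Context: $\mathfrak X$ is the set of all point measures on $(S,\mathcal S)$ of the form $\mu=\sum_{i\in I}\delta_{x_i}$, where $I\subseteq\mathbb N$ and $x_i\in S$ for all $i\in I$; $\delta_x$ is the Dirac measure at $x$. $\mathcal A$ is the smallest $\sigma$-algebra on $\mathfrak X$ making all evaluation maps $\pi_B:\mathfrak X\to\{0,1,2,\dots\}\cup\{\infty\}$, $\mu\mapsto\mu(B)$, $B\in\mathcal S$, measurable (with respect to the power set of the target). $P^Y$ denotes the distribution of a random variable $Y$; $P^\xi$ and $P^\zeta$ are probability measures on $(\mathfrak X,\mathcal A)$. The total variation distance is $d_{\mathrm{TV}}(V,W)=\sup_{A\in\mathcal A}|V(A)-W(A)|$. The function $g$ satisfies $g(z)=\frac{2e^z}{z^2}(e^{-z}-1+z)$ for $z\ne0$ and $g(0)=1$. *)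

theory Defs
  imports "HOL-Probability.Probability"
begin

text \<open>A measurable space \<open>(S, \<S>)\<close> is represented by a measure of which only \<^const>\<open>space\<close>
  and \<^const>\<open>sets\<close> are used; \<^term>\<open>return S x\<close> is then the Dirac measure at \<open>x\<close>.\<close>

text \<open>The sum \<open>\<Sum>i\<in>I. \<mu> i\<close> of measures on \<open>S\<close>. The integral against counting measure is the
  unordered sum over \<open>I\<close> with values in \<open>[0, \<infinity>]\<close>.\<close>

definition sum_measure :: "'s measure \<Rightarrow> 'i set \<Rightarrow> ('i \<Rightarrow> 's measure) \<Rightarrow> 's measure" where
  "sum_measure S I \<mu> =
     measure_of (space S) (sets S) (\<lambda>B. \<integral>\<^sup>+ i. emeasure (\<mu> i) B \<partial>count_space I)"

definition point_measures :: "'s measure \<Rightarrow> 's measure set" where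
  "point_measures S =
     {sum_measure S I (\<lambda>i. return S (x i)) | (I :: nat set) x. \<forall>i\<in>I. x i \<in> space S}"

text \<open>The evaluations \<open>\<mu> \<mapsto> \<mu>(B)\<close> take values in \<open>{0, 1, 2, \<dots>} \<union> {\<infinity>}\<close>, carrying its power set as
  \<open>\<sigma>\<close>-algebra; the generators are the preimages of arbitrary subsets \<open>C\<close> of it.\<close>

definition point_measure_algebra :: "'s measure \<Rightarrow> 's measure measure" where
  "point_measure_algebra S =
     sigma (point_measures S)
       {{\<mu> \<in> point_measures S. emeasure \<mu> B \<in> C} | B C. B \<in> sets S \<and> C \<subseteq> range of_nat \<union> {\<infinity>}}"

text \<open>Intended for probability measures \<open>V\<close>, \<open>W\<close> with \<open>sets V = sets W\<close>.\<close>

definition tv_dist :: "'b measure \<Rightarrow> 'b measure \<Rightarrow> real" where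
  "tv_dist V W = (SUP A\<in>sets V. \<bar>measure V A - measure W A\<bar>)"

text \<open>\<open>g z = 2 * (\<Sum>m\<ge>2. (m - 1) / m! * z ^ (m - 2))\<close>, with the summation index shifted by 2.\<close>

definition g :: "real \<Rightarrow> real" where
  "g z = 2 * (\<Sum>m. real (m + 1) / fact (m + 2) * z ^ m)"

text \<open>The random variables \<open>N\<^sub>j\<close>, \<open>X\<^sub>j\<close>, \<open>X\<^sub>j\<^sub>,\<^sub>k\<close>, \<open>Z\<^sub>j\<close> have values in different types, so they do not
  form a family to which \<^const>\<open>prob_space.indep_vars\<close> applies. Independence is expressed, as in the
  definition of that constant, by \<^const>\<open>prob_space.indep_sets\<close> for the events they generate; the
  datatype indexes the joint family.\<close>

datatype rv_index = IN nat | IX nat | IXX nat nat | IZ nat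

definition rv_indices :: "nat \<Rightarrow> rv_index set" where
  "rv_indices n =
     IN ` {1..n} \<union> IX ` {1..n} \<union> {IXX j k | j k. j \<in> {1..n} \<and> 1 \<le> k} \<union> IZ ` {1..n}"

definition generated_events :: "'w measure \<Rightarrow> 'b measure \<Rightarrow> ('w \<Rightarrow> 'b) \<Rightarrow> 'w set set" where
  "generated_events M M' Y = {Y -` A \<inter> space M | A. A \<in> sets M'}"

fun rv_events ::
  "'w measure \<Rightarrow> 's measure \<Rightarrow> (nat \<Rightarrow> 'w \<Rightarrow> nat) \<Rightarrow> (nat \<Rightarrow> 'w \<Rightarrow> 's) \<Rightarrow> (nat \<Rightarrow> nat \<Rightarrow> 'w \<Rightarrow> 's) \<Rightarrow>
   (nat \<Rightarrow> 'w \<Rightarrow> nat) \<Rightarrow> rv_index \<Rightarrow> 'w set set" where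
  "rv_events M S N X XX Z (IN j) = generated_events M (count_space UNIV) (N j)"
| "rv_events M S N X XX Z (IX j) = generated_events M S (X j)"
| "rv_events M S N X XX Z (IXX j k) = generated_events M S (XX j k)"
| "rv_events M S N X XX Z (IZ j) = generated_events M (count_space UNIV) (Z j)"

end

theory Submission
  imports Defs
begin

text \<open>The proof is Kerstan's method. Convolution with the law of a one-point process acts on bounded
  measurable functions of finite configurations (multisets) through the difference operator
  \<open>D\<^sub>w \<phi>(A) = \<integral> w(x) (\<phi>(A + \<delta>\<^sub>x) - \<phi>(A)) d\<nu>\<close>; these operators commute, \<open>\<xi>\<close> corresponds to the product of
  the \<open>1 + D\<^sub>j\<close> with weights \<open>p\<^sub>j h\<^sub>j\<close> and \<open>\<zeta>\<close> to \<open>exp (\<Sum> D\<^sub>j)\<close>. Each density is split according to whether its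
  ratio to \<open>\<lambda> h\<close> exceeds a level \<open>c\<close>: the part with a large ratio is replaced by a Poisson process directly,
  and for the other part \<open>(1 + D) exp (-D) - 1 = - D\<^sup>2 G(D)\<close> is expanded. The resulting terms
  \<open>exp (\<Sum> D\<^sub>j) \<Prod> D\<^sub>j\<^sup>2\<close> are bounded by an \<open>L\<^sup>2\<close> estimate for products of \<open>m\<close> difference operators under a
  Poisson process, with constant \<open>sqrt (m!)\<close>, and \<open>sqrt ((2k)!) / k! \<le> 2\<^sup>k / sqrt 2\<close> makes the sum geometric
  with ratio \<open>2 sqrt 2 \<alpha>\<close>. The level \<open>c = 4 sqrt 2\<close> gives the first bound, \<open>c = 1\<close> the second.\<close>

section \<open>Bounded operators on bounded measurable functions\<close>

text \<open>Norm bounds for the operators give only multiples of \<open>p\<^sub>j\<^sup>2\<close>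
  and lose the ratio of \<open>h\<^sub>j\<close> to the intensity. This factor is gained only by
  letting the full Poisson smoothing \<open>exp (\<Sum> D\<^sub>j)\<close> act on the squares
  \<open>D\<^sub>j\<^sup>2\<close>, hence the \<open>L\<^sup>2\<close> estimate. It costs the
  integral of \<open>h\<^sub>j\<^sup>2 / (\<lambda> h)\<close>, whereas the claim allows only a
  truncated ratio; this is why the densities are split before the expansion. The Poisson process
  enters the analysis only as a semigroup of positive operators that preserve constants, so the
  estimates need no law on configurations; the random variables are linked to the operators
  afterwards. Events are tested by indicators shifted by 1/2, so every error carries a factor 1/2.
  The second bound is trivial once its right-hand side reaches 1.\<close>

text \<open>The bound holds pointwise on the whole type: configurations carry no reference measure,
  and the operators evaluate functions at individual configurations.\<close>

definition bmf :: "'c measure \<Rightarrow> ('c \<Rightarrow> real) set" where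
  "bmf K = {f \<in> borel_measurable K. \<exists>C. \<forall>A. \<bar>f A\<bar> \<le> C}"

lemma bmfI: "f \<in> borel_measurable K \<Longrightarrow> (\<And>A. \<bar>f A\<bar> \<le> C) \<Longrightarrow> f \<in> bmf K"
  unfolding bmf_def by blast

lemma bmf_measurable: "f \<in> bmf K \<Longrightarrow> f \<in> borel_measurable K"
  unfolding bmf_def by blast

lemma bmf_bound:
  assumes "f \<in> bmf K" obtains C where "0 \<le> C" "\<And>A. \<bar>f A\<bar> \<le> C"
proof -
  from assms obtain C where "\<And>A. \<bar>f A\<bar> \<le> C" unfolding bmf_def by blast
  moreover then have "0 \<le> C" using abs_ge_zero[of "f undefined"] order_trans by blast
  ultimately show thesis using that by blast
qed

lemma bmf_const: "(\<lambda>A. c) \<in> bmf K"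
  by (rule bmfI[where C = "\<bar>c\<bar>"]) auto

lemma bmf_add:
  assumes "f \<in> bmf K" "f' \<in> bmf K" shows "(\<lambda>A. f A + f' A) \<in> bmf K"
proof -
  obtain C where C: "\<And>A. \<bar>f A\<bar> \<le> C" using bmf_bound[OF assms(1)] by blast
  obtain C' where C': "\<And>A. \<bar>f' A\<bar> \<le> C'" using bmf_bound[OF assms(2)] by blast
  have "\<bar>f A + f' A\<bar> \<le> C + C'" for A
    using C[of A] C'[of A] by linarith
  then show ?thesis
    by (rule bmfI[OF borel_measurable_add[OF assms[THEN bmf_measurable]]])
qed

lemma bmf_mult:
  assumes "f \<in> bmf K" "f' \<in> bmf K" shows "(\<lambda>A. f A * f' A) \<in> bmf K"
proof -
  obtain C where C: "0 \<le> C" "\<And>A. \<bar>f A\<bar> \<le> C" using bmf_bound[OF assms(1)] by blast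
  obtain C' where "0 \<le> C'" "\<And>A. \<bar>f' A\<bar> \<le> C'" using bmf_bound[OF assms(2)] by blast
  with C have "\<bar>f A * f' A\<bar> \<le> C * C'" for A
    unfolding abs_mult by (intro mult_mono) auto
  then show ?thesis
    by (rule bmfI[OF borel_measurable_times[OF assms[THEN bmf_measurable]]])
qed

lemma bmf_cmult: "f \<in> bmf K \<Longrightarrow> (\<lambda>A. c * f A) \<in> bmf K"
  using bmf_mult[OF bmf_const] by blast

lemma bmf_diff:
  assumes "f \<in> bmf K" "f' \<in> bmf K" shows "(\<lambda>A. f A - f' A) \<in> bmf K"
  using bmf_add[OF assms(1) bmf_cmult[OF assms(2), of "-1"]] by simp

lemma bmf_power2: "f \<in> bmf K \<Longrightarrow> (\<lambda>A. (f A)\<^sup>2) \<in> bmf K"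
  unfolding power2_eq_square by (rule bmf_mult)

lemma bmf_sum: "(\<And>i. i \<in> I \<Longrightarrow> f i \<in> bmf K) \<Longrightarrow> (\<lambda>A. \<Sum>i\<in>I. f i A) \<in> bmf K"
  by (induction I rule: infinite_finite_induct) (auto intro: bmf_add bmf_const)

lemma bmf_suminf:
  assumes "\<And>m. f m \<in> bmf K" "\<And>m A. \<bar>f m A\<bar> \<le> C m" "summable C"
  shows "(\<lambda>A. \<Sum>m. f m A) \<in> bmf K"
proof (rule bmfI[where C = "suminf C"])
  show "(\<lambda>A. \<Sum>m. f m A) \<in> borel_measurable K"
    by (intro borel_measurable_suminf bmf_measurable assms)
  show "\<bar>\<Sum>m. f m A\<bar> \<le> suminf C" for A
    using norm_suminf_le[of "\<lambda>m. f m A" C] assms by simp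
qed

type_synonym 'c operator = "('c \<Rightarrow> real) \<Rightarrow> 'c \<Rightarrow> real"

text \<open>Operators are total functions on all real functions, so linearity and the norm bound
  \<open>k\<close> are demanded on \<open>bmf K\<close> only. Identities between operators are
  accordingly stated for arguments in \<open>bmf K\<close>.\<close>

definition bounded_op :: "'c measure \<Rightarrow> 'c operator \<Rightarrow> real \<Rightarrow> bool" where
  "bounded_op K U k \<longleftrightarrow> 0 \<le> k \<and> (\<forall>f\<in>bmf K. U f \<in> bmf K) \<and>
     (\<forall>f\<in>bmf K. \<forall>f'\<in>bmf K. U (\<lambda>A. f A + f' A) = (\<lambda>A. U f A + U f' A)) \<and>
     (\<forall>f\<in>bmf K. \<forall>c. U (\<lambda>A. c * f A) = (\<lambda>A. c * U f A)) \<and>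
     (\<forall>f\<in>bmf K. \<forall>C. (\<forall>A. \<bar>f A\<bar> \<le> C) \<longrightarrow> (\<forall>A. \<bar>U f A\<bar> \<le> k * C))"

lemma bounded_op_bmf: "bounded_op K U k \<Longrightarrow> f \<in> bmf K \<Longrightarrow> U f \<in> bmf K"
  unfolding bounded_op_def by blast

lemma bounded_op_nonneg: "bounded_op K U k \<Longrightarrow> 0 \<le> k"
  unfolding bounded_op_def by blast

lemma bounded_op_add:
  "bounded_op K U k \<Longrightarrow> f \<in> bmf K \<Longrightarrow> f' \<in> bmf K \<Longrightarrow>
    U (\<lambda>A. f A + f' A) = (\<lambda>A. U f A + U f' A)"
  unfolding bounded_op_def by blast

lemma bounded_op_cmult:
  "bounded_op K U k \<Longrightarrow> f \<in> bmf K \<Longrightarrow> U (\<lambda>A. c * f A) = (\<lambda>A. c * U f A)"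
  unfolding bounded_op_def by blast

lemma bounded_op_le:
  "bounded_op K U k \<Longrightarrow> f \<in> bmf K \<Longrightarrow> (\<And>A. \<bar>f A\<bar> \<le> C) \<Longrightarrow> \<bar>U f A\<bar> \<le> k * C"
  unfolding bounded_op_def by blast

lemma bounded_op_diff:
  assumes "bounded_op K U k" "f \<in> bmf K" "f' \<in> bmf K"
  shows "U (\<lambda>A. f A - f' A) = (\<lambda>A. U f A - U f' A)"
proof -
  have "U (\<lambda>A. f A + (-1) * f' A) = (\<lambda>A. U f A + (-1) * U f' A)"
    using bounded_op_add[OF assms(1,2) bmf_cmult[OF assms(3)], of "-1"]
      bounded_op_cmult[OF assms(1,3), of "-1"] by simp
  then show ?thesis by simp
qed

lemma bounded_op_zero: "bounded_op K U k \<Longrightarrow> U (\<lambda>A. 0) = (\<lambda>A. 0)"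
  using bounded_op_cmult[OF _ bmf_const, of K U k 0 0] by simp

lemma bounded_op_sum:
  assumes "bounded_op K U k" "\<And>i. i \<in> I \<Longrightarrow> f i \<in> bmf K"
  shows "U (\<lambda>A. \<Sum>i\<in>I. f i A) = (\<lambda>A. \<Sum>i\<in>I. U (f i) A)"
  using assms(2)
proof (induction I rule: infinite_finite_induct)
  case (insert i I)
  then show ?case
    by (simp add: bounded_op_add[OF assms(1)] bmf_sum)
qed (simp_all add: bounded_op_zero[OF assms(1)])

lemma bounded_op_mono:
  assumes "bounded_op K U k" "k \<le> l" shows "bounded_op K U l"
proof -
  have "\<bar>U f A\<bar> \<le> l * C" if "f \<in> bmf K" "\<forall>A. \<bar>f A\<bar> \<le> C" for f A C
  proof -
    have "0 \<le> C" using that(2) abs_ge_zero[of "f A"] order_trans by blast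
    then show ?thesis
      using bounded_op_le[OF assms(1) that(1), of C A] that(2) mult_right_mono[OF assms(2), of C]
      by auto
  qed
  then show ?thesis using assms unfolding bounded_op_def by auto
qed

lemma bounded_op_id: "bounded_op K (\<lambda>f. f) 1"
  unfolding bounded_op_def by auto

lemma bounded_op_scale:
  assumes "bounded_op K U k" shows "bounded_op K (\<lambda>f A. c * U f A) (\<bar>c\<bar> * k)"
proof -
  have "\<bar>c * U f A\<bar> \<le> (\<bar>c\<bar> * k) * C" if "f \<in> bmf K" "\<forall>A. \<bar>f A\<bar> \<le> C" for f A C
    using bounded_op_le[OF assms that(1), of C A] that(2)
    by (simp add: abs_mult mult.assoc mult_left_mono)
  then show ?thesis
    unfolding bounded_op_def
    using bounded_op_nonneg[OF assms] bounded_op_bmf[OF assms]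
    by (auto simp: bounded_op_add[OF assms] bounded_op_cmult[OF assms] algebra_simps
        intro: bmf_cmult)
qed

lemma bounded_op_plus:
  assumes "bounded_op K U k" "bounded_op K V l"
  shows "bounded_op K (\<lambda>f A. U f A + V f A) (k + l)"
proof -
  have "\<bar>U f A + V f A\<bar> \<le> (k + l) * C" if "f \<in> bmf K" "\<forall>A. \<bar>f A\<bar> \<le> C" for f A C
    using bounded_op_le[OF assms(1) that(1), of C A] bounded_op_le[OF assms(2) that(1), of C A]
      that(2) by (auto simp: algebra_simps)
  then show ?thesis
    unfolding bounded_op_def
    using assms[THEN bounded_op_nonneg] assms[THEN bounded_op_bmf]
    by (auto simp: assms[THEN bounded_op_add] assms[THEN bounded_op_cmult] algebra_simps
        intro: bmf_add)
qed

lemma bounded_op_comp: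
  assumes "bounded_op K U k" "bounded_op K V l"
  shows "bounded_op K (\<lambda>f. U (V f)) (k * l)"
proof -
  have "\<bar>U (V f) A\<bar> \<le> (k * l) * C" if "f \<in> bmf K" "\<forall>A. \<bar>f A\<bar> \<le> C" for f A C
    using bounded_op_le[OF assms(1) bounded_op_bmf[OF assms(2) that(1)], of "l * C"]
      bounded_op_le[OF assms(2) that(1)] that(2) by (auto simp: algebra_simps)
  then show ?thesis
    unfolding bounded_op_def
    using assms[THEN bounded_op_nonneg] assms[THEN bounded_op_bmf]
    by (auto simp: assms[THEN bounded_op_add] assms[THEN bounded_op_cmult])
qed

lemma bounded_op_funpow: "bounded_op K U k \<Longrightarrow> bounded_op K (U ^^ m) (k ^ m)"
proof (induction m)
  case 0
  then show ?case using bounded_op_id[of K] by (simp add: id_def)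
next
  case (Suc m)
  then show ?case using bounded_op_comp[of K U k "U ^^ m" "k ^ m"] by (simp add: comp_def)
qed

text \<open>A supremum norm bound gives no continuity along pointwise limits. Domination by the
  summable \<open>C\<close> makes the tails uniformly small, and their images are then at most
  \<open>k\<close> times the tails of \<open>C\<close>.\<close>

lemma bounded_op_suminf:
  fixes f :: "nat \<Rightarrow> 'c \<Rightarrow> real"
  assumes U: "bounded_op K U k" and f: "\<And>m. f m \<in> bmf K" "\<And>m A. \<bar>f m A\<bar> \<le> C m"
    and C: "summable C"
  shows "U (\<lambda>A. \<Sum>m. f m A) = (\<lambda>A. \<Sum>m. U (f m) A)"
proof
  fix A
  have C0: "0 \<le> C m" for m using f(2)[of m undefined] by linarith
  have sm: "summable (\<lambda>m. f m A)" for A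
    by (rule summable_comparison_test[OF _ C]) (auto intro: f)
  have "(\<lambda>n. U (\<lambda>A. \<Sum>m. f m A) A - (\<Sum>m<n. U (f m) A)) \<longlonglongrightarrow> 0"
  proof (rule Lim_null_comparison)
    have "\<bar>U (\<lambda>A. \<Sum>m. f m A) A - (\<Sum>m<n. U (f m) A)\<bar> \<le> k * (\<Sum>m. C (m + n))" for n
    proof -
      have eq: "(\<lambda>A. \<Sum>m. f m A) = (\<lambda>A. (\<Sum>m. f (m + n) A) + (\<Sum>m<n. f m A))"
        using suminf_split_initial_segment[OF sm, where k = n] by auto
      have tb: "(\<lambda>A. \<Sum>m. f (m + n) A) \<in> bmf K"
        by (rule bmf_suminf[of _ _ "\<lambda>m. C (m + n)"])
          (use f summable_ignore_initial_segment[OF C, of n] in auto)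
      have "U (\<lambda>A. \<Sum>m. f m A) A - (\<Sum>m<n. U (f m) A) = U (\<lambda>A. \<Sum>m. f (m + n) A) A"
        by (simp add: eq bounded_op_add[OF U] tb bmf_sum f bounded_op_sum[OF U])
      moreover have "\<bar>\<Sum>m. f (m + n) A\<bar> \<le> (\<Sum>m. C (m + n))" for A
        using norm_suminf_le[of "\<lambda>m. f (m + n) A" "\<lambda>m. C (m + n)"] f
          summable_ignore_initial_segment[OF C] by simp
      ultimately show ?thesis using bounded_op_le[OF U tb] by simp
    qed
    then show "\<forall>\<^sub>F n in sequentially.
      norm (U (\<lambda>A. \<Sum>m. f m A) A - (\<Sum>m<n. U (f m) A)) \<le> k * (\<Sum>m. C (m + n))"
      by simp
    show "(\<lambda>n. k * (\<Sum>m. C (m + n))) \<longlonglongrightarrow> 0"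
      by (rule tendsto_mult_right_zero, rule suminf_exist_split2[OF C])
  qed
  then have "(\<lambda>n. U (\<lambda>A. \<Sum>m. f m A) A - (U (\<lambda>A. \<Sum>m. f m A) A - (\<Sum>m<n. U (f m) A)))
      \<longlonglongrightarrow> U (\<lambda>A. \<Sum>m. f m A) A - 0"
    by (intro tendsto_diff tendsto_const)
  then have "(\<lambda>m. U (f m) A) sums U (\<lambda>A. \<Sum>m. f m A) A"
    by (simp add: sums_def)
  then show "U (\<lambda>A. \<Sum>m. f m A) A = (\<Sum>m. U (f m) A)"
    by (simp add: sums_iff)
qed

section \<open>Commuting operators\<close>

definition commuting ::
  "'c measure \<Rightarrow> 'c operator \<Rightarrow> 'c operator \<Rightarrow> bool" where
  "commuting K U V \<longleftrightarrow> (\<forall>f\<in>bmf K. U (V f) = V (U f))"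

lemma commuting_sym: "commuting K U V \<Longrightarrow> commuting K V U"
  unfolding commuting_def by simp

lemma commutingD: "commuting K U V \<Longrightarrow> f \<in> bmf K \<Longrightarrow> U (V f) = V (U f)"
  unfolding commuting_def by blast

lemma commuting_funpow:
  assumes "commuting K U V" "bounded_op K V l" shows "commuting K U (V ^^ m)"
  unfolding commuting_def
proof (induction m)
  case (Suc m)
  show ?case
    using Suc commutingD[OF assms(1)] bounded_op_bmf[OF bounded_op_funpow[OF assms(2)]] by simp
qed simp

lemma commuting_plus:
  assumes "commuting K W U" "commuting K W V" "bounded_op K W c" "bounded_op K U a" "bounded_op K V b"
  shows "commuting K W (\<lambda>f A. U f A + V f A)"
  unfolding commuting_def
  by (auto simp: bounded_op_add[OF assms(3)] commutingD[OF assms(1)] commutingD[OF assms(2)]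
      bounded_op_bmf[OF assms(4)] bounded_op_bmf[OF assms(5)])

lemma commuting_scale:
  assumes "commuting K W U" "bounded_op K W c" "bounded_op K U a"
  shows "commuting K W (\<lambda>f A. t * U f A)"
  unfolding commuting_def
  by (auto simp: bounded_op_cmult[OF assms(2)] commutingD[OF assms(1)] bounded_op_bmf[OF assms(3)])

lemma commuting_comp:
  assumes "commuting K W U" "commuting K W V" "bounded_op K V b"
  shows "commuting K W (\<lambda>f. U (V f))"
  using assms unfolding commuting_def by (simp add: bounded_op_bmf[OF assms(3)])

lemma commuting_id: "commuting K W (\<lambda>f. f)"
  unfolding commuting_def by simp

section \<open>Power series in a bounded operator\<close>

definition op_series ::
  "(nat \<Rightarrow> real) \<Rightarrow> 'c operator \<Rightarrow> 'c operator" where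
  "op_series c U f = (\<lambda>A. \<Sum>m. c m * (U ^^ m) f A)"

lemma op_series_term:
  assumes "bounded_op K U k" "f \<in> bmf K" "\<And>A. \<bar>f A\<bar> \<le> C"
  shows "\<bar>c m * (U ^^ m) f A\<bar> \<le> \<bar>c m\<bar> * k ^ m * C"
  using bounded_op_le[OF bounded_op_funpow[OF assms(1)] assms(2,3), of m A]
  by (simp add: abs_mult mult.assoc mult_left_mono)

lemma op_series_summable:
  assumes "bounded_op K U k" "summable (\<lambda>m. \<bar>c m\<bar> * k ^ m)" "f \<in> bmf K"
  shows "summable (\<lambda>m. c m * (U ^^ m) f A)"
proof -
  obtain C where C: "\<And>A. \<bar>f A\<bar> \<le> C" using bmf_bound[OF assms(3)] by blast
  show ?thesis
    by (rule summable_comparison_test[OF _ summable_mult2[OF assms(2), of C]])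
      (auto intro: op_series_term[OF assms(1,3) C])
qed

lemma bounded_op_series:
  assumes U: "bounded_op K U k" and c: "summable (\<lambda>m. \<bar>c m\<bar> * k ^ m)"
  shows "bounded_op K (op_series c U) (\<Sum>m. \<bar>c m\<bar> * k ^ m)"
proof -
  note T = op_series_term[OF U]
  have bm: "(\<lambda>A. c m * (U ^^ m) f A) \<in> bmf K" if "f \<in> bmf K" for f m
    by (intro bmf_cmult bounded_op_bmf[OF bounded_op_funpow[OF U]] that)
  have bd: "\<bar>op_series c U f A\<bar> \<le> (\<Sum>m. \<bar>c m\<bar> * k ^ m) * C"
    if "f \<in> bmf K" "\<forall>A. \<bar>f A\<bar> \<le> C" for f C A
  proof -
    have "\<bar>op_series c U f A\<bar> \<le> (\<Sum>m. \<bar>c m\<bar> * k ^ m * C)"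
      unfolding op_series_def
      using norm_suminf_le[of "\<lambda>m. c m * (U ^^ m) f A" "\<lambda>m. \<bar>c m\<bar> * k ^ m * C"]
        T that summable_mult2[OF c] by simp
    then show ?thesis by (simp add: suminf_mult2[OF c])
  qed
  have mem: "op_series c U f \<in> bmf K" if f: "f \<in> bmf K" for f
  proof -
    obtain C where C: "\<And>A. \<bar>f A\<bar> \<le> C" using bmf_bound[OF f] by blast
    show ?thesis
      unfolding op_series_def
      by (rule bmf_suminf[where C = "\<lambda>m. \<bar>c m\<bar> * k ^ m * C"])
        (auto intro: bm[OF f] T[OF f C] summable_mult2[OF c])
  qed
  have add: "op_series c U (\<lambda>A. f A + f' A) = (\<lambda>A. op_series c U f A + op_series c U f' A)"
    if "f \<in> bmf K" "f' \<in> bmf K" for f f'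
    unfolding op_series_def
    by (simp add: bounded_op_add[OF bounded_op_funpow[OF U]] that suminf_add
        op_series_summable[OF U c] distrib_left)
  have scale: "op_series c U (\<lambda>A. d * f A) = (\<lambda>A. d * op_series c U f A)"
    if "f \<in> bmf K" for f d
  proof
    fix A
    have "(\<Sum>m. d * (c m * (U ^^ m) f A)) = d * (\<Sum>m. c m * (U ^^ m) f A)"
      by (rule suminf_mult[OF op_series_summable[OF U c that]])
    then show "op_series c U (\<lambda>A. d * f A) A = d * op_series c U f A"
      unfolding op_series_def
      by (simp add: bounded_op_cmult[OF bounded_op_funpow[OF U]] that mult.left_commute)
  qed
  have "0 \<le> (\<Sum>m. \<bar>c m\<bar> * k ^ m)"
    by (intro suminf_nonneg c) (simp add: bounded_op_nonneg[OF U])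
  then show ?thesis
    unfolding bounded_op_def using bd mem add scale by blast
qed

lemma bounded_op_op_series:
  assumes W: "bounded_op K W w" and U: "bounded_op K U k" and c: "summable (\<lambda>m. \<bar>c m\<bar> * k ^ m)"
    and f: "f \<in> bmf K"
  shows "W (op_series c U f) = (\<lambda>A. \<Sum>m. c m * W ((U ^^ m) f) A)"
proof -
  obtain C where C: "\<And>A. \<bar>f A\<bar> \<le> C" using bmf_bound[OF f] by blast
  have bm: "(U ^^ m) f \<in> bmf K" for m
    by (rule bounded_op_bmf[OF bounded_op_funpow[OF U] f])
  have "W (\<lambda>A. \<Sum>m. c m * (U ^^ m) f A) = (\<lambda>A. \<Sum>m. W (\<lambda>A. c m * (U ^^ m) f A) A)"
  proof (rule bounded_op_suminf[OF W])
    show "(\<lambda>A. c m * (U ^^ m) f A) \<in> bmf K" for m by (rule bmf_cmult[OF bm])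
    show "\<bar>c m * (U ^^ m) f A\<bar> \<le> \<bar>c m\<bar> * k ^ m * C" for m A by (rule op_series_term[OF U f C])
    show "summable (\<lambda>m. \<bar>c m\<bar> * k ^ m * C)" by (rule summable_mult2[OF c])
  qed
  then show ?thesis unfolding op_series_def by (simp add: bounded_op_cmult[OF W bm])
qed

lemma commuting_series:
  assumes "commuting K W U" "bounded_op K W w" "bounded_op K U k" "summable (\<lambda>m. \<bar>c m\<bar> * k ^ m)"
  shows "commuting K W (op_series c U)"
  unfolding commuting_def
proof
  fix f assume f: "f \<in> bmf K"
  show "W (op_series c U f) = op_series c U (W f)"
    unfolding bounded_op_op_series[OF assms(2-4) f]
    by (simp add: op_series_def commutingD[OF commuting_funpow[OF assms(1,3)] f])
qed

text \<open>Identities such as additivity of \<open>diff_op\<close> in the weight hold only for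
  arguments in \<open>bmf K\<close>, so they cannot be rewritten under \<open>^^\<close>
  directly.\<close>

lemma funpow_cong_bmf:
  assumes "bounded_op K U k" "\<And>f. f \<in> bmf K \<Longrightarrow> U f = V f" "f \<in> bmf K"
  shows "(U ^^ m) f = (V ^^ m) f"
proof (induction m)
  case (Suc m)
  then show ?case
    using assms(2)[OF bounded_op_bmf[OF bounded_op_funpow[OF assms(1)] assms(3)], of m] by simp
qed simp

lemma op_series_cong:
  assumes "bounded_op K U k" "\<And>f. f \<in> bmf K \<Longrightarrow> U f = V f" "f \<in> bmf K"
  shows "op_series c U f = op_series c V f"
  unfolding op_series_def by (simp add: funpow_cong_bmf[OF assms])

section \<open>The operator exponential and its functional equation\<close>

definition op_exp :: "'c operator \<Rightarrow> 'c operator" where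
  "op_exp = op_series (\<lambda>m. 1 / fact m)"

lemma summable_exp_coeff: "summable (\<lambda>m. \<bar>1 / fact m\<bar> * k ^ m :: real)"
  using summable_exp_generic[of k] by (simp add: divide_inverse scaleR_conv_of_real)

lemma suminf_exp_coeff: "(\<Sum>m. \<bar>1 / fact m\<bar> * k ^ m) = exp (k :: real)"
  by (simp add: exp_def divide_inverse)

lemma bounded_op_exp: "bounded_op K U k \<Longrightarrow> bounded_op K (op_exp U) (exp k)"
  using bounded_op_series[OF _ summable_exp_coeff, of K U k]
  unfolding op_exp_def suminf_exp_coeff .

lemma commuting_exp:
  "commuting K W U \<Longrightarrow> bounded_op K W w \<Longrightarrow> bounded_op K U k \<Longrightarrow> commuting K W (op_exp U)"
  unfolding op_exp_def by (rule commuting_series[OF _ _ _ summable_exp_coeff])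

lemma op_exp_cong:
  "bounded_op K U k \<Longrightarrow> (\<And>f. f \<in> bmf K \<Longrightarrow> U f = V f) \<Longrightarrow> f \<in> bmf K \<Longrightarrow> op_exp U f = op_exp V f"
  unfolding op_exp_def by (rule op_series_cong)

lemma binomial_commuting:
  assumes U: "bounded_op K U k" and V: "bounded_op K V l" and UV: "commuting K U V"
    and f: "f \<in> bmf K"
  shows "((\<lambda>f A. U f A + V f A) ^^ m) f =
    (\<lambda>A. \<Sum>i\<le>m. real (m choose i) * (U ^^ i) ((V ^^ (m - i)) f) A)"
proof (induction m)
  case (Suc m)
  note Ui = bounded_op_funpow[OF U] and Vi = bounded_op_funpow[OF V]
  have bm: "(U ^^ i) ((V ^^ j) f) \<in> bmf K" for i j
    by (intro bounded_op_bmf[OF Ui] bounded_op_bmf[OF Vi] f)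
  have V_swap: "V ((U ^^ i) ((V ^^ j) f)) = (U ^^ i) ((V ^^ Suc j) f)" for i j
    using commutingD[OF commuting_funpow[OF commuting_sym[OF UV] U, of i]
        bounded_op_bmf[OF Vi[of j] f]] by simp
  let ?a = "\<lambda>i j A. (U ^^ i) ((V ^^ j) f) A"
  have "((\<lambda>f A. U f A + V f A) ^^ Suc m) f A =
      (\<Sum>i\<le>Suc m. real (Suc m choose i) * ?a i (Suc m - i) A)" for A
  proof -
    have "((\<lambda>f A. U f A + V f A) ^^ Suc m) f A =
        (\<Sum>i\<le>m. real (m choose i) * ?a (Suc i) (m - i) A) +
        (\<Sum>i\<le>m. real (m choose i) * ?a i (Suc (m - i)) A)"
    proof -
      let ?p = "\<lambda>A. \<Sum>i\<le>m. real (m choose i) * ?a i (m - i) A"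
      have "U ?p = (\<lambda>A. \<Sum>i\<le>m. real (m choose i) * ?a (Suc i) (m - i) A)"
        by (subst bounded_op_sum[OF U]) (auto simp: bmf_cmult bm bounded_op_cmult[OF U bm])
      moreover have "V ?p = (\<lambda>A. \<Sum>i\<le>m. real (m choose i) * ?a i (Suc (m - i)) A)"
        by (subst bounded_op_sum[OF V])
          (auto simp: bmf_cmult bm bounded_op_cmult[OF V bm] V_swap simp del: funpow.simps(2))
      ultimately show ?thesis
        by (subst funpow.simps(2)) (simp only: o_apply Suc)
    qed
    also have "(\<Sum>i\<le>m. real (m choose i) * ?a i (Suc (m - i)) A) =
        (\<Sum>i\<le>m. real (m choose i) * ?a i (Suc m - i) A)"
      by (intro sum.cong refl) (simp add: Suc_diff_le)
    also have "\<dots> = (\<Sum>i\<le>Suc m. real (m choose i) * ?a i (Suc m - i) A)"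
      by simp
    also have "\<dots> = ?a 0 (Suc m) A + (\<Sum>i\<le>m. real (m choose Suc i) * ?a (Suc i) (m - i) A)"
      by (subst sum.atMost_Suc_shift) simp
    also have "(\<Sum>i\<le>m. real (m choose i) * ?a (Suc i) (m - i) A) +
        (?a 0 (Suc m) A + (\<Sum>i\<le>m. real (m choose Suc i) * ?a (Suc i) (m - i) A)) =
        ?a 0 (Suc m) A + (\<Sum>i\<le>m. real (Suc m choose Suc i) * ?a (Suc i) (m - i) A)"
      by (simp add: sum.distrib[symmetric] distrib_right)
    also have "\<dots> = (\<Sum>i\<le>Suc m. real (Suc m choose i) * ?a i (Suc m - i) A)"
      by (subst sum.atMost_Suc_shift) simp
    finally show ?thesis .
  qed
  then show ?case by blast
qed simp

lemma infsum_nat_eq_suminf: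
  fixes f :: "nat \<Rightarrow> real" assumes "f summable_on UNIV" shows "infsum f UNIV = suminf f"
  using has_sum_imp_sums[OF has_sum_infsum[OF assms]] by (rule sums_unique)

text \<open>A Cauchy product for arrays, since the terms \<open>(U ^^ i) ((V ^^ j) f) A\<close> do
  not factor. Domination by \<open>u i * v j\<close> gives absolute summability over all pairs, so
  antidiagonal sums and row sums agree.\<close>

lemma double_series_diagonal:
  fixes a :: "nat \<Rightarrow> nat \<Rightarrow> real"
  assumes bd: "\<And>i j. \<bar>a i j\<bar> \<le> u i * v j" and u: "summable u" and v: "summable v"
    and pos: "\<And>i. 0 \<le> u i" "\<And>j. 0 \<le> v j"
  shows "(\<Sum>m. \<Sum>i\<le>m. a i (m - i)) = (\<Sum>i. \<Sum>j. a i j)"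
proof -
  define f where "f = (\<lambda>(i, j). a i j)"
  have us: "u summable_on UNIV" and vs: "v summable_on UNIV"
    using norm_summable_imp_summable_on[of u] norm_summable_imp_summable_on[of v] u v pos by simp_all
  have "Infinite_Sum.abs_summable_on (\<lambda>(i, j). u i * v j) (UNIV \<times> UNIV)"
    by (intro iffD2[OF Infinite_Sum.abs_summable_on_Sigma_iff])
      (auto simp: pos abs_mult infsum_nonneg infsum_cmult_right' intro!: summable_on_cmult_right summable_on_cmult_left us vs)
  then have "Infinite_Sum.abs_summable_on f (UNIV \<times> UNIV)"
    by (rule Infinite_Sum.abs_summable_on_comparison_test) (auto simp: f_def bd pos)
  then have fs: "f summable_on UNIV \<times> UNIV"
    by (rule Infinite_Sum.abs_summable_summable)
  have bij: "bij_betw (\<lambda>(m, i). (i, m - i)) (SIGMA m:UNIV. {..m}) (UNIV \<times> (UNIV :: nat set))"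
    by (rule bij_betwI[where g = "\<lambda>(i, j). (i + j, i)"]) auto
  let ?h = "\<lambda>(m, i). a i (m - i)"
  have h: "?h = (\<lambda>x. f ((\<lambda>(m, i). (i, m - i)) x))" by (auto simp: f_def)
  have hs: "?h summable_on (SIGMA m:UNIV. {..m})"
    unfolding h summable_on_reindex_bij_betw[OF bij] by (rule fs)
  have "(\<Sum>m. \<Sum>i\<le>m. a i (m - i)) = infsum (\<lambda>m. infsum (\<lambda>i. ?h (m, i)) {..m}) UNIV"
    using infsum_nat_eq_suminf[OF summable_on_Sigma_banach[OF hs]] by simp
  also have "\<dots> = infsum ?h (SIGMA m:UNIV. {..m})"
    by (rule infsum_Sigma_banach[OF hs])
  also have "\<dots> = infsum f (UNIV \<times> UNIV)"
    unfolding h by (rule infsum_reindex_bij_betw[OF bij])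
  also have "\<dots> = infsum (\<lambda>i. infsum (\<lambda>j. f (i, j)) UNIV) UNIV"
    by (rule infsum_Sigma_banach[OF fs, symmetric])
  also have "\<dots> = (\<Sum>i. infsum (\<lambda>j. f (i, j)) UNIV)"
    by (rule infsum_nat_eq_suminf[OF summable_on_Sigma_banach]) (use fs in simp)
  also have "\<dots> = (\<Sum>i. \<Sum>j. a i j)"
  proof (rule suminf_cong)
    fix i
    have "(\<lambda>j. a i j) summable_on UNIV"
      using norm_summable_imp_summable_on[OF summable_comparison_test[OF _ summable_mult[OF v, of "u i"]], of "a i"]
        bd by simp
    then show "infsum (\<lambda>j. f (i, j)) UNIV = (\<Sum>j. a i j)"
      using infsum_nat_eq_suminf by (simp add: f_def)
  qed
  finally show ?thesis .
qed

text \<open>By the binomial formula the term of degree \<open>m\<close> is the \<open>m\<close>-th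
  antidiagonal of the array \<open>(U ^^ i) ((V ^^ j) f) / (i! j!)\<close>, whose iterated row sums
  form the composition of the two exponentials.\<close>

lemma op_exp_plus:
  assumes U: "bounded_op K U k" and V: "bounded_op K V l" and UV: "commuting K U V"
    and f: "f \<in> bmf K"
  shows "op_exp (\<lambda>f A. U f A + V f A) f = op_exp U (op_exp V f)"
proof
  fix A
  obtain C where C: "0 \<le> C" "\<And>A. \<bar>f A\<bar> \<le> C" using bmf_bound[OF f] by blast
  note Ui = bounded_op_funpow[OF U] and Vi = bounded_op_funpow[OF V]
  have bmV: "(V ^^ j) f \<in> bmf K" for j by (rule bounded_op_bmf[OF Vi f])
  let ?a = "\<lambda>i j. (U ^^ i) ((V ^^ j) f) A / (fact i * fact j)"
  have bd: "\<bar>?a i j\<bar> \<le> (k ^ i / fact i) * (l ^ j / fact j * C)" for i j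
  proof -
    have "\<bar>(U ^^ i) ((V ^^ j) f) A\<bar> \<le> k ^ i * (l ^ j * C)"
      by (rule bounded_op_le[OF Ui bmV bounded_op_le[OF Vi f C(2)]])
    then show ?thesis by (simp add: divide_right_mono)
  qed
  have su: "summable (\<lambda>i. k ^ i / fact i)" and sv: "summable (\<lambda>j. l ^ j / fact j * C)"
    using summable_exp_coeff[of k] summable_mult2[OF summable_exp_coeff[of l], of C] by simp_all
  have "op_exp (\<lambda>f A. U f A + V f A) f A = (\<Sum>m. \<Sum>i\<le>m. ?a i (m - i))"
    unfolding op_exp_def op_series_def binomial_commuting[OF U V UV f]
    by (simp add: sum_distrib_left binomial_fact sum_divide_distrib)
  also have "\<dots> = (\<Sum>i. \<Sum>j. ?a i j)"
    using bounded_op_nonneg[OF U] bounded_op_nonneg[OF V] C(1)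
    by (intro double_series_diagonal[OF bd su sv]) auto
  also have "\<dots> = (\<Sum>i. 1 / fact i * (\<Sum>j. 1 / fact j * (U ^^ i) ((V ^^ j) f) A))"
  proof (intro suminf_cong)
    fix i
    have "summable (\<lambda>j. 1 / fact j * (U ^^ i) ((V ^^ j) f) A)"
      using op_series_summable[OF V summable_exp_coeff bounded_op_bmf[OF Ui f], of i A]
        commutingD[OF commuting_funpow[OF commuting_sym[OF commuting_funpow[OF UV V]] U] f] by simp
    from suminf_mult[OF this, of "1 / fact i"]
    show "(\<Sum>j. ?a i j) = 1 / fact i * (\<Sum>j. 1 / fact j * (U ^^ i) ((V ^^ j) f) A)"
      by (simp add: field_simps)
  qed
  also have "\<dots> = op_exp U (op_exp V f) A"
    unfolding op_exp_def op_series_def[of _ U]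
      bounded_op_op_series[OF Ui V summable_exp_coeff f] ..
  finally show "op_exp (\<lambda>f A. U f A + V f A) f A = op_exp U (op_exp V f) A" .
qed

lemma op_exp_scalar: "op_exp (\<lambda>f A. c * f A) f = (\<lambda>A. exp c * f A)"
proof
  fix A
  have "((\<lambda>f A. c * f A) ^^ m) f = (\<lambda>A. c ^ m * f A)" for m
    by (induction m) auto
  then have "op_exp (\<lambda>f A. c * f A) f A = (\<Sum>m. (c ^ m / fact m) * f A)"
    unfolding op_exp_def op_series_def by simp
  also have "\<dots> = exp c * f A"
    using suminf_mult2[OF summable_exp_generic[of c], of "f A"]
    by (simp add: exp_def divide_inverse mult.commute)
  finally show "op_exp (\<lambda>f A. c * f A) f A = exp c * f A" .
qed

lemma op_exp_taylor:
  assumes U: "bounded_op K U k" and f: "f \<in> bmf K" "\<And>A. \<bar>f A\<bar> \<le> C"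
  shows "op_exp U f A - f A - U f A = (\<Sum>m. 1 / fact (m + 2) * (U ^^ (m + 2)) f A)"
    and "\<bar>op_exp U f A - f A - U f A\<bar> \<le> (\<Sum>m. 1 / fact (m + 2) * k ^ (m + 2)) * C"
proof -
  note s = op_series_summable[OF U summable_exp_coeff f(1)]
  show *: "op_exp U f A - f A - U f A = (\<Sum>m. 1 / fact (m + 2) * (U ^^ (m + 2)) f A)"
    using suminf_split_initial_segment[OF s, of A 2]
    unfolding op_exp_def op_series_def by (simp add: numeral_2_eq_2)
  have s2: "summable (\<lambda>m. 1 / fact (m + 2) * k ^ (m + 2))"
    using summable_ignore_initial_segment[OF summable_exp_coeff[of k], of 2] by simp
  show "\<bar>op_exp U f A - f A - U f A\<bar> \<le> (\<Sum>m. 1 / fact (m + 2) * k ^ (m + 2)) * C"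
  proof -
    have "\<bar>1 / fact (m + 2) * (U ^^ (m + 2)) f A\<bar> \<le> 1 / fact (m + 2) * k ^ (m + 2) * C" for m
      using op_series_term[OF U f, of "\<lambda>m. 1 / fact m" "m + 2"] unfolding abs_divide by (simp del: fact_Suc funpow.simps power_Suc)
    then show ?thesis
      unfolding * suminf_mult2[OF s2]
      by (intro norm_suminf_le[where 'a = real, unfolded real_norm_def] summable_mult2[OF s2])
  qed
qed

section \<open>The function \<open>g\<close> and remainders of the exponential series\<close>

lemma g_coeff_bound: "0 \<le> x \<Longrightarrow> \<bar>real (m + 1) / fact (m + 2)\<bar> * x ^ m \<le> \<bar>1 / fact m\<bar> * x ^ m"
proof -
  have "real (m + 1) / fact (m + 2) = 1 / ((real m + 2) * fact m)"
    by (simp add: divide_simps)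
  also have "\<dots> \<le> 1 / fact m"
    by (simp add: divide_simps)
  finally show "0 \<le> x \<Longrightarrow> \<bar>real (m + 1) / fact (m + 2)\<bar> * x ^ m \<le> \<bar>1 / fact m\<bar> * x ^ m"
    by (intro mult_right_mono) simp_all
qed

lemma summable_g:
  assumes "0 \<le> x" shows "summable (\<lambda>m. real (m + 1) / fact (m + 2) * x ^ m)"
proof (rule summable_comparison_test[OF _ summable_exp_coeff[of x]], intro exI allI impI)
  show "norm (real (n + 1) / fact (n + 2) * x ^ n) \<le> \<bar>1 / fact n\<bar> * x ^ n" for n
    using g_coeff_bound[OF assms, of n] assms by (simp add: abs_mult)
qed

lemma g_mono: "0 \<le> x \<Longrightarrow> x \<le> y \<Longrightarrow> g x \<le> g y"
  unfolding g_def
  by (intro mult_left_mono suminf_le summable_g mult_left_mono power_mono) auto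

lemma g_ge_1:
  assumes "0 \<le> x" shows "1 \<le> g x"
proof -
  have "(\<Sum>m\<in>{0}. real (m + 1) / fact (m + 2) * x ^ m) \<le> (\<Sum>m. real (m + 1) / fact (m + 2) * x ^ m)"
    by (rule sum_le_suminf[OF summable_g[OF assms]]) (use assms in auto)
  then show ?thesis unfolding g_def by (simp add: numeral_2_eq_2)
qed

text \<open>The left-hand side is \<open>exp x - 1 - x\<close>; the estimate is termwise from
  \<open>1 \<le> m + 1\<close>. Thus \<open>g\<close> also controls the remainder of a Poisson
  exponential, not only Kerstan's remainder.\<close>

lemma suminf_fact_shift_le_g:
  assumes "0 \<le> x" shows "(\<Sum>m. 1 / fact (m + 2) * x ^ (m + 2)) \<le> x\<^sup>2 * g x / 2"
proof -
  have s: "summable (\<lambda>m. 1 / fact (m + 2) * x ^ (m + 2))"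
    using summable_ignore_initial_segment[OF summable_exp_coeff[of x], of 2] by simp
  have "(\<Sum>m. 1 / fact (m + 2) * x ^ (m + 2)) \<le> (\<Sum>m. x\<^sup>2 * (real (m + 1) / fact (m + 2) * x ^ m))"
  proof (rule suminf_le[OF _ s summable_mult[OF summable_g[OF assms]]])
    fix m
    have "1 * (x ^ (m + 2) / fact (m + 2)) \<le> real (m + 1) * (x ^ (m + 2) / fact (m + 2))"
      using assms by (intro mult_right_mono) auto
    then show "1 / fact (m + 2) * x ^ (m + 2) \<le> x\<^sup>2 * (real (m + 1) / fact (m + 2) * x ^ m)"
      by (simp add: power_add power2_eq_square algebra_simps del: fact_Suc)
  qed
  also have "\<dots> = x\<^sup>2 * g x / 2"
    unfolding suminf_mult[OF summable_g[OF assms]] g_def by simp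
  finally show ?thesis .
qed

lemma op_exp_remainder:
  assumes U: "bounded_op K U k" and \<phi>: "\<phi> \<in> bmf K" "\<And>A. \<bar>\<phi> A\<bar> \<le> C"
  shows "\<bar>op_exp U \<phi> A - \<phi> A - U \<phi> A\<bar> \<le> k\<^sup>2 * g k / 2 * C"
proof -
  have "0 \<le> C" using \<phi>(2)[of A] by linarith
  then show ?thesis
    using op_exp_taylor(2)[OF U \<phi>, of A]
      mult_right_mono[OF suminf_fact_shift_le_g[OF bounded_op_nonneg[OF U]], of C] by linarith
qed

text \<open>The Taylor coefficients of \<open>G(z) = (1 - (1 + z) exp (-z)) / z\<^sup>2\<close>,
  that is, of \<open>g (-z) / 2\<close>. Norm estimates see only absolute values, so
  \<open>G\<close> of an operator with norm at most \<open>k\<close> has norm at most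
  \<open>g k / 2\<close>.\<close>

definition kerstan_coeff :: "nat \<Rightarrow> real" where
  "kerstan_coeff m = (-1) ^ m * (real (m + 1) / fact (m + 2))"

lemma abs_kerstan_coeff: "\<bar>kerstan_coeff m\<bar> = real (m + 1) / fact (m + 2)"
  by (simp add: kerstan_coeff_def abs_mult power_abs)

lemma summable_kerstan: "0 \<le> k \<Longrightarrow> summable (\<lambda>m. \<bar>kerstan_coeff m\<bar> * k ^ m)"
  unfolding abs_kerstan_coeff by (rule summable_g)

lemma bounded_op_kerstan:
  "bounded_op K U k \<Longrightarrow> bounded_op K (op_series kerstan_coeff U) (g k / 2)"
  using bounded_op_series[OF _ summable_kerstan, of K U k] bounded_op_nonneg[of K U k]
  unfolding abs_kerstan_coeff g_def by simp

text \<open>The power series identity \<open>(1 + z) e\<^bsup>-z\<^esup> = 1 - z\<^sup>2 G(z)\<close>, whose coefficients are those of \<open>g\<close>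
  up to sign.\<close>

lemma kerstan_remainder:
  assumes U: "bounded_op K U k" and \<phi>: "\<phi> \<in> bmf K"
  defines "E \<equiv> op_exp (\<lambda>\<phi> A. (-1) * U \<phi> A)"
  shows "E \<phi> A + U (E \<phi>) A = \<phi> A - U (U (op_series kerstan_coeff U \<phi>)) A"
proof -
  define a where "a m = (U ^^ m) \<phi> A" for m
  define e where "e m = ((-1) ^ m / fact m :: real)" for m
  have k0: "0 \<le> k" by (rule bounded_op_nonneg[OF U])
  have pow: "((\<lambda>\<phi> A. (-1) * U \<phi> A) ^^ m) \<phi> = (\<lambda>A. (-1) ^ m * (U ^^ m) \<phi> A)" for m
  proof (induction m)
    case (Suc m)
    then show ?case
      using bounded_op_cmult[OF U bounded_op_bmf[OF bounded_op_funpow[OF U] \<phi>], of "(-1) ^ m" m]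
      by simp
  qed simp
  have ec: "\<bar>(-1) ^ m / fact m :: real\<bar> = \<bar>1 / fact m\<bar>" for m
    by (simp add: power_abs)
  have E: "E \<phi> = op_series (\<lambda>m. (-1) ^ m / fact m) U \<phi>"
    unfolding E_def op_exp_def op_series_def pow by simp
  have sc: "summable (\<lambda>m. \<bar>(-1) ^ m / fact m\<bar> * k ^ m)"
    unfolding ec by (rule summable_exp_coeff)
  have sE: "summable (\<lambda>m. e m * a m)"
    unfolding a_def e_def by (rule op_series_summable[OF U sc \<phi>])
  have sUE: "summable (\<lambda>m. e m * a (Suc m))"
    using op_series_summable[OF U sc bounded_op_bmf[OF U \<phi>], of A]
    unfolding a_def e_def by (simp add: funpow_swap1)
  \<comment> \<open>The linear terms \<open>- a 1\<close> here and \<open>a 1\<close> in the next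
    step cancel, so the deviation from the identity begins in degree 2.\<close>
  have 1: "E \<phi> A = a 0 - a 1 + (\<Sum>m. e (m + 2) * a (m + 2))"
    using suminf_split_initial_segment[OF sE, of 2]
    by (simp add: E op_series_def a_def e_def numeral_2_eq_2)
  have 2: "U (E \<phi>) A = a 1 + (\<Sum>m. e (m + 1) * a (m + 2))"
    using suminf_split_initial_segment[OF sUE, of 1]
    unfolding E bounded_op_op_series[OF U U sc \<phi>] by (simp add: a_def e_def)
  have UU: "bounded_op K (\<lambda>\<phi>. U (U \<phi>)) (k * k)" by (rule bounded_op_comp[OF U U])
  have 3: "U (U (op_series kerstan_coeff U \<phi>)) A = (\<Sum>m. kerstan_coeff m * a (m + 2))"
    unfolding bounded_op_op_series[OF UU U summable_kerstan[OF k0] \<phi>] by (simp add: a_def)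
  have "e (m + 2) * a (m + 2) + e (m + 1) * a (m + 2) = - (kerstan_coeff m * a (m + 2))" for m
  proof -
    have "e (m + 2) + e (m + 1) = - kerstan_coeff m"
      unfolding e_def kerstan_coeff_def by (simp add: divide_simps) (simp add: algebra_simps)
    then show ?thesis by (simp add: distrib_right[symmetric])
  qed
  then have "(\<Sum>m. e (m + 2) * a (m + 2)) + (\<Sum>m. e (m + 1) * a (m + 2)) =
      (\<Sum>m. - (kerstan_coeff m * a (m + 2)))"
    using suminf_add[OF summable_ignore_initial_segment[OF sE, of 2]
        summable_ignore_initial_segment[OF sUE, of 1]] by simp
  also have "\<dots> = - (\<Sum>m. kerstan_coeff m * a (m + 2))"
    using op_series_summable[OF U summable_kerstan[OF k0] bounded_op_bmf[OF UU \<phi>], of A]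
    by (intro suminf_minus) (simp add: a_def funpow_swap1)
  finally show ?thesis using 1 2 3 by (simp add: a_def)
qed

section \<open>Configurations\<close>

text \<open>Multisets replace point measures: all processes here have finitely many points, and
  adding a point becomes \<open>add_mset\<close>. The carrier is the whole type; points outside
  \<open>space S\<close> are discarded on passing to measures in
  \<open>config_measure\<close>.\<close>

definition config :: "'s measure \<Rightarrow> 's multiset measure" where
  "config S = sigma UNIV {{A. size (filter_mset (\<lambda>x. x \<in> B) A) = k} | B k. B \<in> sets S}"

lemma space_config [simp]: "space (config S) = UNIV"
  unfolding config_def by (rule space_measure_of) auto

lemma sets_config_cong: "sets S = sets S' \<Longrightarrow> config S = config S'"
  unfolding config_def by simp

lemma measurable_configI:
  assumes "\<And>B. B \<in> sets S \<Longrightarrow>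
    (\<lambda>\<omega>. size (filter_mset (\<lambda>x. x \<in> B) (f \<omega>))) \<in> measurable M (count_space UNIV)"
  shows "f \<in> measurable M (config S)"
  unfolding config_def
proof (rule measurable_measure_of)
  fix Y assume "Y \<in> {{A. size (filter_mset (\<lambda>x. x \<in> B) A) = k} | B k. B \<in> sets S}"
  then obtain B k where B: "B \<in> sets S" and Y: "Y = {A. size (filter_mset (\<lambda>x. x \<in> B) A) = k}" by blast
  have "f -` Y \<inter> space M = (\<lambda>\<omega>. size (filter_mset (\<lambda>x. x \<in> B) (f \<omega>))) -` {k} \<inter> space M"
    unfolding Y by auto
  then show "f -` Y \<inter> space M \<in> sets M"
    using measurable_sets[OF assms[OF B], of "{k}"] by simp
qed auto

lemma measurable_config_count:
  assumes "B \<in> sets S"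
  shows "(\<lambda>A. size (filter_mset (\<lambda>x. x \<in> B) A)) \<in> measurable (config S) (count_space UNIV)"
proof -
  have "{A. size (filter_mset (\<lambda>x. x \<in> B) A) = k} \<in> sets (config S)" for k
    unfolding config_def by (rule in_measure_of) (use assms in auto)
  then show ?thesis
    by (subst measurable_count_space_eq2_countable) (auto simp: vimage_def)
qed

lemma measurable_config_union [measurable (raw)]:
  assumes "f \<in> measurable M (config S)" "f' \<in> measurable M (config S)"
  shows "(\<lambda>\<omega>. f \<omega> + f' \<omega>) \<in> measurable M (config S)"
proof (rule measurable_configI)
  fix B assume "B \<in> sets S"
  note [measurable] = measurable_compose[OF assms(1) measurable_config_count[OF this]]
    measurable_compose[OF assms(2) measurable_config_count[OF this]]
  show "(\<lambda>\<omega>. size (filter_mset (\<lambda>x. x \<in> B) (f \<omega> + f' \<omega>))) \<in> measurable M (count_space UNIV)"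
    by simp
qed

lemma measurable_config_single [measurable (raw)]:
  assumes [measurable]: "f \<in> measurable M S" shows "(\<lambda>\<omega>. {#f \<omega>#}) \<in> measurable M (config S)"
proof (rule measurable_configI)
  fix B assume [measurable]: "B \<in> sets S"
  have "(\<lambda>\<omega>. size (filter_mset (\<lambda>x. x \<in> B) {#f \<omega>#})) = (\<lambda>\<omega>. if f \<omega> \<in> B then 1 else 0)"
    by auto
  then show "(\<lambda>\<omega>. size (filter_mset (\<lambda>x. x \<in> B) {#f \<omega>#})) \<in> measurable M (count_space UNIV)"
    by simp
qed

lemma measurable_config_add_mset [measurable (raw)]:
  assumes "f \<in> measurable M S" "f' \<in> measurable M (config S)"
  shows "(\<lambda>\<omega>. add_mset (f \<omega>) (f' \<omega>)) \<in> measurable M (config S)"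
  using measurable_config_union[OF measurable_config_single[OF assms(1)] assms(2)] by simp

lemma measurable_config_sum:
  assumes "\<And>i. i \<in> I \<Longrightarrow> f i \<in> measurable M (config S)"
  shows "(\<lambda>\<omega>. \<Sum>i\<in>I. f i \<omega>) \<in> measurable M (config S)"
  using assms
  by (induction I rule: infinite_finite_induct) (auto intro: measurable_config_union)

section \<open>Difference operators\<close>

context sigma_finite_measure
begin

abbreviation "BM \<equiv> bmf (config M)"

definition transl_op :: "('a \<Rightarrow> real) \<Rightarrow> 'a multiset operator" where
  "transl_op w \<phi> = (\<lambda>A. \<integral>x. w x * \<phi> (add_mset x A) \<partial>M)"

text \<open>Translation minus total mass, instead of the integral of a difference, so that
  boundedness, commutation and the splitting of the exponential follow from the operator calculus;
  \<open>diff_op_eq\<close> recovers the integral form.\<close>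

definition diff_op :: "('a \<Rightarrow> real) \<Rightarrow> 'a multiset operator" where
  "diff_op w = (\<lambda>\<phi> A. transl_op w \<phi> A + (- (\<integral>x. w x \<partial>M)) * \<phi> A)"

lemma measurable_transl [measurable (raw)]:
  "\<phi> \<in> BM \<Longrightarrow> (\<lambda>x. \<phi> (add_mset x A)) \<in> borel_measurable M"
  by (rule measurable_compose[OF _ bmf_measurable]) auto

lemma transl_integrable:
  assumes w: "integrable M w" and \<phi>: "\<phi> \<in> BM"
  shows "integrable M (\<lambda>x. w x * \<phi> (add_mset x A))"
proof -
  obtain C where C: "0 \<le> C" "\<And>A. \<bar>\<phi> A\<bar> \<le> C" using bmf_bound[OF \<phi>] by blast
  show ?thesis
  proof (rule Bochner_Integration.integrable_bound[OF integrable_mult_right[OF w, of C]])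
    show "(\<lambda>x. w x * \<phi> (add_mset x A)) \<in> borel_measurable M"
      using w \<phi> by measurable
    show "AE x in M. norm (w x * \<phi> (add_mset x A)) \<le> norm (C * w x)"
      using C mult_left_mono[OF C(2) abs_ge_zero] by (simp add: abs_mult mult.commute)
  qed
qed

lemma bounded_op_transl:
  assumes w: "integrable M w" shows "bounded_op (config M) (transl_op w) (\<integral>x. \<bar>w x\<bar> \<partial>M)"
proof -
  have le: "\<bar>transl_op w \<phi> A\<bar> \<le> (\<integral>x. \<bar>w x\<bar> \<partial>M) * C"
    if \<phi>: "\<phi> \<in> BM" and C: "\<forall>A. \<bar>\<phi> A\<bar> \<le> C" for \<phi> A C
  proof -
    have "\<bar>transl_op w \<phi> A\<bar> \<le> (\<integral>x. \<bar>w x * \<phi> (add_mset x A)\<bar> \<partial>M)"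
      unfolding transl_op_def by (rule integral_abs_bound)
    also have "\<dots> \<le> (\<integral>x. \<bar>w x\<bar> * C \<partial>M)"
      using w integrable_abs[OF transl_integrable[OF w \<phi>]] C
      by (intro integral_mono) (auto simp: abs_mult mult_left_mono)
    finally show ?thesis by simp
  qed
  have mem: "transl_op w \<phi> \<in> BM" if \<phi>: "\<phi> \<in> BM" for \<phi>
  proof -
    obtain C where C: "\<And>A. \<bar>\<phi> A\<bar> \<le> C" using bmf_bound[OF \<phi>] by blast
    have [measurable]: "\<phi> \<in> borel_measurable (config M)" by (rule bmf_measurable[OF \<phi>])
    have [measurable]: "w \<in> borel_measurable M" using w by simp
    show ?thesis
    proof (rule bmfI)
      show "transl_op w \<phi> \<in> borel_measurable (config M)"
        unfolding transl_op_def by measurable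
      show "\<bar>transl_op w \<phi> A\<bar> \<le> (\<integral>x. \<bar>w x\<bar> \<partial>M) * C" for A using le[OF \<phi>] C by blast
    qed
  qed
  have add: "transl_op w (\<lambda>A. \<phi> A + \<psi> A) = (\<lambda>A. transl_op w \<phi> A + transl_op w \<psi> A)"
    if "\<phi> \<in> BM" "\<psi> \<in> BM" for \<phi> \<psi>
    unfolding transl_op_def
    by (simp add: distrib_left Bochner_Integration.integral_add transl_integrable w that)
  have scale: "transl_op w (\<lambda>A. c * \<phi> A) = (\<lambda>A. c * transl_op w \<phi> A)" if "\<phi> \<in> BM" for \<phi> c
    unfolding transl_op_def by (simp add: mult.left_commute)
  show ?thesis
    unfolding bounded_op_def using le mem add scale by auto
qed

text \<open>Fubini's theorem, together with the fact that the order in which two points are added to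
  a multiset does not matter.\<close>

lemma commuting_transl:
  assumes v: "integrable M v" and w: "integrable M w"
  shows "commuting (config M) (transl_op v) (transl_op w)"
  unfolding commuting_def
proof
  fix \<phi> assume \<phi>: "\<phi> \<in> BM"
  interpret P: pair_sigma_finite M M ..
  have [measurable]: "\<phi> \<in> borel_measurable (config M)" by (rule bmf_measurable[OF \<phi>])
  have [measurable]: "w \<in> borel_measurable M" "v \<in> borel_measurable M" using w v by auto
  obtain C where C: "0 \<le> C" "\<And>A. \<bar>\<phi> A\<bar> \<le> C" using bmf_bound[OF \<phi>] by blast
  show "transl_op v (transl_op w \<phi>) = transl_op w (transl_op v \<phi>)"
  proof
    fix A
    let ?f = "\<lambda>x y. w x * v y * \<phi> (add_mset x (add_mset y A))"
    have "integrable (M \<Otimes>\<^sub>M M) (\<lambda>(x, y). w x * v y)"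
      using v w by (intro P.Fubini_integrable) (auto simp: abs_mult)
    then have "integrable (M \<Otimes>\<^sub>M M) (\<lambda>z. C * (\<lambda>(x, y). w x * v y) z)" by (rule integrable_mult_right)
    then have int: "integrable (M \<Otimes>\<^sub>M M) (\<lambda>(x, y). ?f x y)"
    proof (rule Bochner_Integration.integrable_bound)
      show "(\<lambda>(x, y). ?f x y) \<in> borel_measurable (M \<Otimes>\<^sub>M M)" by measurable
      show "AE z in M \<Otimes>\<^sub>M M. norm (case z of (x, y) \<Rightarrow> ?f x y) \<le> norm (C * (\<lambda>(x, y). w x * v y) z)"
        using C by (auto simp: abs_mult mult.commute intro!: AE_I2 mult_mono)
    qed
    have "transl_op v (transl_op w \<phi>) A = (\<integral>y. (\<integral>x. ?f x y \<partial>M) \<partial>M)"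
      unfolding transl_op_def
      by (simp add: Bochner_Integration.integral_mult_right_zero[symmetric] ac_simps del: Bochner_Integration.integral_mult_right_zero)
    also have "\<dots> = (\<integral>x. (\<integral>y. ?f x y \<partial>M) \<partial>M)"
      by (rule P.Fubini_integral[OF int])
    also have "\<dots> = transl_op w (transl_op v \<phi>) A"
      unfolding transl_op_def
      by (simp add: Bochner_Integration.integral_mult_right_zero[symmetric] ac_simps add_mset_commute[of _ _ A] del: Bochner_Integration.integral_mult_right_zero)
    finally show "transl_op v (transl_op w \<phi>) A = transl_op w (transl_op v \<phi>) A" .
  qed
qed

lemma bounded_op_scalar: "bounded_op K (\<lambda>\<phi> A. c * \<phi> A) \<bar>c\<bar>"
  using bounded_op_scale[OF bounded_op_id, of K c] by simp

lemma bounded_op_diff_op: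
  assumes "integrable M w" shows "bounded_op (config M) (diff_op w) (2 * (\<integral>x. \<bar>w x\<bar> \<partial>M))"
  unfolding diff_op_def
  by (rule bounded_op_mono[OF bounded_op_plus[OF bounded_op_transl[OF assms] bounded_op_scalar]])
    (use integral_abs_bound[of M w] in simp)

lemma commuting_diff_op:
  assumes v: "integrable M v" and w: "integrable M w"
  shows "commuting (config M) (diff_op v) (diff_op w)"
proof -
  note b = bounded_op_diff_op[OF v] bounded_op_transl[OF w] bounded_op_transl[OF v]
  have "commuting (config M) (transl_op w) (diff_op v)"
    unfolding diff_op_def
    by (rule commuting_plus[OF commuting_transl[OF w v]
          commuting_scale[OF commuting_id b(2) bounded_op_id] b(2) b(3) bounded_op_scalar])
  then show ?thesis
    by (subst (2) diff_op_def)
      (rule commuting_plus[OF commuting_sym commuting_scale[OF commuting_id b(1) bounded_op_id]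
          b(1,2) bounded_op_scalar])
qed

lemma diff_op_eq:
  assumes "integrable M w" "\<phi> \<in> BM"
  shows "diff_op w \<phi> A = (\<integral>x. w x * (\<phi> (add_mset x A) - \<phi> A) \<partial>M)"
  unfolding diff_op_def transl_op_def right_diff_distrib
  by (subst Bochner_Integration.integral_diff[OF transl_integrable[OF assms]])
    (use assms in auto)

lemma diff_op_add:
  assumes "integrable M v" "integrable M w" "\<phi> \<in> BM"
  shows "diff_op (\<lambda>x. v x + w x) \<phi> = (\<lambda>A. diff_op v \<phi> A + diff_op w \<phi> A)"
  unfolding diff_op_def transl_op_def
  by (auto simp: algebra_simps assms transl_integrable)

lemma diff_op_cmult:
  "diff_op (\<lambda>x. c * w x) \<phi> = (\<lambda>A. c * diff_op w \<phi> A)"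
  unfolding diff_op_def transl_op_def by (auto simp: mult.assoc right_diff_distrib)

lemma diff_op_const: "diff_op w (\<lambda>A. c) = (\<lambda>A. 0)"
  unfolding diff_op_def transl_op_def by simp

abbreviation exp_op :: "('a \<Rightarrow> real) \<Rightarrow> 'a multiset operator" where
  "exp_op w \<equiv> op_exp (diff_op w)"

lemma bounded_op_exp_op:
  "integrable M w \<Longrightarrow> bounded_op (config M) (exp_op w) (exp (2 * (\<integral>x. \<bar>w x\<bar> \<partial>M)))"
  by (rule bounded_op_exp[OF bounded_op_diff_op])

lemma exp_op_const: "exp_op w (\<lambda>A. c) = (\<lambda>A. c)"
proof -
  have z: "(diff_op w ^^ m) (\<lambda>A. c) = (\<lambda>A. if m = 0 then c else 0)" for m
    by (induction m) (auto simp: diff_op_const)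
  have "(\<Sum>m. 1 / fact m * (if m = 0 then c else 0)) = c"
    by (subst suminf_finite[of "{0}"]) auto
  then show ?thesis unfolding op_exp_def op_series_def z by simp
qed

lemma exp_op_add:
  assumes v: "integrable M v" and w: "integrable M w" and \<phi>: "\<phi> \<in> BM"
  shows "exp_op (\<lambda>x. v x + w x) \<phi> = exp_op v (exp_op w \<phi>)"
proof -
  note b = bounded_op_diff_op[OF v] bounded_op_diff_op[OF w]
  have "exp_op (\<lambda>x. v x + w x) \<phi> = op_exp (\<lambda>\<phi> A. diff_op v \<phi> A + diff_op w \<phi> A) \<phi>"
    by (rule op_exp_cong[OF bounded_op_diff_op]) (use v w \<phi> in \<open>auto simp: diff_op_add\<close>)
  also have "\<dots> = exp_op v (exp_op w \<phi>)"
    by (rule op_exp_plus[OF b commuting_diff_op[OF v w] \<phi>])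
  finally show ?thesis .
qed

lemma exp_op_zero: "exp_op (\<lambda>x. 0) \<phi> = \<phi>"
proof -
  have "diff_op (\<lambda>x. 0) = (\<lambda>\<phi> A. 0 * \<phi> A)"
    unfolding diff_op_def transl_op_def by simp
  then have "exp_op (\<lambda>x. 0) \<phi> = (\<lambda>A. exp 0 * \<phi> A)"
    using op_exp_scalar[of 0 \<phi>] by (simp only:)
  then show ?thesis by simp
qed

lemma commuting_exp_op:
  assumes v: "integrable M v" and w: "integrable M w"
  shows "commuting (config M) (diff_op v) (exp_op w)"
  by (rule commuting_exp[OF commuting_diff_op[OF v w] bounded_op_diff_op[OF v] bounded_op_diff_op[OF w]])

text \<open>Multiples of the identity commute with translation, so the exponential factors into the
  Poisson mixture \<open>exp (-m) * \<Sum>k. T ^^ k / k!\<close>. In this form it is visibly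
  positive for \<open>w \<ge> 0\<close>, which the series in \<open>diff_op\<close> hides.\<close>

lemma exp_op_transl:
  assumes w: "integrable M w" and \<phi>: "\<phi> \<in> BM"
  shows "exp_op w \<phi> A = exp (- (\<integral>x. w x \<partial>M)) * op_exp (transl_op w) \<phi> A"
proof -
  let ?m = "- (\<integral>x. w x \<partial>M)"
  have "exp_op w \<phi> = op_exp (transl_op w) (op_exp (\<lambda>\<phi> A. ?m * \<phi> A) \<phi>)"
    unfolding diff_op_def
    by (rule op_exp_plus[OF bounded_op_transl[OF w] bounded_op_scalar
          commuting_scale[OF commuting_id bounded_op_transl[OF w] bounded_op_id] \<phi>])
  then show ?thesis
    unfolding op_exp_scalar bounded_op_cmult[OF bounded_op_exp[OF bounded_op_transl[OF w]] \<phi>]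
    by simp
qed

lemma exp_op_nonneg:
  assumes w: "integrable M w" and w0: "\<And>x. x \<in> space M \<Longrightarrow> 0 \<le> w x"
    and \<phi>: "\<phi> \<in> BM" and \<phi>0: "\<And>A. 0 \<le> \<phi> A"
  shows "0 \<le> exp_op w \<phi> A"
proof -
  have pos: "0 \<le> (transl_op w ^^ m) \<phi> A" for m A
  proof (induction m arbitrary: A)
    case (Suc m)
    then show ?case
      by (simp add: transl_op_def[of w "(transl_op w ^^ m) \<phi>"] w0 Bochner_Integration.integral_nonneg)
  qed (simp add: \<phi>0)
  have "0 \<le> op_exp (transl_op w) \<phi> A"
    unfolding op_exp_def op_series_def
    by (rule suminf_nonneg[OF op_series_summable[OF bounded_op_transl[OF w] summable_exp_coeff \<phi>]])
      (simp add: pos)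
  then show ?thesis unfolding exp_op_transl[OF w \<phi>] by simp
qed

lemma exp_op_mono:
  assumes w: "integrable M w" "\<And>x. x \<in> space M \<Longrightarrow> 0 \<le> w x"
    and \<phi>: "\<phi> \<in> BM" "\<psi> \<in> BM" and le: "\<And>A. \<phi> A \<le> \<psi> A"
  shows "exp_op w \<phi> A \<le> exp_op w \<psi> A"
  using exp_op_nonneg[OF w bmf_diff[OF \<phi>(2,1)], of A] le
  by (simp add: bounded_op_diff[OF bounded_op_exp_op[OF w(1)] \<phi>(2,1)])

text \<open>Positivity and preservation of constants force norm 1, whereas the power series alone
  yields \<open>exp (2 * (\<integral>x. \<bar>w x\<bar> \<partial>M))\<close>. Products of many
  factors need the bound 1.\<close>

lemma bounded_op_exp_op_contraction:
  assumes w: "integrable M w" "\<And>x. x \<in> space M \<Longrightarrow> 0 \<le> w x"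
  shows "bounded_op (config M) (exp_op w) 1"
proof -
  have "\<bar>exp_op w \<phi> A\<bar> \<le> C" if \<phi>: "\<phi> \<in> BM" and C: "\<forall>A. \<bar>\<phi> A\<bar> \<le> C" for \<phi> C A
  proof -
    have "exp_op w \<phi> A \<le> exp_op w (\<lambda>A. C) A" "exp_op w (\<lambda>A. - C) A \<le> exp_op w \<phi> A"
      using C by (auto intro!: exp_op_mono w \<phi> bmf_const simp: abs_le_iff minus_le_iff)
    then show ?thesis by (simp add: exp_op_const)
  qed
  then show ?thesis
    using bounded_op_exp_op[OF w(1)] unfolding bounded_op_def by auto
qed

end

section \<open>The chaos bound for products of difference operators\<close>

text \<open>Supplies a quadratic error that is uniform in \<open>u\<close> and \<open>h\<close>, for
  comparing increments with those of a power without derivatives.\<close>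

lemma power_Suc_taylor_bound:
  "\<exists>K\<ge>0. \<forall>u h :: real. 0 \<le> u \<and> u \<le> 1 \<and> 0 \<le> h \<and> h \<le> 1 \<longrightarrow>
    (u + h) ^ Suc m \<le> u ^ Suc m + real (Suc m) * h * u ^ m + K * h\<^sup>2"
proof (induction m)
  case 0
  show ?case by (rule exI[where x = 0]) simp
next
  case (Suc m)
  then obtain K where K: "0 \<le> K" "\<And>u h :: real. 0 \<le> u \<Longrightarrow> u \<le> 1 \<Longrightarrow> 0 \<le> h \<Longrightarrow> h \<le> 1 \<Longrightarrow>
    (u + h) ^ Suc m \<le> u ^ Suc m + real (Suc m) * h * u ^ m + K * h\<^sup>2" by blast
  have "(u + h) ^ Suc (Suc m) \<le> u ^ Suc (Suc m) + real (Suc (Suc m)) * h * u ^ Suc m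
      + (real (Suc m) + 2 * K) * h\<^sup>2" if uh: "0 \<le> u" "u \<le> 1" "0 \<le> h" "h \<le> 1" for u h :: real
  proof -
    have "(u + h) ^ Suc (Suc m) = (u + h) * (u + h) ^ Suc m" by simp
    also have "\<dots> \<le> (u + h) * (u ^ Suc m + real (Suc m) * h * u ^ m + K * h\<^sup>2)"
      by (rule mult_left_mono[OF K(2)]) (use uh in auto)
    also have "\<dots> = u ^ Suc (Suc m) + real (Suc (Suc m)) * h * u ^ Suc m
        + (real (Suc m) * u ^ m * h\<^sup>2 + (u + h) * K * h\<^sup>2)"
      by (simp add: algebra_simps power2_eq_square)
    also have "real (Suc m) * u ^ m * h\<^sup>2 + (u + h) * K * h\<^sup>2 \<le> real (Suc m) * 1 * h\<^sup>2 + 2 * K * h\<^sup>2"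
      using uh K(1) by (intro add_mono mult_mono mult_right_mono power_le_one) auto
    finally show ?thesis by (simp add: algebra_simps)
  qed
  then show ?case using K(1) by (intro exI[where x = "real (Suc m) + 2 * K"]) auto
qed

text \<open>The integrated form of \<open>F' u \<ge> c * u ^ m\<close> for an \<open>F\<close> whose
  differentiability is not at hand: quadratic errors of the increments disappear when the interval
  is subdivided finely.\<close>

lemma increment_lower_bound:
  fixes F :: "real \<Rightarrow> real"
  assumes s: "0 \<le> s" "s \<le> 1" and c: "0 \<le> c"
    and F: "\<And>u h. 0 \<le> u \<Longrightarrow> 0 \<le> h \<Longrightarrow> u + h \<le> s \<Longrightarrow> h * u ^ m * c - K * h\<^sup>2 \<le> F (u + h) - F u"
  shows "c * s ^ Suc m / real (Suc m) \<le> F s - F 0"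
proof -
  obtain K' where K': "0 \<le> K'" "\<And>u h :: real. 0 \<le> u \<Longrightarrow> u \<le> 1 \<Longrightarrow> 0 \<le> h \<Longrightarrow> h \<le> 1 \<Longrightarrow>
    (u + h) ^ Suc m \<le> u ^ Suc m + real (Suc m) * h * u ^ m + K' * h\<^sup>2"
    using power_Suc_taylor_bound[of m] by blast
  define H where "H u = F u - c * u ^ Suc m / real (Suc m)" for u
  define L where "L = K + c * K' / real (Suc m)"
  have inc: "- L * h\<^sup>2 \<le> H (u + h) - H u" if uh: "0 \<le> u" "0 \<le> h" "u + h \<le> s" for u h
  proof -
    have "c * (u + h) ^ Suc m / real (Suc m) \<le>
        c * (u ^ Suc m + real (Suc m) * h * u ^ m + K' * h\<^sup>2) / real (Suc m)"
      using uh s c K'(2)[of u h] by (intro divide_right_mono mult_left_mono) auto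
    also have "\<dots> = c * u ^ Suc m / real (Suc m) + h * u ^ m * c + c * K' / real (Suc m) * h\<^sup>2"
    proof -
      have "c * (x + N * h * y + K' * h\<^sup>2) / N = c * x / N + h * y * c + c * K' / N * h\<^sup>2"
        if "N \<noteq> 0" for x y N
        using that by (simp add: field_simps)
      from this[of "real (Suc m)"] show ?thesis by (simp del: power_Suc of_nat_Suc)
    qed
    finally show ?thesis
      using F[OF uh] unfolding H_def L_def by (simp add: algebra_simps)
  qed
  \<comment> \<open>On \<open>n + 1\<close> pieces of length \<open>s / (n + 1)\<close> the errors
    \<open>L * h\<^sup>2\<close> add up to \<open>L * s\<^sup>2 / (n + 1)\<close>, which tends to
    0.\<close>
  have "- L * s\<^sup>2 / real (Suc n) \<le> H s - H 0" for n
  proof -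
    let ?N = "real (Suc n)"
    let ?h = "s / ?N"
    have "real (Suc n) * (- L * ?h\<^sup>2) \<le> (\<Sum>i<Suc n. H (real (Suc i) * ?h) - H (real i * ?h))"
    proof -
      have "- L * ?h\<^sup>2 \<le> H (real (Suc i) * ?h) - H (real i * ?h)" if "i < Suc n" for i
      proof -
        have "real i * ?h + ?h = (real i + 1) * ?h" by (simp only: distrib_right mult_1_left)
        also have "\<dots> \<le> ?N * ?h" using that s by (intro mult_right_mono) auto
        also have "\<dots> = s" by simp
        finally have *: "real i * ?h + ?h \<le> s" .
        have "real (Suc i) * ?h = real i * ?h + ?h"
          by (simp only: of_nat_Suc distrib_right mult_1_left add.commute)
        moreover have "- L * ?h\<^sup>2 \<le> H (real i * ?h + ?h) - H (real i * ?h)"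
          by (rule inc[OF _ _ *]) (use s in auto)
        ultimately show ?thesis by (simp only:)
      qed
      then have "(\<Sum>i<Suc n. - L * ?h\<^sup>2) \<le> (\<Sum>i<Suc n. H (real (Suc i) * ?h) - H (real i * ?h))"
        by (intro sum_mono) auto
      then show ?thesis by simp
    qed
    also have "\<dots> = H (?N * ?h) - H 0"
      by (subst sum_lessThan_telescope[of "\<lambda>i. H (real i * ?h)"]) simp
    finally show ?thesis by (simp add: power2_eq_square divide_simps)
  qed
  moreover have "(\<lambda>n. - L * s\<^sup>2 / real (Suc n)) \<longlonglongrightarrow> 0"
    using tendsto_mult_right_zero[OF lim_1_over_n[THEN LIMSEQ_Suc], of "- L * s\<^sup>2"] by simp
  ultimately have "0 \<le> H s - H 0"
    by (intro LIMSEQ_le_const2[where X = "\<lambda>n. - L * s\<^sup>2 / real (Suc n)"]) auto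
  then show ?thesis unfolding H_def by simp
qed

text \<open>The discriminant criterion behind Cauchy-Schwarz: \<open>t = R / Q\<close> minimises the
  quadratic. If \<open>Q = 0\<close> and \<open>R \<noteq> 0\<close>, the witness
  \<open>(G + 1) / (2 * R)\<close> gives the value -1.\<close>

lemma quadratic_nonneg_imp:
  fixes Q R G :: real
  assumes "\<And>t. 0 \<le> t\<^sup>2 * Q - 2 * t * R + G" and Q: "0 \<le> Q"
  shows "R\<^sup>2 \<le> Q * G"
proof (cases "Q = 0")
  case True
  have "R = 0"
  proof (rule ccontr)
    assume "R \<noteq> 0"
    then show False using assms(1)[of "(G + 1) / (2 * R)"] True by (simp add: field_simps)
  qed
  then show ?thesis using True by simp
next
  case False
  with Q have "0 < Q" by simp
  then show ?thesis
    using assms(1)[of "R / Q"] by (simp add: field_simps power2_eq_square)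
qed

section \<open>The squared gradient of the Poisson semigroup\<close>

context sigma_finite_measure
begin

text \<open>The carre du champ of the generator \<open>diff_op l\<close>, from the pointwise
  identity \<open>b\<^sup>2 - a\<^sup>2 - 2 a (b - a) = (b - a)\<^sup>2\<close>.\<close>

lemma diff_op_square:
  assumes l: "integrable M l" and \<psi>: "\<psi> \<in> BM"
  shows "integrable M (\<lambda>x. l x * (\<psi> (add_mset x A) - \<psi> A)\<^sup>2)"
    and "diff_op l (\<lambda>A. (\<psi> A)\<^sup>2) A - 2 * \<psi> A * diff_op l \<psi> A =
      (\<integral>x. l x * (\<psi> (add_mset x A) - \<psi> A)\<^sup>2 \<partial>M)"
proof -
  have sq: "(\<lambda>A. (\<psi> A)\<^sup>2) \<in> BM" by (rule bmf_power2[OF \<psi>])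
  have i1: "integrable M (\<lambda>x. l x * ((\<psi> (add_mset x A))\<^sup>2 - (\<psi> A)\<^sup>2))"
    unfolding right_diff_distrib
    by (intro Bochner_Integration.integrable_diff transl_integrable[OF l sq] integrable_mult_left l)
  have i2: "integrable M (\<lambda>x. l x * (\<psi> (add_mset x A) - \<psi> A))"
    unfolding right_diff_distrib
    by (intro Bochner_Integration.integrable_diff transl_integrable[OF l \<psi>] integrable_mult_left l)
  have eq: "(\<lambda>x. l x * (\<psi> (add_mset x A) - \<psi> A)\<^sup>2) =
    (\<lambda>x. l x * ((\<psi> (add_mset x A))\<^sup>2 - (\<psi> A)\<^sup>2) - 2 * \<psi> A * (l x * (\<psi> (add_mset x A) - \<psi> A)))"
    by (auto simp: algebra_simps power2_eq_square)
  show "integrable M (\<lambda>x. l x * (\<psi> (add_mset x A) - \<psi> A)\<^sup>2)"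
    unfolding eq by (intro Bochner_Integration.integrable_diff integrable_mult_right i1 i2)
  show "diff_op l (\<lambda>A. (\<psi> A)\<^sup>2) A - 2 * \<psi> A * diff_op l \<psi> A =
      (\<integral>x. l x * (\<psi> (add_mset x A) - \<psi> A)\<^sup>2 \<partial>M)"
    unfolding eq diff_op_eq[OF l sq] diff_op_eq[OF l \<psi>]
    by (subst Bochner_Integration.integral_diff) (use i1 i2 in auto)
qed

lemma integrable_mult_unit:
  assumes "integrable M l" "f \<in> borel_measurable M" "\<And>x. \<bar>f x\<bar> \<le> (1 :: real)"
  shows "integrable M (\<lambda>x. f x * l x)"
proof (rule Bochner_Integration.integrable_bound[OF assms(1)])
  show "AE x in M. norm (f x * l x) \<le> norm (l x)"
    using mult_right_mono[OF assms(3) abs_ge_zero] by (simp add: abs_mult)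
qed (use assms in auto)

lemma diff_op_cauchy_schwarz:
  assumes l: "integrable M l" "\<And>x. x \<in> space M \<Longrightarrow> 0 \<le> l x"
    and f: "f \<in> borel_measurable M" "\<And>x. \<bar>f x\<bar> \<le> 1" and \<psi>: "\<psi> \<in> BM"
  shows "(diff_op (\<lambda>x. f x * l x) \<psi> A)\<^sup>2 \<le>
    (\<integral>x. (f x)\<^sup>2 * l x \<partial>M) * (diff_op l (\<lambda>A. (\<psi> A)\<^sup>2) A - 2 * \<psi> A * diff_op l \<psi> A)"
proof (rule quadratic_nonneg_imp)
  have fl: "integrable M (\<lambda>x. f x * l x)" by (rule integrable_mult_unit[OF l(1) f])
  have i1: "integrable M (\<lambda>x. (f x)\<^sup>2 * l x)"
    using f by (intro integrable_mult_unit[OF l(1)]) (auto simp: power_le_one abs_square_le_1[symmetric] abs_le_square_iff)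
  have i2: "integrable M (\<lambda>x. f x * l x * (\<psi> (add_mset x A) - \<psi> A))"
    unfolding right_diff_distrib
    by (intro Bochner_Integration.integrable_diff transl_integrable[OF fl \<psi>] integrable_mult_left fl)
  note i3 = diff_op_square(1)[OF l(1) \<psi>, of A]
  show "0 \<le> (\<integral>x. (f x)\<^sup>2 * l x \<partial>M)" using l(2) by (intro Bochner_Integration.integral_nonneg) auto
  fix t
  have "0 \<le> (\<integral>x. l x * (t * f x - (\<psi> (add_mset x A) - \<psi> A))\<^sup>2 \<partial>M)"
    using l(2) by (intro Bochner_Integration.integral_nonneg) auto
  also have "(\<lambda>x. l x * (t * f x - (\<psi> (add_mset x A) - \<psi> A))\<^sup>2) =
    (\<lambda>x. t\<^sup>2 * ((f x)\<^sup>2 * l x) - 2 * t * (f x * l x * (\<psi> (add_mset x A) - \<psi> A)) +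
      l x * (\<psi> (add_mset x A) - \<psi> A)\<^sup>2)"
    by (auto simp: algebra_simps power2_eq_square)
  also have "(\<integral>x. \<dots> x \<partial>M) = t\<^sup>2 * (\<integral>x. (f x)\<^sup>2 * l x \<partial>M) - 2 * t * diff_op (\<lambda>x. f x * l x) \<psi> A +
      (diff_op l (\<lambda>A. (\<psi> A)\<^sup>2) A - 2 * \<psi> A * diff_op l \<psi> A)"
    unfolding diff_op_square(2)[OF l(1) \<psi>] diff_op_eq[OF fl \<psi>]
    by (subst Bochner_Integration.integral_add Bochner_Integration.integral_diff;
        (intro Bochner_Integration.integrable_diff integrable_mult_right i1 i2 i3)?)
      (subst Bochner_Integration.integral_diff;
        (intro Bochner_Integration.integrable_diff integrable_mult_right i1 i2 i3)?; simp)
  finally show "0 \<le> t\<^sup>2 * (\<integral>x. (f x)\<^sup>2 * l x \<partial>M) - 2 * t * diff_op (\<lambda>x. f x * l x) \<psi> A +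
      (diff_op l (\<lambda>A. (\<psi> A)\<^sup>2) A - 2 * \<psi> A * diff_op l \<psi> A)" .
qed

text \<open>Cauchy-Schwarz combined with the expansion of \<open>exp (h D)\<close> to first order.
  The point is that \<open>K\<close> depends neither on \<open>\<psi>\<close> nor on
  \<open>h\<close> or \<open>A\<close>: in the interpolation the function changes with every
  subinterval. The gradient is taken of the image of \<open>\<psi>\<close>, which is the function at
  the left end of the subinterval.\<close>

lemma exp_op_square_increment:
  assumes l: "integrable M l" "\<And>x. x \<in> space M \<Longrightarrow> 0 \<le> l x"
    and f: "f \<in> borel_measurable M" "\<And>x. \<bar>f x\<bar> \<le> 1"
  shows "\<exists>K. \<forall>\<psi>\<in>BM. (\<forall>A. \<bar>\<psi> A\<bar> \<le> C) \<longrightarrow> (\<forall>h A. 0 \<le> h \<and> h \<le> 1 \<longrightarrow>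
    h * (diff_op (\<lambda>x. f x * l x) (exp_op (\<lambda>x. h * l x) \<psi>) A)\<^sup>2 - K * h\<^sup>2 \<le>
    (\<integral>x. (f x)\<^sup>2 * l x \<partial>M) *
      (exp_op (\<lambda>x. h * l x) (\<lambda>A. (\<psi> A)\<^sup>2) A - (exp_op (\<lambda>x. h * l x) \<psi> A)\<^sup>2))"
proof -
  define k where "k = 2 * (\<integral>x. \<bar>l x\<bar> \<partial>M)"
  define R where "R = k\<^sup>2 * g k / 2"
  define Q where "Q = (\<integral>x. (f x)\<^sup>2 * l x \<partial>M)"
  \<comment> \<open>The first summand is the remainder of the semigroup on
    \<open>\<psi>\<^sup>2\<close>, the other two come from squaring its expansion on
    \<open>\<psi>\<close>. \<open>K\<close> adds the cost of replacing the gradient of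
    \<open>\<psi>\<close> by that of its image, a sum of two gradients times their
    difference.\<close>
  define K3 where "K3 = R * C\<^sup>2 + 2 * R * C\<^sup>2 + ((k + R) * C)\<^sup>2"
  define K where "K = Q * K3 + 2 * (k * C) * (k * ((k + R) * C))"
  have k0: "0 \<le> k" unfolding k_def by simp
  have R0: "0 \<le> R" using k0 g_ge_1[OF k0] unfolding R_def by simp
  have Q0: "0 \<le> Q" unfolding Q_def using l(2) by (intro Bochner_Integration.integral_nonneg) auto
  have fl: "integrable M (\<lambda>x. f x * l x)" by (rule integrable_mult_unit[OF l(1) f])
  have bD: "bounded_op (config M) (diff_op l) k"
    unfolding k_def by (rule bounded_op_diff_op[OF l(1)])
  have bf: "bounded_op (config M) (diff_op (\<lambda>x. f x * l x)) k"
  proof (rule bounded_op_mono[OF bounded_op_diff_op[OF fl]])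
    have "(\<integral>x. \<bar>f x * l x\<bar> \<partial>M) \<le> (\<integral>x. \<bar>l x\<bar> \<partial>M)"
      using l(1) integrable_abs[OF fl] mult_right_mono[OF f(2) abs_ge_zero]
      by (intro integral_mono) (auto simp: abs_mult)
    then show "2 * (\<integral>x. \<bar>f x * l x\<bar> \<partial>M) \<le> k" unfolding k_def by simp
  qed
  have rem: "\<bar>exp_op (\<lambda>x. h * l x) \<phi> A - \<phi> A - h * diff_op l \<phi> A\<bar> \<le> h\<^sup>2 * (R * B)"
    if h: "0 \<le> h" "h \<le> 1" and \<phi>: "\<phi> \<in> BM" "\<And>A. \<bar>\<phi> A\<bar> \<le> B" for h \<phi> A B
  proof -
    have "0 \<le> B" using \<phi>(2)[of A] by linarith
    have b: "bounded_op (config M) (diff_op (\<lambda>x. h * l x)) (h * k)"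
      using bounded_op_diff_op[OF integrable_mult_right[OF l(1)], of h] h
      by (simp add: k_def abs_mult mult.left_commute)
    have "\<bar>exp_op (\<lambda>x. h * l x) \<phi> A - \<phi> A - h * diff_op l \<phi> A\<bar> \<le> (h * k)\<^sup>2 * g (h * k) / 2 * B"
      using op_exp_remainder[OF b \<phi>, of A] by (simp add: diff_op_cmult)
    also have "\<dots> \<le> (h * k)\<^sup>2 * g k / 2 * B"
      using h k0 \<open>0 \<le> B\<close> by (intro mult_right_mono divide_right_mono mult_left_mono g_mono mult_left_le_one_le) auto
    finally show ?thesis by (simp add: R_def power_mult_distrib mult.assoc)
  qed
  have "h * (diff_op (\<lambda>x. f x * l x) (exp_op (\<lambda>x. h * l x) \<psi>) A)\<^sup>2 - K * h\<^sup>2 \<le>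
    Q * (exp_op (\<lambda>x. h * l x) (\<lambda>A. (\<psi> A)\<^sup>2) A - (exp_op (\<lambda>x. h * l x) \<psi> A)\<^sup>2)"
    if \<psi>: "\<psi> \<in> BM" "\<And>A. \<bar>\<psi> A\<bar> \<le> C" and h: "0 \<le> h" "h \<le> 1" for \<psi> h A
  proof -
    define \<eta> where "\<eta> = exp_op (\<lambda>x. h * l x) \<psi>"
    have hl: "integrable M (\<lambda>x. h * l x)" using l by simp
    have C0: "0 \<le> C" using \<psi>(2)[of A] by linarith
    have \<eta>: "\<eta> \<in> BM" unfolding \<eta>_def by (rule bounded_op_bmf[OF bounded_op_exp_op[OF hl] \<psi>(1)])
    have \<eta>C: "\<bar>\<eta> A\<bar> \<le> C" for A
      using bounded_op_le[OF bounded_op_exp_op_contraction[OF hl] \<psi>, of A] l h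
      unfolding \<eta>_def by simp
    have dC: "\<bar>diff_op l \<psi> A\<bar> \<le> k * C" for A by (rule bounded_op_le[OF bD \<psi>])
    have r1: "\<bar>\<eta> A - \<psi> A - h * diff_op l \<psi> A\<bar> \<le> h\<^sup>2 * (R * C)" for A
      unfolding \<eta>_def by (rule rem[OF h \<psi>])
    have "\<bar>(\<psi> A)\<^sup>2\<bar> \<le> C\<^sup>2" for A
      using power_mono[OF \<psi>(2), of A 2] by simp
    then have r2: "\<bar>exp_op (\<lambda>x. h * l x) (\<lambda>A. (\<psi> A)\<^sup>2) A - (\<psi> A)\<^sup>2 - h * diff_op l (\<lambda>A. (\<psi> A)\<^sup>2) A\<bar>
        \<le> h\<^sup>2 * (R * C\<^sup>2)"
      by (rule rem[OF h bmf_power2[OF \<psi>(1)]])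
    have h2: "h\<^sup>2 \<le> h" using h by (simp add: power2_eq_square mult_left_le_one_le)
    have close: "\<bar>\<eta> A - \<psi> A\<bar> \<le> h * ((k + R) * C)" for A
    proof -
      have "\<bar>\<eta> A - \<psi> A\<bar> \<le> \<bar>h * diff_op l \<psi> A\<bar> + h\<^sup>2 * (R * C)"
        using r1[of A] by linarith
      also have "\<dots> \<le> h * (k * C) + h * (R * C)"
        using h h2 dC[of A] R0 C0 by (intro add_mono) (auto simp: abs_mult intro: mult_left_mono mult_right_mono)
      finally show ?thesis by (simp add: algebra_simps)
    qed
    have up: "(\<eta> A)\<^sup>2 \<le> (\<psi> A)\<^sup>2 + 2 * h * \<psi> A * diff_op l \<psi> A + h\<^sup>2 * (2 * R * C\<^sup>2 + ((k + R) * C)\<^sup>2)"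
    proof -
      have "(\<eta> A)\<^sup>2 = (\<psi> A)\<^sup>2 + 2 * h * \<psi> A * diff_op l \<psi> A +
          2 * \<psi> A * (\<eta> A - \<psi> A - h * diff_op l \<psi> A) + (\<eta> A - \<psi> A)\<^sup>2"
        by (simp add: algebra_simps power2_eq_square)
      moreover have "2 * \<psi> A * (\<eta> A - \<psi> A - h * diff_op l \<psi> A) \<le> 2 * (C * (h\<^sup>2 * (R * C)))"
      proof -
        have "\<psi> A * (\<eta> A - \<psi> A - h * diff_op l \<psi> A) \<le> \<bar>\<psi> A\<bar> * \<bar>\<eta> A - \<psi> A - h * diff_op l \<psi> A\<bar>"
          by (metis abs_ge_self abs_mult)
        also have "\<dots> \<le> C * (h\<^sup>2 * (R * C))"
          by (rule mult_mono[OF \<psi>(2) r1 C0]) simp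
        finally show ?thesis by simp
      qed
      moreover have "(\<eta> A - \<psi> A)\<^sup>2 \<le> (h * ((k + R) * C))\<^sup>2"
        using close[of A] by (simp add: abs_le_square_iff[symmetric])
      ultimately show ?thesis by (simp add: algebra_simps power2_eq_square)
    qed
    have "h * (diff_op l (\<lambda>A. (\<psi> A)\<^sup>2) A - 2 * \<psi> A * diff_op l \<psi> A) - h\<^sup>2 * K3 \<le>
        exp_op (\<lambda>x. h * l x) (\<lambda>A. (\<psi> A)\<^sup>2) A - (\<eta> A)\<^sup>2"
      using up r2 unfolding K3_def by (simp add: algebra_simps abs_le_iff)
    from mult_left_mono[OF this Q0]
    have 1: "h * (Q * (diff_op l (\<lambda>A. (\<psi> A)\<^sup>2) A - 2 * \<psi> A * diff_op l \<psi> A)) - h\<^sup>2 * (Q * K3) \<le>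
        Q * (exp_op (\<lambda>x. h * l x) (\<lambda>A. (\<psi> A)\<^sup>2) A - (\<eta> A)\<^sup>2)"
      by (simp add: algebra_simps)
    let ?D = "diff_op (\<lambda>x. f x * l x)"
    have 2: "h * (?D \<psi> A)\<^sup>2 \<le> h * (Q * (diff_op l (\<lambda>A. (\<psi> A)\<^sup>2) A - 2 * \<psi> A * diff_op l \<psi> A))"
      using diff_op_cauchy_schwarz[OF l f \<psi>(1), of A] h unfolding Q_def by (intro mult_left_mono) auto
    have 3: "(?D \<eta> A)\<^sup>2 - (?D \<psi> A)\<^sup>2 \<le> h * (2 * (k * C) * (k * ((k + R) * C)))"
    proof -
      have "\<bar>?D \<eta> A - ?D \<psi> A\<bar> \<le> k * (h * ((k + R) * C))"
        using bounded_op_le[OF bf bmf_diff[OF \<eta> \<psi>(1)] close, of A]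
        by (simp add: bounded_op_diff[OF bf \<eta> \<psi>(1)])
      moreover have "\<bar>?D \<eta> A + ?D \<psi> A\<bar> \<le> 2 * (k * C)"
        using bounded_op_le[OF bf \<eta> \<eta>C, of A] bounded_op_le[OF bf \<psi>, of A] by linarith
      ultimately have "\<bar>?D \<eta> A + ?D \<psi> A\<bar> * \<bar>?D \<eta> A - ?D \<psi> A\<bar> \<le> 2 * (k * C) * (k * (h * ((k + R) * C)))"
        using k0 C0 by (intro mult_mono) auto
      then show ?thesis
        unfolding abs_mult[symmetric] by (simp add: algebra_simps power2_eq_square abs_le_iff)
    qed
    have "h * ((?D \<eta> A)\<^sup>2 - (?D \<psi> A)\<^sup>2) \<le> h\<^sup>2 * (2 * (k * C) * (k * ((k + R) * C)))"
      using mult_left_mono[OF 3 h(1)] by (simp add: power2_eq_square mult.assoc)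
    then show ?thesis
      using 1 2 unfolding \<eta>_def[symmetric] K_def by (simp add: algebra_simps)
  qed
  then show ?thesis unfolding Q_def by blast
qed

text \<open>The weights are given by densities \<open>f\<close> relative to the intensity
  \<open>l\<close>, because the estimate is in terms of the norms of \<open>f\<close> in
  \<open>L\<^sup>2(l dM)\<close>.\<close>

definition diff_ops :: "('a \<Rightarrow> real) \<Rightarrow> ('a \<Rightarrow> real) list \<Rightarrow> 'a multiset operator" where
  "diff_ops l fs \<phi> = foldr (\<lambda>f. diff_op (\<lambda>x. f x * l x)) fs \<phi>"

lemma diff_ops_Nil [simp]: "diff_ops l [] \<phi> = \<phi>"
  unfolding diff_ops_def by simp

lemma diff_ops_Cons [simp]: "diff_ops l (f # fs) \<phi> = diff_op (\<lambda>x. f x * l x) (diff_ops l fs \<phi>)"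
  unfolding diff_ops_def by simp

definition unit_weights :: "('a \<Rightarrow> real) set" where
  "unit_weights = {f \<in> borel_measurable M. \<forall>x. \<bar>f x\<bar> \<le> 1}"

lemma integrable_unit_weight:
  "integrable M l \<Longrightarrow> f \<in> unit_weights \<Longrightarrow> integrable M (\<lambda>x. f x * l x)"
  unfolding unit_weights_def by (rule integrable_mult_unit) auto

lemma bounded_op_diff_ops:
  assumes "integrable M l" "set fs \<subseteq> unit_weights"
  shows "\<exists>k. bounded_op (config M) (diff_ops l fs) k"
  using assms(2)
proof (induction fs)
  case Nil
  have "diff_ops l [] = (\<lambda>\<phi>. \<phi>)" by auto
  then show ?case using bounded_op_id by metis
next
  case (Cons f fs)
  then obtain k where "bounded_op (config M) (diff_ops l fs) k" by auto
  with Cons.prems show ?case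
    using bounded_op_comp[OF bounded_op_diff_op[OF integrable_unit_weight[OF assms(1)]], of f]
    by (fastforce simp: diff_ops_def)
qed

lemma diff_ops_bmf:
  "integrable M l \<Longrightarrow> set fs \<subseteq> unit_weights \<Longrightarrow> \<phi> \<in> BM \<Longrightarrow> diff_ops l fs \<phi> \<in> BM"
  using bounded_op_diff_ops bounded_op_bmf by blast

lemma commuting_diff_ops:
  assumes l: "integrable M l" and fs: "set fs \<subseteq> unit_weights"
    and W: "bounded_op (config M) W w" "\<And>v. integrable M v \<Longrightarrow> commuting (config M) W (diff_op v)"
  shows "commuting (config M) W (diff_ops l fs)"
  using fs
proof (induction fs)
  case (Cons f fs)
  have *: "diff_ops l (f # fs) = (\<lambda>\<phi>. diff_op (\<lambda>x. f x * l x) (diff_ops l fs \<phi>))" by auto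
  show ?case
    unfolding *
    using Cons bounded_op_diff_ops[OF l, of fs]
    by (auto intro: commuting_comp W(2) integrable_unit_weight[OF l])
qed (simp add: commuting_def)

lemma diff_ops_exp_op:
  assumes "integrable M l" "set fs \<subseteq> unit_weights" "integrable M w" "\<phi> \<in> BM"
  shows "exp_op w (diff_ops l fs \<phi>) = diff_ops l fs (exp_op w \<phi>)"
  by (rule commutingD[OF commuting_diff_ops[OF assms(1,2) bounded_op_exp_op[OF assms(3)]] assms(4)])
    (rule commuting_sym[OF commuting_exp_op[OF _ assms(3)]])

lemma diff_ops_diff_op:
  assumes "integrable M l" "set fs \<subseteq> unit_weights" "integrable M w" "\<phi> \<in> BM"
  shows "diff_op w (diff_ops l fs \<phi>) = diff_ops l fs (diff_op w \<phi>)"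
  by (rule commutingD[OF commuting_diff_ops[OF assms(1,2) bounded_op_diff_op[OF assms(3)]] assms(4)])
    (rule commuting_diff_op[OF assms(3)])

text \<open>For the Poisson expectation \<open>P\<^sub>s = exp (s D)\<close> the function \<open>J(u) = P\<^sub>u ((P\<^bsub>s-u\<^esub> \<phi>)\<^sup>2)\<close> interpolates
  between \<open>(P\<^sub>s \<phi>)\<^sup>2\<close> and \<open>P\<^sub>s (\<phi>\<^sup>2)\<close>; its derivative is \<open>P\<^sub>u\<close> of a squared gradient, to which the
  Cauchy-Schwarz inequality and the induction hypothesis apply. The factorial arises from
  integrating \<open>u\<^sup>m\<close>.\<close>

theorem chaos_bound:
  assumes l: "integrable M l" "\<And>x. x \<in> space M \<Longrightarrow> 0 \<le> l x"
    and fs: "set fs \<subseteq> unit_weights" and \<phi>: "\<phi> \<in> BM" and s: "0 \<le> s" "s \<le> 1"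
  shows "s ^ length fs * (exp_op (\<lambda>x. s * l x) (diff_ops l fs \<phi>) A)\<^sup>2 \<le>
    fact (length fs) * (\<Prod>f\<leftarrow>fs. \<integral>x. (f x)\<^sup>2 * l x \<partial>M) * exp_op (\<lambda>x. s * l x) (\<lambda>A. (\<phi> A)\<^sup>2) A"
  using fs \<phi> s
proof (induction fs arbitrary: \<phi> s)
  have sl: "integrable M (\<lambda>x. s * l x)" "\<And>x. x \<in> space M \<Longrightarrow> 0 \<le> s \<Longrightarrow> 0 \<le> s * l x" for s
    using l by auto
  have P_mono: "exp_op (\<lambda>x. u * l x) \<phi> A \<le> exp_op (\<lambda>x. u * l x) \<psi> A"
    if "0 \<le> u" "\<phi> \<in> BM" "\<psi> \<in> BM" "\<And>A. \<phi> A \<le> \<psi> A" for u \<phi> \<psi> A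
    by (rule exp_op_mono[OF sl(1) sl(2)]) (use that in auto)
  have P_bmf: "exp_op (\<lambda>x. u * l x) \<phi> \<in> BM" if "\<phi> \<in> BM" for u \<phi>
    by (rule bounded_op_bmf[OF bounded_op_exp_op[OF sl(1)] that])
  note P_op = bounded_op_exp_op[OF sl(1)]
  have P_add: "exp_op (\<lambda>x. u * l x) (exp_op (\<lambda>x. v * l x) \<phi>) = exp_op (\<lambda>x. (u + v) * l x) \<phi>"
    if "\<phi> \<in> BM" for u v \<phi>
    using exp_op_add[OF sl(1) sl(1) that, of u v] by (simp add: distrib_right)
  {
    case Nil
    let ?m = "exp_op (\<lambda>x. s * l x) \<phi> A"
    \<comment> \<open>With no difference operators the claim is Jensen's inequality, obtained by
      applying the positive operator to the tangent bound
      \<open>2 m \<phi> - m\<^sup>2 \<le> \<phi>\<^sup>2\<close> at the mean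
      \<open>m\<close>.\<close>
    have "exp_op (\<lambda>x. s * l x) (\<lambda>B. 2 * ?m * \<phi> B + - ?m\<^sup>2) A \<le> exp_op (\<lambda>x. s * l x) (\<lambda>B. (\<phi> B)\<^sup>2) A"
    proof (rule P_mono[OF Nil(3)])
      show "2 * ?m * \<phi> B + - ?m\<^sup>2 \<le> (\<phi> B)\<^sup>2" for B
        using zero_le_power2[of "\<phi> B - ?m"] by (simp add: power2_diff algebra_simps)
    qed (intro bmf_add bmf_cmult bmf_const bmf_power2 Nil)+
    then have "?m\<^sup>2 \<le> exp_op (\<lambda>x. s * l x) (\<lambda>B. (\<phi> B)\<^sup>2) A"
      by (subst (asm) bounded_op_add[OF P_op bmf_cmult[OF Nil(2)] bmf_const])
        (simp add: bounded_op_cmult[OF P_op Nil(2)] exp_op_const power2_eq_square)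
    then show ?case by simp
  next
    case (Cons f fs)
    let ?P = "\<lambda>u. exp_op (\<lambda>x. u * l x)"
    let ?D = "diff_op (\<lambda>x. f x * l x)"
    let ?m = "length fs"
    define X where "X = ?P s (diff_ops l (f # fs) \<phi>) A"
    define q where "q = (\<Prod>f\<leftarrow>fs. \<integral>x. (f x)\<^sup>2 * l x \<partial>M)"
    define Q where "Q = (\<integral>x. (f x)\<^sup>2 * l x \<partial>M)"
    define J where "J u = ?P u (\<lambda>A. (?P (s - u) \<phi> A)\<^sup>2) A" for u
    have f: "f \<in> borel_measurable M" "\<And>x. \<bar>f x\<bar> \<le> 1" and fs: "set fs \<subseteq> unit_weights"
      and fU: "f \<in> unit_weights"
      using Cons.prems(1) by (auto simp: unit_weights_def)
    have fl: "integrable M (\<lambda>x. f x * l x)" by (rule integrable_unit_weight[OF l(1) fU])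
    have q0: "0 \<le> q"
      unfolding q_def using l(2)
      by (intro prod_list_nonneg) (auto intro!: Bochner_Integration.integral_nonneg)
    obtain C where C: "\<And>A. \<bar>\<phi> A\<bar> \<le> C" using bmf_bound[OF Cons.prems(2)] by blast
    obtain K where K: "\<And>\<psi> h A. \<psi> \<in> BM \<Longrightarrow> (\<And>A. \<bar>\<psi> A\<bar> \<le> C) \<Longrightarrow> 0 \<le> h \<Longrightarrow> h \<le> 1 \<Longrightarrow>
      h * (?D (?P h \<psi>) A)\<^sup>2 - K * h\<^sup>2 \<le> Q * (?P h (\<lambda>A. (\<psi> A)\<^sup>2) A - (?P h \<psi> A)\<^sup>2)"
      using exp_op_square_increment[OF l f, of C] unfolding Q_def by blast
    \<comment> \<open>By commutation and the semigroup property this quantity does not depend on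
      \<open>u\<close>. The induction hypothesis at time \<open>u\<close> therefore bounds the
      derivative of \<open>J\<close> below by a constant times
      \<open>u ^ ?m * X\<^sup>2\<close>.\<close>
    have X: "?P u (diff_ops l fs (?D (?P (s - u) \<phi>))) A = X" for u
    proof -
      have "diff_ops l fs (?D (?P (s - u) \<phi>)) = ?P (s - u) (diff_ops l (f # fs) \<phi>)"
        unfolding diff_ops_exp_op[OF l(1) Cons.prems(1) sl(1) Cons.prems(2)]
        by (simp add: diff_ops_diff_op[OF l(1) fs fl P_bmf[OF Cons.prems(2)]])
      then show ?thesis
        unfolding X_def using P_add[OF diff_ops_bmf[OF l(1) Cons.prems(1,2)], of u "s - u"] by simp
    qed
    have "X\<^sup>2 * s ^ Suc ?m / real (Suc ?m) \<le> fact ?m * q * Q * J s - fact ?m * q * Q * J 0"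
    proof (rule increment_lower_bound[OF Cons.prems(3,4), where K = "fact ?m * q * K"])
      fix u h assume u: "0 \<le> u" and h: "0 \<le> h" and uh: "u + h \<le> s"
      \<comment> \<open>This makes \<open>J (u + h) - J u\<close> the image under
        \<open>?P u\<close> of \<open>?P h (\<psi>\<^sup>2) - (?P h \<psi>)\<^sup>2\<close>, the
        quantity bounded by the choice of \<open>K\<close>.\<close>
      define \<psi> where "\<psi> = ?P (s - (u + h)) \<phi>"
      have \<psi>: "\<psi> \<in> BM" unfolding \<psi>_def by (rule P_bmf[OF Cons.prems(2)])
      have \<psi>C: "\<bar>\<psi> A\<bar> \<le> C" for A
        using bounded_op_le[OF bounded_op_exp_op_contraction[OF sl(1) sl(2)] Cons.prems(2) C,
          of "s - (u + h)" A] uh unfolding \<psi>_def by simp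
      have \<eta>: "?P h \<psi> = ?P (s - u) \<phi>"
        unfolding \<psi>_def using P_add[OF Cons.prems(2), of h "s - (u + h)"] by simp
      have sq: "(\<lambda>A. (\<psi> A)\<^sup>2) \<in> BM" "(\<lambda>A. (?P h \<psi> A)\<^sup>2) \<in> BM" "(\<lambda>A. (?D (?P h \<psi>) A)\<^sup>2) \<in> BM"
        by (intro bmf_power2 P_bmf bounded_op_bmf[OF bounded_op_diff_op[OF fl]] \<psi>)+
      have "?P u (\<lambda>A. h * (?D (?P h \<psi>) A)\<^sup>2 + - (K * h\<^sup>2)) A \<le>
          ?P u (\<lambda>A. Q * (?P h (\<lambda>A. (\<psi> A)\<^sup>2) A - (?P h \<psi> A)\<^sup>2)) A"
      proof (rule P_mono[OF u])
        show "h * (?D (?P h \<psi>) A)\<^sup>2 + - (K * h\<^sup>2) \<le> Q * (?P h (\<lambda>A. (\<psi> A)\<^sup>2) A - (?P h \<psi> A)\<^sup>2)" for A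
          using K[OF \<psi> \<psi>C h, of A] uh u Cons.prems(4) by simp
      qed (intro bmf_add bmf_cmult bmf_const bmf_diff sq P_bmf)+
      also have "\<dots> = Q * (?P (u + h) (\<lambda>A. (\<psi> A)\<^sup>2) A - ?P u (\<lambda>A. (?P h \<psi> A)\<^sup>2) A)"
        by (simp add: bounded_op_cmult[OF P_op] bounded_op_diff[OF P_op] bmf_diff sq P_bmf P_add)
      also have "\<dots> = Q * (J (u + h) - J u)"
        by (simp only: J_def \<eta>) (simp only: \<psi>_def)
      also have "?P u (\<lambda>A. h * (?D (?P h \<psi>) A)\<^sup>2 + - (K * h\<^sup>2)) A =
          h * ?P u (\<lambda>A. (?D (?P (s - u) \<phi>) A)\<^sup>2) A - K * h\<^sup>2"
        using sq(3)
        by (subst bounded_op_add[OF P_op bmf_cmult bmf_const])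
          (simp_all add: bounded_op_cmult[OF P_op] exp_op_const \<eta>)
      finally have 1: "h * ?P u (\<lambda>A. (?D (?P (s - u) \<phi>) A)\<^sup>2) A - K * h\<^sup>2 \<le> Q * (J (u + h) - J u)" .
      have "u ^ ?m * X\<^sup>2 \<le> fact ?m * q * ?P u (\<lambda>A. (?D (?P (s - u) \<phi>) A)\<^sup>2) A"
        using Cons.IH[OF fs bounded_op_bmf[OF bounded_op_diff_op[OF fl] P_bmf[OF Cons.prems(2)]] u, of "s - u"]
          uh h Cons.prems(4) unfolding X q_def by simp
      from mult_left_mono[OF this h] mult_left_mono[OF 1, of "fact ?m * q"]
      show "h * u ^ ?m * X\<^sup>2 - fact ?m * q * K * h\<^sup>2 \<le>
          fact ?m * q * Q * J (u + h) - fact ?m * q * Q * J u"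
        using q0 by (simp add: algebra_simps)
    qed simp
    \<comment> \<open>The contribution at 0 is dropped. The denominator \<open>Suc ?m\<close> from
      integrating the power turns \<open>fact ?m\<close> into the next factorial.\<close>
    moreover have "0 \<le> fact ?m * q * Q * J 0"
    proof -
      have "0 \<le> Q" unfolding Q_def using l(2) by (intro Bochner_Integration.integral_nonneg) auto
      moreover have "J 0 = (?P s \<phi> A)\<^sup>2" unfolding J_def by (simp add: exp_op_zero)
      ultimately show ?thesis using q0 by simp
    qed
    moreover have "J s = ?P s (\<lambda>A. (\<phi> A)\<^sup>2) A" unfolding J_def by (simp add: exp_op_zero)
    ultimately have "X\<^sup>2 * s ^ Suc ?m / real (Suc ?m) \<le> fact ?m * q * Q * ?P s (\<lambda>A. (\<phi> A)\<^sup>2) A"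
      by simp
    then show ?case
      unfolding X_def[symmetric] by (simp add: q_def Q_def field_simps)
  }
qed

end

section \<open>Kerstan's expansion\<close>

text \<open>The central binomial coefficient is at most \<open>4 ^ i / 2\<close>, with equality at
  \<open>i = 1\<close>. The gain 1/2, false at \<open>i = 0\<close>, is the source of the factor
  \<open>1 / sqrt 2\<close> in front of the geometric series.\<close>

lemma fact_double_le: "1 \<le> i \<Longrightarrow> (fact (2 * i) :: real) \<le> 4 ^ i / 2 * (fact i)\<^sup>2"
proof (induction i rule: nat_induct_at_least)
  case base
  then show ?case by (simp add: numeral_2_eq_2)
next
  case (Suc i)
  have "(fact (2 * Suc i) :: real) = (2 * real i + 2) * (2 * real i + 1) * fact (2 * i)"
    by (simp add: algebra_simps)
  also have "\<dots> \<le> (2 * real i + 2) * (2 * real i + 2) * (4 ^ i / 2 * (fact i)\<^sup>2)"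
    by (intro mult_mono Suc.IH) auto
  also have "\<dots> = 4 ^ Suc i / 2 * (fact (Suc i))\<^sup>2"
    by (simp add: power_mult_distrib) (simp add: algebra_simps power2_eq_square)
  finally show ?case .
qed

lemma sqrt_fact_double_le:
  assumes "1 \<le> i" shows "sqrt (fact (2 * i)) / fact i \<le> 2 ^ i / sqrt 2"
proof -
  have "sqrt (fact (2 * i)) \<le> sqrt (4 ^ i / 2 * (fact i)\<^sup>2)"
    using fact_double_le[OF assms] by simp
  also have "\<dots> = 2 ^ i / sqrt 2 * fact i"
    using real_sqrt_power[of 4 i] by (simp add: real_sqrt_mult real_sqrt_divide)
  finally show ?thesis by (simp add: divide_le_eq)
qed

text \<open>\<open>weighted_sum y n k = \<Sum>\<^sub>J sqrt ((2 (k + |J|))!) * \<Prod>\<^bsub>j\<in>J\<^esub> y j\<close>, where \<open>J\<close> ranges over the subsets of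
  \<open>{0..<n}\<close>.\<close>

fun weighted_sum :: "(nat \<Rightarrow> real) \<Rightarrow> nat \<Rightarrow> nat \<Rightarrow> real" where
  "weighted_sum y 0 k = sqrt (fact (2 * k))"
| "weighted_sum y (Suc n) k = weighted_sum y n k + y n * weighted_sum y n (Suc k)"

lemma power_add_ge:
  fixes a b :: real assumes "0 \<le> a" "0 \<le> b"
  shows "a ^ Suc i + real (Suc i) * b * a ^ i \<le> (a + b) ^ Suc i"
proof (induction i)
  case (Suc i)
  have "a ^ Suc (Suc i) + real (Suc (Suc i)) * b * a ^ Suc i \<le>
      (a + b) * (a ^ Suc i + real (Suc i) * b * a ^ i)"
    using assms by (simp add: algebra_simps)
  also have "\<dots> \<le> (a + b) * (a + b) ^ Suc i"
    using assms by (intro mult_left_mono Suc) auto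
  finally show ?case by simp
qed simp

text \<open>Subsets of size \<open>i\<close> contribute the elementary symmetric polynomial of
  degree \<open>i\<close> in the \<open>y j\<close>, which is at most
  \<open>(\<Sum>j<n. y j) ^ i / i!\<close>. In the induction this is the bound by the first two
  binomial terms in \<open>power_add_ge\<close>.\<close>

lemma weighted_sum_le:
  assumes "\<And>j. j < n \<Longrightarrow> 0 \<le> y j"
  shows "weighted_sum y n k \<le> (\<Sum>i\<le>n. sqrt (fact (2 * (k + i))) / fact i * (\<Sum>j<n. y j) ^ i)"
  using assms
proof (induction n arbitrary: k)
  case (Suc n)
  let ?Y = "\<Sum>j<n. y j"
  let ?c = "\<lambda>i. sqrt (fact (2 * (k + i))) :: real"
  have Y: "0 \<le> ?Y" and yn: "0 \<le> y n" using Suc.prems by (auto intro: sum_nonneg)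
  have "weighted_sum y (Suc n) k \<le>
      (\<Sum>i\<le>n. ?c i / fact i * ?Y ^ i) + y n * (\<Sum>i\<le>n. ?c (Suc i) / fact i * ?Y ^ i)"
    using Suc.IH[of k] Suc.IH[of "Suc k"] Suc.prems yn
    by (auto intro!: add_mono mult_left_mono)
  also have "(\<Sum>i\<le>n. ?c i / fact i * ?Y ^ i) \<le> (\<Sum>i\<le>Suc n. ?c i / fact i * ?Y ^ i)"
    using Y by simp
  also have "\<dots> = ?c 0 + (\<Sum>i\<le>n. ?c (Suc i) / fact (Suc i) * ?Y ^ Suc i)"
    by (subst sum.atMost_Suc_shift) simp
  also have "\<dots> + y n * (\<Sum>i\<le>n. ?c (Suc i) / fact i * ?Y ^ i) =
      ?c 0 + (\<Sum>i\<le>n. ?c (Suc i) / fact (Suc i) * (?Y ^ Suc i + real (Suc i) * y n * ?Y ^ i))"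
    unfolding sum_distrib_left add.assoc sum.distrib[symmetric]
  proof (intro arg_cong2[where f = "(+)"] refl sum.cong)
    fix i
    have "c / (N * F) * P + z * (c / F * Q) = c / (N * F) * (P + N * z * Q)" if "N \<noteq> 0" "F \<noteq> 0"
      for c N F P Q z :: real
      using that by (simp add: field_simps)
    then show "?c (Suc i) / fact (Suc i) * ?Y ^ Suc i + y n * (?c (Suc i) / fact i * ?Y ^ i) =
        ?c (Suc i) / fact (Suc i) * (?Y ^ Suc i + real (Suc i) * y n * ?Y ^ i)"
      unfolding fact_Suc by (simp del: of_nat_Suc power_Suc)
  qed
  also have "\<dots> \<le> ?c 0 + (\<Sum>i\<le>n. ?c (Suc i) / fact (Suc i) * (?Y + y n) ^ Suc i)"
    by (intro add_left_mono sum_mono mult_left_mono power_add_ge Y yn) auto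
  also have "\<dots> = (\<Sum>i\<le>Suc n. ?c i / fact i * (\<Sum>j<Suc n. y j) ^ i)"
    by (subst sum.atMost_Suc_shift) simp
  finally show ?case by simp
qed simp

text \<open>The empty subset contributes the 1 that is subtracted; all other terms satisfy
  \<open>i \<ge> 1\<close>, so \<open>sqrt_fact_double_le\<close> applies and leaves a geometric
  series without its constant term.\<close>

lemma weighted_sum_bound:
  assumes y: "\<And>j. j < n \<Longrightarrow> 0 \<le> y j" and x: "2 * (\<Sum>j<n. y j) < 1"
  shows "weighted_sum y n 0 - 1 \<le> 1 / sqrt 2 * (2 * (\<Sum>j<n. y j) / (1 - 2 * (\<Sum>j<n. y j)))"
proof -
  define Y where "Y = (\<Sum>j<n. y j)"
  have Y0: "0 \<le> Y" unfolding Y_def using y by (auto intro: sum_nonneg)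
  have Y1: "2 * Y < 1" using x unfolding Y_def .
  have "weighted_sum y n 0 \<le> (\<Sum>i\<le>n. sqrt (fact (2 * i)) / fact i * Y ^ i)"
    using weighted_sum_le[OF y, where k = 0] unfolding Y_def by simp
  also have "\<dots> \<le> (\<Sum>i\<le>n. (if i = 0 then 1 else 0) + 1 / sqrt 2 * (if i = 0 then 0 else (2 * Y) ^ i))"
  proof (rule sum_mono)
    fix i
    have "sqrt (fact (2 * i)) / fact i * Y ^ i \<le> 2 ^ i / sqrt 2 * Y ^ i" if "i \<noteq> 0"
      using sqrt_fact_double_le[of i] that Y0 by (intro mult_right_mono) auto
    then show "sqrt (fact (2 * i)) / fact i * Y ^ i \<le>
        (if i = 0 then 1 else 0) + 1 / sqrt 2 * (if i = 0 then 0 else (2 * Y) ^ i)"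
      by (auto simp: power_mult_distrib)
  qed
  also have "\<dots> = 1 + 1 / sqrt 2 * (\<Sum>i\<le>n. if i = 0 then 0 else (2 * Y) ^ i)"
    unfolding sum.distrib sum_distrib_left[symmetric] by simp
  also have "(\<Sum>i\<le>n. if i = 0 then 0 else (2 * Y) ^ i) = 2 * Y * (\<Sum>i<n. (2 * Y) ^ i)"
    by (cases n) (auto simp: sum.atMost_Suc_shift sum_distrib_left lessThan_Suc_atMost
        simp del: sum.atMost_Suc)
  also have "\<dots> \<le> 2 * Y * (1 / (1 - 2 * Y))"
  proof (rule mult_left_mono)
    show "(\<Sum>i<n. (2 * Y) ^ i) \<le> 1 / (1 - 2 * Y)"
      using sum_le_suminf[OF summable_geometric[of "2 * Y"], of "{..<n}"] suminf_geometric[of "2 * Y"]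
        Y0 Y1 by simp
  qed (use Y0 in simp)
  finally show ?thesis unfolding Y_def by (simp add: divide_right_mono)
qed

section \<open>Products of operators\<close>

fun op_prod :: "(nat \<Rightarrow> 'c operator) \<Rightarrow> nat \<Rightarrow> 'c operator" where
  "op_prod U 0 \<phi> = \<phi>"
| "op_prod U (Suc n) \<phi> = U n (op_prod U n \<phi>)"

lemma bounded_op_prod:
  assumes "\<And>j. j < n \<Longrightarrow> bounded_op K (U j) (k j)"
  shows "bounded_op K (op_prod U n) (\<Prod>j<n. k j)"
  using assms
proof (induction n)
  case 0
  have "op_prod U 0 = (\<lambda>\<phi>. \<phi>)" by auto
  then show ?case using bounded_op_id by simp
next
  case (Suc n)
  have *: "op_prod U (Suc n) = (\<lambda>\<phi>. U n (op_prod U n \<phi>))" by auto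
  show ?case
    unfolding * using bounded_op_comp[OF Suc.prems[of n] Suc.IH] Suc.prems
    by (simp add: mult.commute)
qed

lemma bounded_op_prod_1:
  "(\<And>j. j < n \<Longrightarrow> bounded_op K (U j) 1) \<Longrightarrow> bounded_op K (op_prod U n) 1"
  using bounded_op_prod[of n K U "\<lambda>_. 1"] by simp

lemma commuting_prod:
  assumes "\<And>j. j < n \<Longrightarrow> commuting K W (U j)" "\<And>j. j < n \<Longrightarrow> bounded_op K (U j) (k j)"
  shows "commuting K W (op_prod U n)"
  using assms
proof (induction n)
  case (Suc n)
  have *: "op_prod U (Suc n) = (\<lambda>\<phi>. U n (op_prod U n \<phi>))" by auto
  show ?case
    unfolding *
    by (rule commuting_comp[OF _ Suc.IH bounded_op_prod[of n K U k]]) (use Suc.prems in auto)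
qed (simp add: commuting_def)

text \<open>Factors are exchanged one at a time. Since all factors are contractions, the error of
  each exchange reaches the product without amplification.\<close>

lemma op_prod_diff_le:
  assumes U: "\<And>j. j < n \<Longrightarrow> bounded_op K (U j) 1" and V: "\<And>j. j < n \<Longrightarrow> bounded_op K (V j) 1"
    and UV: "\<And>j \<phi> C A. j < n \<Longrightarrow> \<phi> \<in> bmf K \<Longrightarrow> (\<And>A. \<bar>\<phi> A\<bar> \<le> C) \<Longrightarrow>
      \<bar>U j \<phi> A - V j \<phi> A\<bar> \<le> e j * C"
    and \<phi>: "\<phi> \<in> bmf K" "\<And>A. \<bar>\<phi> A\<bar> \<le> C"
  shows "\<bar>op_prod U n \<phi> A - op_prod V n \<phi> A\<bar> \<le> (\<Sum>j<n. e j) * C"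
  using U V UV
proof (induction n arbitrary: A)
  case (Suc n)
  let ?u = "op_prod U n \<phi>" and ?v = "op_prod V n \<phi>"
  have b: "bounded_op K (op_prod U n) 1" "bounded_op K (op_prod V n) 1"
    using Suc.prems by (auto intro: bounded_op_prod_1)
  have bm: "?u \<in> bmf K" "?v \<in> bmf K" using b \<phi>(1) by (auto intro: bounded_op_bmf)
  have Un: "bounded_op K (U n) 1" using Suc.prems by simp
  have "\<bar>?u A - ?v A\<bar> \<le> (\<Sum>j<n. e j) * C" for A
    using Suc.prems by (intro Suc.IH) auto
  then have 1: "\<bar>U n ?u A - U n ?v A\<bar> \<le> 1 * ((\<Sum>j<n. e j) * C)"
    using bounded_op_le[OF Un bmf_diff[OF bm], of _ A] by (simp add: bounded_op_diff[OF Un bm])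
  have "\<bar>?v A\<bar> \<le> C" for A using bounded_op_le[OF b(2) \<phi>, of A] by simp
  then have 2: "\<bar>U n ?v A - V n ?v A\<bar> \<le> e n * C"
    using Suc.prems(3)[OF _ bm(2)] by simp
  from 1 2 show ?case by (simp add: distrib_right)
qed simp

section \<open>Bernoulli points and Kerstan's remainders as operators\<close>

context sigma_finite_measure
begin

definition nonneg_weights :: "('a \<Rightarrow> real) set" where
  "nonneg_weights = {w. integrable M w \<and> (\<forall>x\<in>space M. 0 \<le> w x)}"

lemma nonneg_weightsD:
  "w \<in> nonneg_weights \<Longrightarrow> integrable M w" "w \<in> nonneg_weights \<Longrightarrow> x \<in> space M \<Longrightarrow> 0 \<le> w x"
  unfolding nonneg_weights_def by auto

lemma nonneg_weights_add:
  "v \<in> nonneg_weights \<Longrightarrow> w \<in> nonneg_weights \<Longrightarrow> (\<lambda>x. v x + w x) \<in> nonneg_weights"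
  unfolding nonneg_weights_def by auto

lemma nonneg_weights_sum:
  "(\<And>i. i \<in> I \<Longrightarrow> w i \<in> nonneg_weights) \<Longrightarrow> (\<lambda>x. \<Sum>i\<in>I. w i x) \<in> nonneg_weights"
  unfolding nonneg_weights_def by (auto intro: sum_nonneg)

lemma integral_abs_nonneg_weight: "w \<in> nonneg_weights \<Longrightarrow> (\<integral>x. \<bar>w x\<bar> \<partial>M) = (\<integral>x. w x \<partial>M)"
  by (rule Bochner_Integration.integral_cong) (auto dest: nonneg_weightsD)

lemma bounded_op_diff_op_nonneg:
  "w \<in> nonneg_weights \<Longrightarrow> bounded_op (config M) (diff_op w) (2 * (\<integral>x. w x \<partial>M))"
  using bounded_op_diff_op[of w] nonneg_weightsD(1)[of w] by (simp add: integral_abs_nonneg_weight)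

lemma integral_nonneg_weight: "w \<in> nonneg_weights \<Longrightarrow> 0 \<le> (\<integral>x. w x \<partial>M)"
  by (rule Bochner_Integration.integral_nonneg) (auto dest: nonneg_weightsD)

text \<open>\<open>bernoulli_op w\<close> is convolution with the law of the configuration that has one point with
  distribution \<open>w dM\<close> and is empty with probability \<open>1 - \<integral>w dM\<close>.\<close>

definition bernoulli_op :: "('a \<Rightarrow> real) \<Rightarrow> 'a multiset operator" where
  "bernoulli_op w = (\<lambda>\<phi> A. \<phi> A + diff_op w \<phi> A)"

lemma bounded_op_bernoulli:
  assumes w: "w \<in> nonneg_weights" and le1: "(\<integral>x. w x \<partial>M) \<le> 1"
  shows "bounded_op (config M) (bernoulli_op w) 1"
proof -
  let ?m = "\<integral>x. w x \<partial>M"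
  have "bounded_op (config M) (\<lambda>\<phi> A. transl_op w \<phi> A + (1 - ?m) * \<phi> A) (?m + \<bar>1 - ?m\<bar>)"
    using bounded_op_plus[OF bounded_op_transl[OF nonneg_weightsD(1)[OF w]] bounded_op_scalar]
    by (simp add: integral_abs_nonneg_weight[OF w])
  then show ?thesis
    using le1 unfolding bernoulli_op_def diff_op_def by (simp add: algebra_simps)
qed

lemma bounded_op_bernoulli_exp:
  assumes "a \<in> nonneg_weights" "b \<in> nonneg_weights" "(\<integral>x. a x \<partial>M) \<le> 1"
  shows "bounded_op (config M) (\<lambda>\<phi>. bernoulli_op a (exp_op b \<phi>)) 1"
  using bounded_op_comp[OF bounded_op_bernoulli[OF assms(1,3)]
      bounded_op_exp_op_contraction[OF nonneg_weightsD[OF assms(2)]]] by simp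

text \<open>The cost of replacing the part \<open>b\<close> of a Bernoulli point by an independent Poisson process.\<close>

lemma bernoulli_split:
  assumes a: "a \<in> nonneg_weights" and b: "b \<in> nonneg_weights"
    and \<phi>: "\<phi> \<in> BM" "\<And>A. \<bar>\<phi> A\<bar> \<le> C"
  defines "m \<equiv> \<integral>x. a x \<partial>M" and "m' \<equiv> \<integral>x. b x \<partial>M"
  assumes "m \<le> 1"
  shows "\<bar>bernoulli_op (\<lambda>x. a x + b x) \<phi> A - bernoulli_op a (exp_op b \<phi>) A\<bar> \<le>
    (2 * m'\<^sup>2 * g (2 * m') + 4 * m * m') * C"
proof -
  note ai = nonneg_weightsD(1)[OF a] and bi = nonneg_weightsD(1)[OF b]
  \<comment> \<open>With this remainder, \<open>(1 + D\<^sub>a + D\<^sub>b) - (1 + D\<^sub>a) (1 +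
    D\<^sub>b + e) = - (1 + D\<^sub>a) e - D\<^sub>a D\<^sub>b\<close>. The two terms give the two
    summands of the bound.\<close>
  define e where "e A = exp_op b \<phi> A - \<phi> A - diff_op b \<phi> A" for A
  have bmE: "exp_op b \<phi> \<in> BM" by (rule bounded_op_bmf[OF bounded_op_exp_op[OF bi] \<phi>(1)])
  have bmD: "diff_op b \<phi> \<in> BM" by (rule bounded_op_bmf[OF bounded_op_diff_op[OF bi] \<phi>(1)])
  have bme: "e \<in> BM" unfolding e_def by (intro bmf_diff bmE bmD \<phi>(1))
  have "\<bar>e A\<bar> \<le> (2 * m')\<^sup>2 * g (2 * m') / 2 * C" for A
    unfolding e_def m'_def by (rule op_exp_remainder[OF bounded_op_diff_op_nonneg[OF b] \<phi>])
  then have 1: "\<bar>bernoulli_op a e A\<bar> \<le> 1 * ((2 * m')\<^sup>2 * g (2 * m') / 2 * C)"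
    using bounded_op_le[OF bounded_op_bernoulli[OF a] bme] assms(7) unfolding m_def by blast
  have 2: "\<bar>diff_op a (diff_op b \<phi>) A\<bar> \<le> 2 * m * (2 * m') * C"
    unfolding m_def m'_def
    by (rule bounded_op_le[OF bounded_op_comp[OF bounded_op_diff_op_nonneg[OF a]
            bounded_op_diff_op_nonneg[OF b]] \<phi>])
  have "e = (\<lambda>A. exp_op b \<phi> A - (\<phi> A + diff_op b \<phi> A))" unfolding e_def by auto
  then have "diff_op a e A = diff_op a (exp_op b \<phi>) A - (diff_op a \<phi> A + diff_op a (diff_op b \<phi>) A)"
    by (simp add: bounded_op_diff[OF bounded_op_diff_op[OF ai] bmE bmf_add[OF \<phi>(1) bmD]]
        bounded_op_add[OF bounded_op_diff_op[OF ai] \<phi>(1) bmD])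
  then have "bernoulli_op (\<lambda>x. a x + b x) \<phi> A - bernoulli_op a (exp_op b \<phi>) A =
      - bernoulli_op a e A - diff_op a (diff_op b \<phi>) A"
    unfolding bernoulli_op_def diff_op_add[OF ai bi \<phi>(1)] by (simp add: e_def)
  then show ?thesis using 1 2 by (simp add: algebra_simps power2_eq_square)
qed

definition kerstan_op :: "('a \<Rightarrow> real) \<Rightarrow> 'a multiset operator" where
  "kerstan_op a = op_series kerstan_coeff (diff_op a)"

text \<open>This is \<open>(1 + D) exp (- D)\<close> in the form \<open>1 - D\<^sup>2 G(D)\<close>:
  the two difference operators are exposed for the \<open>L\<^sup>2\<close> estimate, while
  \<open>G(D)\<close> is charged only with its norm.\<close>

definition remainder_op :: "('a \<Rightarrow> real) \<Rightarrow> 'a multiset operator" where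
  "remainder_op a = (\<lambda>\<phi> A. \<phi> A + (-1) * diff_op a (diff_op a (kerstan_op a \<phi>)) A)"

lemma bounded_op_kerstan_op:
  "a \<in> nonneg_weights \<Longrightarrow> bounded_op (config M) (kerstan_op a) (g (2 * (\<integral>x. a x \<partial>M)) / 2)"
  unfolding kerstan_op_def by (rule bounded_op_kerstan[OF bounded_op_diff_op_nonneg])

lemma commuting_kerstan_op:
  assumes "a \<in> nonneg_weights" "bounded_op (config M) W w" "commuting (config M) W (diff_op a)"
  shows "commuting (config M) W (kerstan_op a)"
  unfolding kerstan_op_def
  by (rule commuting_series[OF assms(3,2) bounded_op_diff_op_nonneg[OF assms(1)] summable_kerstan])
    (simp add: integral_nonneg_weight[OF assms(1)])

lemma bounded_op_remainder:
  assumes "a \<in> nonneg_weights" shows "\<exists>k. bounded_op (config M) (remainder_op a) k"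
  unfolding remainder_op_def
  using bounded_op_plus[OF bounded_op_id bounded_op_scale[OF bounded_op_comp[OF
          bounded_op_diff_op_nonneg[OF assms] bounded_op_comp[OF
            bounded_op_diff_op_nonneg[OF assms] bounded_op_kerstan_op[OF assms]]]], of "-1"]
  by blast

lemma commuting_remainder:
  assumes a: "a \<in> nonneg_weights" and W: "bounded_op (config M) W w"
    and c: "commuting (config M) W (diff_op a)"
  shows "commuting (config M) W (remainder_op a)"
proof -
  note b = bounded_op_diff_op_nonneg[OF a] bounded_op_kerstan_op[OF a]
  note b2 = bounded_op_comp[OF b(1) b(2)]
  show ?thesis
    unfolding remainder_op_def
    by (rule commuting_plus[OF commuting_id commuting_scale[OF commuting_comp[OF c commuting_comp[OF c
              commuting_kerstan_op[OF a W c] b(2)] b2] W bounded_op_comp[OF b(1) b2]] W bounded_op_id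
          bounded_op_scale[OF bounded_op_comp[OF b(1) b2]]])
qed

text \<open>\<open>1 + D\<^sub>a\<close> is multiplied by
  \<open>exp (D\<^sub>a) exp (- D\<^sub>a)\<close>, so that the Poisson factor acquires the full
  intensity \<open>a + b\<close> although only \<open>a\<close> is expanded.\<close>

lemma bernoulli_exp_eq:
  assumes a: "a \<in> nonneg_weights" and b: "b \<in> nonneg_weights" and \<phi>: "\<phi> \<in> BM"
  shows "bernoulli_op a (exp_op b \<phi>) = exp_op (\<lambda>x. a x + b x) (remainder_op a \<phi>)"
proof
  fix A
  note ai = nonneg_weightsD(1)[OF a] and bi = nonneg_weightsD(1)[OF b]
  have abi: "integrable M (\<lambda>x. a x + b x)" and mi: "integrable M (\<lambda>x. (-1) * a x)"
    using ai bi by auto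
  let ?E = "exp_op (\<lambda>x. (-1) * a x)"
  have "diff_op (\<lambda>x. (-1) * a x) = (\<lambda>\<phi> A. (-1) * diff_op a \<phi> A)"
    using diff_op_cmult[of "-1" a] by (intro ext) (simp only:)
  then have E: "?E = op_exp (\<lambda>\<phi> A. (-1) * diff_op a \<phi> A)" by (simp only:)
  have R: "remainder_op a \<phi> = (\<lambda>A. ?E \<phi> A + diff_op a (?E \<phi>) A)"
    unfolding remainder_op_def kerstan_op_def E kerstan_remainder[OF bounded_op_diff_op[OF ai] \<phi>] by simp
  have bmE: "?E \<phi> \<in> BM" by (rule bounded_op_bmf[OF bounded_op_exp_op[OF mi] \<phi>])
  have eb: "exp_op (\<lambda>x. a x + b x) (?E \<phi>) = exp_op b \<phi>"
    using exp_op_add[OF abi mi \<phi>] by simp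
  show "bernoulli_op a (exp_op b \<phi>) A = exp_op (\<lambda>x. a x + b x) (remainder_op a \<phi>) A"
    unfolding R bounded_op_add[OF bounded_op_exp_op[OF abi] bmE bounded_op_bmf[OF bounded_op_diff_op[OF ai] bmE]]
      commutingD[OF commuting_exp_op[OF ai abi] bmE, symmetric] eb
    by (simp add: bernoulli_op_def)
qed

lemma op_prod_exp_op:
  assumes "\<And>j. j < n \<Longrightarrow> integrable M (w j)" "\<phi> \<in> BM"
  shows "op_prod (\<lambda>j. exp_op (w j)) n \<phi> = exp_op (\<lambda>x. \<Sum>j<n. w j x) \<phi>"
  using assms(1)
proof (induction n)
  case 0
  then show ?case by (simp add: exp_op_zero)
next
  case (Suc n)
  have "exp_op (\<lambda>x. w n x + (\<Sum>j<n. w j x)) \<phi> = exp_op (w n) (exp_op (\<lambda>x. \<Sum>j<n. w j x) \<phi>)"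
    using Suc.prems by (intro exp_op_add assms(2)) auto
  then show ?case using Suc by (simp add: add.commute)
qed

text \<open>The remainders commute with the exponentials, which collect into a single Poisson
  semigroup with the total intensity. Every term of the expansion is thus smoothed by all indices at
  once.\<close>

lemma op_prod_bernoulli_exp:
  assumes a: "\<And>j. j < n \<Longrightarrow> a j \<in> nonneg_weights" and b: "\<And>j. j < n \<Longrightarrow> b j \<in> nonneg_weights"
    and \<phi>: "\<phi> \<in> BM"
  shows "op_prod (\<lambda>j \<phi>. bernoulli_op (a j) (exp_op (b j) \<phi>)) n \<phi> =
    exp_op (\<lambda>x. \<Sum>j<n. a j x + b j x) (op_prod (\<lambda>j. remainder_op (a j)) n \<phi>)"
  using a b
proof (induction n)
  case 0
  then show ?case by (simp add: exp_op_zero)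
next
  case (Suc n)
  let ?l = "\<lambda>x. \<Sum>j<n. a j x + b j x"
  let ?R = "op_prod (\<lambda>j. remainder_op (a j)) n \<phi>"
  have an: "a n \<in> nonneg_weights" and bn: "b n \<in> nonneg_weights" using Suc.prems by auto
  have "?l \<in> nonneg_weights"
    by (intro nonneg_weights_sum nonneg_weights_add) (use Suc.prems in auto)
  then have li: "integrable M ?l" by (rule nonneg_weightsD)
  have abi: "integrable M (\<lambda>x. a n x + b n x)" by (rule nonneg_weightsD[OF nonneg_weights_add[OF an bn]])
  have "\<forall>j\<in>{..<n}. \<exists>k. bounded_op (config M) (remainder_op (a j)) k"
    using bounded_op_remainder Suc.prems(1) by simp
  from bchoice[OF this] obtain k where "\<And>j. j < n \<Longrightarrow> bounded_op (config M) (remainder_op (a j)) (k j)"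
    by auto
  then have R: "?R \<in> BM" by (intro bounded_op_bmf[OF bounded_op_prod \<phi>])
  have "op_prod (\<lambda>j \<phi>. bernoulli_op (a j) (exp_op (b j) \<phi>)) (Suc n) \<phi> =
      bernoulli_op (a n) (exp_op (b n) (exp_op ?l ?R))"
    using Suc by simp
  also have "\<dots> = exp_op (\<lambda>x. a n x + b n x) (remainder_op (a n) (exp_op ?l ?R))"
    by (rule bernoulli_exp_eq[OF an bn bounded_op_bmf[OF bounded_op_exp_op[OF li] R]])
  also have "remainder_op (a n) (exp_op ?l ?R) = exp_op ?l (remainder_op (a n) ?R)"
    by (rule commutingD[OF commuting_sym[OF commuting_remainder[OF an bounded_op_exp_op[OF li]
              commuting_sym[OF commuting_exp_op[OF nonneg_weightsD(1)[OF an] li]]]] R])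
  also have "exp_op (\<lambda>x. a n x + b n x) \<dots> = exp_op (\<lambda>x. (a n x + b n x) + ?l x) (remainder_op (a n) ?R)"
    using bounded_op_remainder[OF an] bounded_op_bmf R
    by (intro exp_op_add[OF abi li, symmetric]) blast
  finally show ?case by (simp add: add.commute)
qed

text \<open>The case \<open>s = 1\<close> of \<open>chaos_bound\<close>, where
  \<open>\<phi>\<^sup>2\<close> is bounded by \<open>C\<^sup>2\<close> and the semigroup is a
  contraction.\<close>

lemma diff_ops_expectation_bound:
  assumes l: "l \<in> nonneg_weights" and fs: "set fs \<subseteq> unit_weights"
    and \<phi>: "\<phi> \<in> BM" "\<And>A. \<bar>\<phi> A\<bar> \<le> C"
  shows "\<bar>exp_op l (diff_ops l fs \<phi>) A\<bar> \<le>
    C * sqrt (\<Prod>f\<leftarrow>fs. \<integral>x. (f x)\<^sup>2 * l x \<partial>M) * sqrt (fact (length fs))"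
proof -
  let ?q = "\<Prod>f\<leftarrow>fs. \<integral>x. (f x)\<^sup>2 * l x \<partial>M"
  note li = nonneg_weightsD[OF l]
  have C0: "0 \<le> C" using \<phi>(2)[of A] by linarith
  have q0: "0 \<le> ?q"
    using li(2) by (intro prod_list_nonneg) (auto intro!: Bochner_Integration.integral_nonneg)
  have "(exp_op l (diff_ops l fs \<phi>) A)\<^sup>2 \<le> fact (length fs) * ?q * exp_op l (\<lambda>A. (\<phi> A)\<^sup>2) A"
    using chaos_bound[OF li fs \<phi>(1), of 1 A] by simp
  also have "\<dots> \<le> fact (length fs) * ?q * C\<^sup>2"
  proof (rule mult_left_mono)
    have "\<bar>(\<phi> A)\<^sup>2\<bar> \<le> C\<^sup>2" for A using power_mono[OF \<phi>(2), of A 2] by simp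
    then show "exp_op l (\<lambda>A. (\<phi> A)\<^sup>2) A \<le> C\<^sup>2"
      using bounded_op_le[OF bounded_op_exp_op_contraction[OF li] bmf_power2[OF \<phi>(1)], of "C\<^sup>2" A] by simp
  qed (use q0 in simp)
  also have "\<dots> = (C * sqrt ?q * sqrt (fact (length fs)))\<^sup>2"
    using q0 by (simp add: power_mult_distrib)
  finally show ?thesis
    using C0 q0 by (simp add: abs_le_square_iff[symmetric])
qed

text \<open>The product of remainders is expanded factor by factor. A selected index adds
  \<open>f j\<close> twice to the list, so \<open>k\<close> counts the indices selected so far; its
  \<open>G\<close> changes the test function, which is why \<open>\<phi>\<close> and
  \<open>C\<close> vary in the induction. The selection without any index is subtracted on both
  sides.\<close>

lemma remainder_expectation_bound:
  assumes l: "l \<in> nonneg_weights" and f: "\<And>j. j < n \<Longrightarrow> f j \<in> unit_weights"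
    and a: "\<And>j. j < n \<Longrightarrow> a j \<in> nonneg_weights"
    and af: "\<And>j x. j < n \<Longrightarrow> x \<in> space M \<Longrightarrow> a j x = f j x * l x"
    and fs: "set fs \<subseteq> unit_weights" "length fs = 2 * k"
    and \<phi>: "\<phi> \<in> BM" "\<And>A. \<bar>\<phi> A\<bar> \<le> C"
  defines "y \<equiv> \<lambda>j. (\<integral>x. (f j x)\<^sup>2 * l x \<partial>M) * (g (2 * (\<integral>x. a j x \<partial>M)) / 2)"
  shows "\<bar>exp_op l (diff_ops l fs (op_prod (\<lambda>j. remainder_op (a j)) n \<phi>)) A -
      exp_op l (diff_ops l fs \<phi>) A\<bar> \<le>
    C * sqrt (\<Prod>f\<leftarrow>fs. \<integral>x. (f x)\<^sup>2 * l x \<partial>M) * (weighted_sum y n k - weighted_sum y 0 k)"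
  using f a af fs \<phi>
proof (induction n arbitrary: fs k \<phi> C)
  case (Suc n)
  note li = nonneg_weightsD(1)[OF l]
  let ?R = "op_prod (\<lambda>j. remainder_op (a j)) n"
  let ?q = "\<Prod>f\<leftarrow>fs. \<integral>x. (f x)\<^sup>2 * l x \<partial>M"
  let ?G = "kerstan_op (a n)"
  let ?D = "diff_op (a n)"
  let ?fs = "f n # f n # fs"
  define Q where "Q = (\<integral>x. (f n x)\<^sup>2 * l x \<partial>M)"
  have an: "a n \<in> nonneg_weights" and fn: "f n \<in> unit_weights" using Suc.prems by auto
  note ani = nonneg_weightsD(1)[OF an]
  have Q0: "0 \<le> Q"
    unfolding Q_def using nonneg_weightsD(2)[OF l] by (auto intro!: Bochner_Integration.integral_nonneg)
  have q0: "0 \<le> ?q"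
    using nonneg_weightsD(2)[OF l] by (intro prod_list_nonneg) (auto intro!: Bochner_Integration.integral_nonneg)
  have D: "?D = diff_op (\<lambda>x. f n x * l x)"
  proof -
    have "(\<integral>x. a n x * \<psi> (add_mset x A) \<partial>M) = (\<integral>x. f n x * l x * \<psi> (add_mset x A) \<partial>M)" for \<psi> A
      using Suc.prems(3)[of n] by (intro Bochner_Integration.integral_cong) auto
    moreover have "(\<integral>x. a n x \<partial>M) = (\<integral>x. f n x * l x \<partial>M)"
      using Suc.prems(3)[of n] by (intro Bochner_Integration.integral_cong) auto
    ultimately show ?thesis unfolding diff_op_def transl_op_def by simp
  qed
  have "\<forall>j\<in>{..<n}. \<exists>k. bounded_op (config M) (remainder_op (a j)) k"
    using bounded_op_remainder Suc.prems(2) by simp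
  from bchoice[OF this]
  obtain kR where kR: "\<And>j. j < n \<Longrightarrow> bounded_op (config M) (remainder_op (a j)) (kR j)"
    by auto
  note bR = bounded_op_prod[of n "config M" "\<lambda>j. remainder_op (a j)" kR, OF kR]
  note bG = bounded_op_kerstan_op[OF an]
  \<comment> \<open>\<open>G\<close> is moved past the remaining factors onto the test function,
    where it costs only its norm.\<close>
  have comm: "?G (?R \<phi>) = ?R (?G \<phi>)"
  proof (rule commutingD[OF commuting_prod[OF _ kR] Suc.prems(6)])
    fix j assume j: "j < n"
    have "commuting (config M) (diff_op (a j)) ?G"
      using Suc.prems(2)[of j] j
      by (intro commuting_kerstan_op[OF an bounded_op_diff_op] commuting_diff_op ani nonneg_weightsD) auto
    then show "commuting (config M) ?G (remainder_op (a j))"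
      using Suc.prems(2)[of j] j by (intro commuting_remainder[OF _ bG]) (auto intro: commuting_sym)
  qed
  have bmR: "?R \<phi> \<in> BM" by (rule bounded_op_bmf[OF bR Suc.prems(6)])
  have bmG: "?G \<phi> \<in> BM" by (rule bounded_op_bmf[OF bG Suc.prems(6)])
  have bmRG: "?R (?G \<phi>) \<in> BM" by (rule bounded_op_bmf[OF bR bmG])
  have bD: "bounded_op (config M) ?D (2 * (\<integral>x. \<bar>a n x\<bar> \<partial>M))" by (rule bounded_op_diff_op[OF ani])
  have bmDD: "?D (?D (?R (?G \<phi>))) \<in> BM" by (intro bounded_op_bmf[OF bD] bmRG)
  obtain kd where kd: "bounded_op (config M) (diff_ops l fs) kd"
    using bounded_op_diff_ops[OF li Suc.prems(4)] by blast
  have "op_prod (\<lambda>j. remainder_op (a j)) (Suc n) \<phi> = (\<lambda>A. ?R \<phi> A - ?D (?D (?R (?G \<phi>))) A)"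
    by (simp add: remainder_op_def[of "a n"] comm)
  then have "diff_ops l fs (op_prod (\<lambda>j. remainder_op (a j)) (Suc n) \<phi>) =
      (\<lambda>A. diff_ops l fs (?R \<phi>) A - diff_ops l fs (?D (?D (?R (?G \<phi>)))) A)"
    by (simp add: bounded_op_diff[OF kd bmR bmDD])
  also have "diff_ops l fs (?D (?D (?R (?G \<phi>)))) = diff_ops l ?fs (?R (?G \<phi>))"
    unfolding diff_ops_Cons D[symmetric]
    by (simp add: diff_ops_diff_op[OF li Suc.prems(4) ani] bmRG bounded_op_bmf[OF bD])
  finally have eq: "exp_op l (diff_ops l fs (op_prod (\<lambda>j. remainder_op (a j)) (Suc n) \<phi>)) A =
      exp_op l (diff_ops l fs (?R \<phi>)) A - exp_op l (diff_ops l ?fs (?R (?G \<phi>))) A"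
    using bounded_op_diff[OF bounded_op_exp_op[OF li] diff_ops_bmf[OF li Suc.prems(4) bmR]
        diff_ops_bmf[OF li _ bmRG, of ?fs]] fn Suc.prems(4) by simp
  have 1: "\<bar>exp_op l (diff_ops l fs (?R \<phi>)) A - exp_op l (diff_ops l fs \<phi>) A\<bar> \<le>
      C * sqrt ?q * (weighted_sum y n k - weighted_sum y 0 k)"
    using Suc.prems by (intro Suc.IH) auto
  let ?C = "g (2 * (\<integral>x. a n x \<partial>M)) / 2 * C"
  have GC: "\<bar>?G \<phi> A\<bar> \<le> ?C" for A by (rule bounded_op_le[OF bG Suc.prems(6,7)])
  have fs': "set ?fs \<subseteq> unit_weights" "length ?fs = 2 * Suc k" using Suc.prems(4,5) fn by auto
  have q: "sqrt (\<Prod>f\<leftarrow>?fs. \<integral>x. (f x)\<^sup>2 * l x \<partial>M) = Q * sqrt ?q"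
    using Q0 by (simp add: Q_def[symmetric] real_sqrt_mult mult.assoc[symmetric])
  have "\<bar>exp_op l (diff_ops l ?fs (?R (?G \<phi>))) A - exp_op l (diff_ops l ?fs (?G \<phi>)) A\<bar> \<le>
      ?C * (Q * sqrt ?q) * (weighted_sum y n (Suc k) - weighted_sum y 0 (Suc k))"
    unfolding q[symmetric]
    by (rule Suc.IH[OF _ _ _ fs' bmG GC]) (use Suc.prems in auto)
  \<comment> \<open>In the branch where the last index is selected nothing is subtracted, so the
    term without further indices is added back by the chaos bound.\<close>
  moreover have "\<bar>exp_op l (diff_ops l ?fs (?G \<phi>)) A\<bar> \<le> ?C * (Q * sqrt ?q) * weighted_sum y 0 (Suc k)"
    using diff_ops_expectation_bound[OF l fs'(1) bmG GC, of A] unfolding q fs'(2) by simp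
  ultimately have "\<bar>exp_op l (diff_ops l ?fs (?R (?G \<phi>))) A\<bar> \<le>
      ?C * (Q * sqrt ?q) * weighted_sum y n (Suc k)"
    by (simp add: right_diff_distrib)
  also have "\<dots> = C * sqrt ?q * (y n * weighted_sum y n (Suc k))"
    unfolding y_def Q_def by simp
  finally show ?case
    unfolding eq using 1 by (simp add: distrib_left right_diff_distrib)
qed simp

text \<open>The intermediate process \<open>?H\<close> keeps the parts \<open>a j\<close> as
  Bernoulli points and makes the parts \<open>b j\<close> Poisson. Reaching it costs the first sum;
  going on to the Poisson process costs the geometric term. The bound 1/2 on \<open>\<phi>\<close>
  halves both errors.\<close>

theorem bernoulli_poisson_bound:
  fixes a b f :: "nat \<Rightarrow> 'a \<Rightarrow> real"
  assumes a: "\<And>j. j < n \<Longrightarrow> a j \<in> nonneg_weights" and b: "\<And>j. j < n \<Longrightarrow> b j \<in> nonneg_weights"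
    and f: "\<And>j. j < n \<Longrightarrow> f j \<in> unit_weights"
  defines "l \<equiv> \<lambda>x. \<Sum>j<n. a j x + b j x"
    and "m \<equiv> \<lambda>j. \<integral>x. a j x \<partial>M" and "m' \<equiv> \<lambda>j. \<integral>x. b j x \<partial>M"
  assumes af: "\<And>j x. j < n \<Longrightarrow> x \<in> space M \<Longrightarrow> a j x = f j x * l x"
    and le1: "\<And>j. j < n \<Longrightarrow> m j + m' j \<le> 1"
    and \<phi>: "\<phi> \<in> BM" "\<And>A. \<bar>\<phi> A\<bar> \<le> 1 / 2"
  defines "x \<equiv> \<Sum>j<n. (\<integral>x. (f j x)\<^sup>2 * l x \<partial>M) * g (2 * m j)"
  assumes x: "x < 1"
  shows "\<bar>op_prod (\<lambda>j. bernoulli_op (\<lambda>x. a j x + b j x)) n \<phi> A -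
      op_prod (\<lambda>j. exp_op (\<lambda>x. a j x + b j x)) n \<phi> A\<bar> \<le>
    (\<Sum>j<n. (m' j)\<^sup>2 * g (2 * m' j) + 2 * m j * m' j) + 1 / (2 * sqrt 2) * (x / (1 - x))"
proof -
  let ?H = "op_prod (\<lambda>j \<phi>. bernoulli_op (a j) (exp_op (b j) \<phi>)) n \<phi>"
  let ?y = "\<lambda>j. (\<integral>x. (f j x)\<^sup>2 * l x \<partial>M) * (g (2 * m j) / 2)"
  have mm: "0 \<le> m j" "0 \<le> m' j" if "j < n" for j
    using a[OF that] b[OF that] unfolding m_def m'_def by (auto intro: integral_nonneg_weight)
  have l: "l \<in> nonneg_weights"
    unfolding l_def by (auto intro!: nonneg_weights_sum nonneg_weights_add a b)
  have ab: "(\<lambda>x. a j x + b j x) \<in> nonneg_weights" if "j < n" for j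
    by (intro nonneg_weights_add a b that)
  have abint: "(\<integral>x. a j x + b j x \<partial>M) = m j + m' j" if "j < n" for j
    unfolding m_def m'_def by (intro Bochner_Integration.integral_add nonneg_weightsD a b that)
  have "\<bar>op_prod (\<lambda>j. bernoulli_op (\<lambda>x. a j x + b j x)) n \<phi> A - ?H A\<bar> \<le>
      (\<Sum>j<n. 2 * (m' j)\<^sup>2 * g (2 * m' j) + 4 * m j * m' j) * (1 / 2)"
  proof (rule op_prod_diff_le[OF _ _ _ \<phi>])
    fix j assume j: "j < n"
    show "bounded_op (config M) (bernoulli_op (\<lambda>x. a j x + b j x)) 1"
      using abint[OF j] le1[OF j] by (intro bounded_op_bernoulli ab j) simp
    have m1: "m j \<le> 1" using le1[OF j] mm[OF j] by simp
    then show "bounded_op (config M) (\<lambda>\<phi>. bernoulli_op (a j) (exp_op (b j) \<phi>)) 1"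
      by (intro bounded_op_bernoulli_exp a b j) (simp add: m_def)
    fix \<phi> :: "'a multiset \<Rightarrow> real" and C A
    assume "\<phi> \<in> BM" "\<And>A. \<bar>\<phi> A\<bar> \<le> C"
    then show "\<bar>bernoulli_op (\<lambda>x. a j x + b j x) \<phi> A - bernoulli_op (a j) (exp_op (b j) \<phi>) A\<bar> \<le>
        (2 * (m' j)\<^sup>2 * g (2 * m' j) + 4 * m j * m' j) * C"
      using bernoulli_split[OF a[OF j] b[OF j], of \<phi> C A] m1 unfolding m_def m'_def by blast
  qed
  also have "\<dots> = (\<Sum>j<n. (m' j)\<^sup>2 * g (2 * m' j) + 2 * m j * m' j)"
    unfolding sum_distrib_right by (intro sum.cong) (auto simp: algebra_simps)
  finally have 1: "\<bar>op_prod (\<lambda>j. bernoulli_op (\<lambda>x. a j x + b j x)) n \<phi> A - ?H A\<bar> \<le> \<dots>" .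
  have H: "?H = exp_op l (op_prod (\<lambda>j. remainder_op (a j)) n \<phi>)"
    unfolding l_def by (rule op_prod_bernoulli_exp[OF a b \<phi>(1)])
  have E: "op_prod (\<lambda>j. exp_op (\<lambda>x. a j x + b j x)) n \<phi> = exp_op l \<phi>"
    unfolding l_def by (rule op_prod_exp_op[OF nonneg_weightsD(1)[OF ab] \<phi>(1)])
  have Y: "2 * (\<Sum>j<n. ?y j) = x" unfolding x_def sum_distrib_left by simp
  have y0: "0 \<le> ?y j" if "j < n" for j
    using nonneg_weightsD(2)[OF l] g_ge_1[of "2 * m j"] mm[OF that]
    by (intro mult_nonneg_nonneg) (auto intro!: Bochner_Integration.integral_nonneg)
  have "\<bar>?H A - op_prod (\<lambda>j. exp_op (\<lambda>x. a j x + b j x)) n \<phi> A\<bar> \<le>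
      1 / 2 * (weighted_sum ?y n 0 - 1)"
    using remainder_expectation_bound[OF l f a af, where n = n and fs = "[]" and k = 0 and \<phi> = \<phi> and C = "1 / 2" and A = A] \<phi>
    unfolding H E m_def by simp
  also have "\<dots> \<le> 1 / 2 * (1 / sqrt 2 * (x / (1 - x)))"
  proof (rule mult_left_mono)
    have "2 * (\<Sum>j<n. ?y j) < 1" unfolding Y by (rule x)
    from weighted_sum_bound[where y = ?y, OF y0 this]
    show "weighted_sum ?y n 0 - 1 \<le> 1 / sqrt 2 * (x / (1 - x))" unfolding Y by blast
  qed simp
  finally show ?thesis using 1 by simp
qed

end

section \<open>Point measures of configurations\<close>

lemma sets_sum_measure [simp]: "sets (sum_measure S I \<mu>) = sets S"
  unfolding sum_measure_def by simp

lemma space_sum_measure [simp]: "space (sum_measure S I \<mu>) = space S"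
  by (rule sets_eq_imp_space_eq) simp

text \<open>\<open>measure_of\<close> turns a set function that is not a measure into the null
  measure, so countable additivity is checked before values are read off.\<close>

lemma emeasure_sum_measure:
  assumes I: "finite I" and \<mu>: "\<And>i. i \<in> I \<Longrightarrow> sets (\<mu> i) = sets S" and B: "B \<in> sets S"
  shows "emeasure (sum_measure S I \<mu>) B = (\<Sum>i\<in>I. emeasure (\<mu> i) B)"
proof -
  have eq: "(\<lambda>B. \<integral>\<^sup>+ i. emeasure (\<mu> i) B \<partial>count_space I) = (\<lambda>B. \<Sum>i\<in>I. emeasure (\<mu> i) B)"
    by (intro ext nn_integral_count_space_finite I)
  show ?thesis
    unfolding sum_measure_def eq
  proof (rule emeasure_measure_of_sigma)
    show "sigma_algebra (space S) (sets S)" ..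
    show "positive (sets S) (\<lambda>B. \<Sum>i\<in>I. emeasure (\<mu> i) B)"
      by (simp add: positive_def)
    show "countably_additive (sets S) (\<lambda>B. \<Sum>i\<in>I. emeasure (\<mu> i) B)"
    proof (rule countably_additiveI)
      fix A :: "nat \<Rightarrow> _" assume A: "range A \<subseteq> sets S" "disjoint_family A"
      have "(\<Sum>k. \<Sum>i\<in>I. emeasure (\<mu> i) (A k)) = (\<Sum>i\<in>I. \<Sum>k. emeasure (\<mu> i) (A k))"
        by (rule suminf_sum) auto
      also have "\<dots> = (\<Sum>i\<in>I. emeasure (\<mu> i) (\<Union>k. A k))"
        using A \<mu> by (intro sum.cong suminf_emeasure) auto
      finally show "(\<Sum>k. \<Sum>i\<in>I. emeasure (\<mu> i) (A k)) = (\<Sum>i\<in>I. emeasure (\<mu> i) (\<Union>k. A k))" .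
    qed
  qed fact
qed

text \<open>\<open>point_measures\<close> requires Dirac measures at points of
  \<open>space S\<close>, indexed by a set of naturals. Hence the points are listed in some order
  and those outside \<open>space S\<close> removed; values on sets depend only on counts, so the
  order does not affect the measure.\<close>

definition config_measure :: "'s measure \<Rightarrow> 's multiset \<Rightarrow> 's measure" where
  "config_measure S A = (let xs = SOME xs. mset xs = filter_mset (\<lambda>x. x \<in> space S) A
     in sum_measure S {..<length xs} (\<lambda>i. return S (xs ! i)))"

lemma config_measure_list:
  obtains xs where "mset xs = filter_mset (\<lambda>x. x \<in> space S) A"
    "config_measure S A = sum_measure S {..<length xs} (\<lambda>i. return S (xs ! i))"
proof -
  let ?xs = "SOME xs. mset xs = filter_mset (\<lambda>x. x \<in> space S) A"
  have "mset ?xs = filter_mset (\<lambda>x. x \<in> space S) A"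
    by (rule someI_ex) (rule ex_mset)
  then show thesis using that[of ?xs] unfolding config_measure_def Let_def by blast
qed

lemma config_measure_in_point_measures: "config_measure S A \<in> point_measures S"
proof -
  obtain xs where xs: "mset xs = filter_mset (\<lambda>x. x \<in> space S) A"
    and m: "config_measure S A = sum_measure S {..<length xs} (\<lambda>i. return S (xs ! i))"
    by (rule config_measure_list)
  have "set xs \<subseteq> space S" using arg_cong[OF xs, of set_mset] by auto
  then show ?thesis
    unfolding point_measures_def m by (auto intro!: exI[of _ "{..<length xs}"] exI[of _ "(!) xs"])
qed

lemma sets_config_measure [simp]: "sets (config_measure S A) = sets S"
  unfolding config_measure_def Let_def by simp

lemma emeasure_config_measure:
  assumes B: "B \<in> sets S"
  shows "emeasure (config_measure S A) B = of_nat (size (filter_mset (\<lambda>x. x \<in> B) A))"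
proof -
  obtain xs where xs: "mset xs = filter_mset (\<lambda>x. x \<in> space S) A"
    and m: "config_measure S A = sum_measure S {..<length xs} (\<lambda>i. return S (xs ! i))"
    by (rule config_measure_list)
  have "emeasure (config_measure S A) B = (\<Sum>i<length xs. indicator B (xs ! i))"
    unfolding m using B by (subst emeasure_sum_measure) auto
  also have "\<dots> = (\<Sum>x\<leftarrow>xs. indicator B x)"
    by (simp add: sum_list_sum_nth atLeast0LessThan)
  also have "\<dots> = of_nat (length (filter (\<lambda>x. x \<in> B) xs))"
    by (induction xs) auto
  also have "length (filter (\<lambda>x. x \<in> B) xs) = size (filter_mset (\<lambda>x. x \<in> B) (mset xs))"
    by (metis mset_filter size_mset)
  also have "filter_mset (\<lambda>x. x \<in> B) (mset xs) = filter_mset (\<lambda>x. x \<in> B) A"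
    unfolding xs filter_filter_mset
    by (rule filter_mset_cong) (use sets.sets_into_space[OF B] in auto)
  finally show ?thesis .
qed

lemma eq_config_measureI:
  assumes "sets \<mu> = sets S"
    and "\<And>B. B \<in> sets S \<Longrightarrow> emeasure \<mu> B = of_nat (size (filter_mset (\<lambda>x. x \<in> B) A))"
  shows "\<mu> = config_measure S A"
  using assms by (intro measure_eqI) (auto simp: emeasure_config_measure)

lemma space_point_measure_algebra [simp]: "space (point_measure_algebra S) = point_measures S"
  unfolding point_measure_algebra_def by (rule space_measure_of) auto

text \<open>Events of point measures pull back to events of configurations, which transfers the
  total variation problem to multisets. A generator for \<open>B\<close> and \<open>C\<close>
  becomes the condition that the count of \<open>B\<close>, embedded in the extended reals, lies in
  \<open>C\<close>.\<close>

lemma measurable_config_measure [measurable]: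
  "config_measure S \<in> measurable (config S) (point_measure_algebra S)"
  unfolding point_measure_algebra_def
proof (rule measurable_measure_of)
  show "config_measure S \<in> space (config S) \<rightarrow> point_measures S"
    by (simp add: config_measure_in_point_measures)
  fix Y assume "Y \<in> {{\<mu> \<in> point_measures S. emeasure \<mu> B \<in> C} | B C. B \<in> sets S \<and> C \<subseteq> range of_nat \<union> {\<infinity>}}"
  then obtain B C where B: "B \<in> sets S" and Y: "Y = {\<mu> \<in> point_measures S. emeasure \<mu> B \<in> C}" by blast
  have "config_measure S -` Y \<inter> space (config S) =
      (\<lambda>A. size (filter_mset (\<lambda>x. x \<in> B) A)) -` {k. of_nat k \<in> C} \<inter> space (config S)"
    unfolding Y by (auto simp: config_measure_in_point_measures emeasure_config_measure[OF B])
  then show "config_measure S -` Y \<inter> space (config S) \<in> sets (config S)"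
    using measurable_sets[OF measurable_config_count[OF B], of "{k. of_nat k \<in> C}"] by simp
qed auto

lemma size_filter_sum_mset:
  "size (filter_mset P (\<Sum>i\<in>I. A i)) = (\<Sum>i\<in>I. size (filter_mset P (A i)))"
  by (induction I rule: infinite_finite_induct) auto

lemma size_filter_repeat_mset: "size (filter_mset P (repeat_mset k A)) = k * size (filter_mset P A)"
proof (induction k)
  case (Suc k)
  have "repeat_mset (Suc k) A = A + repeat_mset k A" by (simp add: multiset_eq_iff)
  then show ?case using Suc by simp
qed simp

lemma measurable_config_repeat:
  assumes "Z \<in> measurable M (count_space UNIV)" "f \<in> measurable M (config S)"
  shows "(\<lambda>\<omega>. repeat_mset (Z \<omega>) (f \<omega>)) \<in> measurable M (config S)"
proof (rule measurable_compose_countable[OF _ assms(1)])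
  show "(\<lambda>\<omega>. repeat_mset k (f \<omega>)) \<in> measurable M (config S)" for k
    by (induction k) (auto intro: measurable_config_union assms(2))
qed

text \<open>The \<open>Z j\<close> are natural-valued and lie in {0, 1} only almost surely, so
  arbitrary multiplicities are treated and the identity holds at every outcome.\<close>

lemma bernoulli_process_eq_config_measure:
  assumes "finite J" "\<And>j. j \<in> J \<Longrightarrow> x j \<in> space S"
  shows "sum_measure S J (\<lambda>j. scale_measure (of_nat (z j)) (return S (x j))) =
    config_measure S (\<Sum>j\<in>J. repeat_mset (z j) {#x j#})"
proof (rule eq_config_measureI)
  fix B assume B: "B \<in> sets S"
  have "emeasure (sum_measure S J (\<lambda>j. scale_measure (of_nat (z j)) (return S (x j)))) B =
      (\<Sum>j\<in>J. of_nat (z j) * indicator B (x j))"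
    using assms B by (subst emeasure_sum_measure) auto
  also have "\<dots> = of_nat (\<Sum>j\<in>J. z j * size (filter_mset (\<lambda>x. x \<in> B) {#x j#}))"
    unfolding of_nat_sum by (intro sum.cong) auto
  finally show "emeasure (sum_measure S J (\<lambda>j. scale_measure (of_nat (z j)) (return S (x j)))) B =
      of_nat (size (filter_mset (\<lambda>x. x \<in> B) (\<Sum>j\<in>J. repeat_mset (z j) {#x j#})))"
    unfolding size_filter_sum_mset size_filter_repeat_mset .
qed simp

lemma poisson_process_eq_config_measure:
  assumes "finite J" "\<And>j. j \<in> J \<Longrightarrow> finite (K j)" "\<And>j k. j \<in> J \<Longrightarrow> k \<in> K j \<Longrightarrow> x j k \<in> space S"
  shows "sum_measure S J (\<lambda>j. sum_measure S (K j) (\<lambda>k. return S (x j k))) =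
    config_measure S (\<Sum>j\<in>J. \<Sum>k\<in>K j. {#x j k#})"
proof (rule eq_config_measureI)
  fix B assume B: "B \<in> sets S"
  have "emeasure (sum_measure S J (\<lambda>j. sum_measure S (K j) (\<lambda>k. return S (x j k)))) B =
      (\<Sum>j\<in>J. \<Sum>k\<in>K j. indicator B (x j k))"
    using assms B by (simp add: emeasure_sum_measure)
  also have "\<dots> = of_nat (\<Sum>j\<in>J. \<Sum>k\<in>K j. size (filter_mset (\<lambda>x. x \<in> B) {#x j k#}))"
    unfolding of_nat_sum by (intro sum.cong) auto
  finally show "emeasure (sum_measure S J (\<lambda>j. sum_measure S (K j) (\<lambda>k. return S (x j k)))) B =
      of_nat (size (filter_mset (\<lambda>x. x \<in> B) (\<Sum>j\<in>J. \<Sum>k\<in>K j. {#x j k#})))"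
    unfolding size_filter_sum_mset .
qed simp

section \<open>Random configurations\<close>

text \<open>A common value type for counting variables (first component) and points (second
  component, as singletons), so that the whole family can be handled by
  \<open>indep_vars\<close>.\<close>

abbreviation marked :: "'s measure \<Rightarrow> (nat \<times> 's multiset) measure" where
  "marked S \<equiv> count_space UNIV \<Otimes>\<^sub>M config S"

lemma (in prob_space) bmf_integrable:
  assumes "\<phi> \<in> bmf K" "T \<in> measurable M K" shows "integrable M (\<lambda>\<omega>. \<phi> (T \<omega>))"
proof -
  obtain C where "\<And>A. \<bar>\<phi> A\<bar> \<le> C" using bmf_bound[OF assms(1)] by blast
  then show ?thesis
    using measurable_compose[OF assms(2) bmf_measurable[OF assms(1)]]
    by (intro integrable_const_bound[where B = C]) auto
qed

lemma bmf_config_union: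
  assumes "\<phi> \<in> bmf (config S)" shows "(\<lambda>A. \<phi> (B + A)) \<in> bmf (config S)"
proof -
  obtain C where C: "\<And>A. \<bar>\<phi> A\<bar> \<le> C" using bmf_bound[OF assms] by blast
  have "(\<lambda>A. \<phi> (B + A)) \<in> borel_measurable (config S)"
    by (rule measurable_compose[OF measurable_config_union bmf_measurable[OF assms]]) auto
  then show ?thesis by (rule bmfI) (rule C)
qed

lemma (in prob_space) expectation_indep_union:
  assumes ind: "indep_var (config S) V (config S) W" and \<phi>: "\<phi> \<in> bmf (config S)"
  shows "expectation (\<lambda>\<omega>. \<phi> (A + (V \<omega> + W \<omega>))) =
    expectation (\<lambda>\<omega>. expectation (\<lambda>\<omega>'. \<phi> (A + V \<omega> + W \<omega>')))"
proof -
  let ?K = "config S"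
  have V: "V \<in> measurable M ?K" and W: "W \<in> measurable M ?K"
    and eq: "distr M ?K V \<Otimes>\<^sub>M distr M ?K W = distr M (?K \<Otimes>\<^sub>M ?K) (\<lambda>x. (V x, W x))"
    using ind unfolding indep_var_distribution_eq by auto
  interpret P1: prob_space "distr M ?K V" by (rule prob_space_distr[OF V])
  interpret P2: prob_space "distr M ?K W" by (rule prob_space_distr[OF W])
  interpret P: pair_prob_space "distr M ?K V" "distr M ?K W" ..
  have \<phi>m [measurable]: "\<phi> \<in> borel_measurable ?K" by (rule bmf_measurable[OF \<phi>])
  obtain C where C: "\<And>A. \<bar>\<phi> A\<bar> \<le> C" using bmf_bound[OF \<phi>] by blast
  let ?f = "\<lambda>(v, w). \<phi> (A + (v + w))"
  have fm [measurable]: "?f \<in> borel_measurable (?K \<Otimes>\<^sub>M ?K)" by measurable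
  have fi: "integrable (distr M ?K V \<Otimes>\<^sub>M distr M ?K W) ?f"
    by (rule P.integrable_const_bound[where B = C]) (auto intro!: AE_I2 C)
  have "expectation (\<lambda>\<omega>. \<phi> (A + (V \<omega> + W \<omega>))) = (\<integral>x. ?f x \<partial>distr M (?K \<Otimes>\<^sub>M ?K) (\<lambda>x. (V x, W x)))"
    using V W by (subst integral_distr) auto
  also have "\<dots> = (\<integral>v. (\<integral>w. \<phi> (A + (v + w)) \<partial>distr M ?K W) \<partial>distr M ?K V)"
    unfolding eq[symmetric] by (rule P.integral_fst'[OF fi, symmetric, unfolded prod.case])
  also have "\<dots> = expectation (\<lambda>\<omega>. \<integral>w. \<phi> (A + (V \<omega> + w)) \<partial>distr M ?K W)"
    by (intro integral_distr[OF V] P2.borel_measurable_lebesgue_integral) measurable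
  also have "\<dots> = expectation (\<lambda>\<omega>. expectation (\<lambda>\<omega>'. \<phi> (A + (V \<omega> + W \<omega>'))))"
    by (intro Bochner_Integration.integral_cong refl integral_distr[OF W]) measurable
  finally show ?thesis by (simp add: add.assoc)
qed

text \<open>Independent summands are integrated out one by one. The value of the summand with index
  \<open>n\<close> joins the base configuration while the others are integrated, so \<open>A\<close>
  is arbitrary in the induction.\<close>

lemma (in prob_space) expectation_op_prod:
  assumes ind: "indep_vars (\<lambda>_. config S) W {..<n}"
    and U: "\<And>j \<phi>. j < n \<Longrightarrow> \<phi> \<in> bmf (config S) \<Longrightarrow> U j \<phi> \<in> bmf (config S)"
    and E: "\<And>j \<phi> A. j < n \<Longrightarrow> \<phi> \<in> bmf (config S) \<Longrightarrow> expectation (\<lambda>\<omega>. \<phi> (A + W j \<omega>)) = U j \<phi> A"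
    and \<phi>: "\<phi> \<in> bmf (config S)"
  shows "expectation (\<lambda>\<omega>. \<phi> (A + (\<Sum>j<n. W j \<omega>))) = op_prod U n \<phi> A"
  using ind U E
proof (induction n arbitrary: A)
  case 0
  then show ?case by (simp add: prob_space)
next
  case (Suc n)
  have ind': "indep_vars (\<lambda>_. config S) W {..<n}"
    by (rule indep_vars_subset[OF Suc.prems(1)]) auto
  have IH: "expectation (\<lambda>\<omega>. \<phi> (A + (\<Sum>j<n. W j \<omega>))) = op_prod U n \<phi> A" for A
    by (rule Suc.IH[OF ind']) (use Suc.prems in auto)
  have bm: "op_prod U m \<phi> \<in> bmf (config S)" if "m \<le> n" for m
    using that by (induction m) (use \<phi> Suc.prems(2) in auto)
  have m: "(\<lambda>\<eta>. \<Sum>j<n. \<eta> j) \<in> measurable (PiM {..<n} (\<lambda>_. config S)) (config S)"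
    by (rule measurable_config_sum) simp
  have m': "(\<lambda>\<eta>. \<eta> n) \<in> measurable (PiM {n} (\<lambda>_. config S)) (config S)" by simp
  have "indep_var (config S) (\<lambda>\<omega>. W n \<omega>) (config S) (\<lambda>\<omega>. \<Sum>j<n. W j \<omega>)"
    using indep_var_compose[OF indep_var_restrict[OF Suc.prems(1), of "{n}" "{..<n}"] m' m]
    by (simp add: comp_def)
  then have "expectation (\<lambda>\<omega>. \<phi> (A + (W n \<omega> + (\<Sum>j<n. W j \<omega>)))) =
      expectation (\<lambda>\<omega>. op_prod U n \<phi> (A + W n \<omega>))"
    using expectation_indep_union[OF _ \<phi>, of "\<lambda>\<omega>. W n \<omega>" "\<lambda>\<omega>. \<Sum>j<n. W j \<omega>" A]
    by (simp only: IH)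
  also have "\<dots> = op_prod U (Suc n) \<phi> A"
    using Suc.prems(3)[OF _ bm[OF order_refl]] by simp
  finally show ?case by (simp add: add.commute)
qed

context sigma_finite_measure
begin

text \<open>Factors the event of a given count out of an expectation; the constants \<open>B\<close>
  and \<open>c\<close> merely fill the other component of the pairs.\<close>

lemma expectation_count_indep:
  assumes P: "prob_space P"
    and ind: "prob_space.indep_var P (marked M) (\<lambda>\<omega>. (Z \<omega>, B)) (marked M) (\<lambda>\<omega>. (c, T \<omega>))"
    and \<phi>: "\<phi> \<in> BM"
  shows "integral\<^sup>L P (\<lambda>\<omega>. (if Z \<omega> = k then 1 else 0) * \<phi> (T \<omega>)) =
      measure P {\<omega> \<in> space P. Z \<omega> = k} * integral\<^sup>L P (\<lambda>\<omega>. \<phi> (T \<omega>))"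
    and "integrable P (\<lambda>\<omega>. (if Z \<omega> = k then 1 else 0) * \<phi> (T \<omega>))"
proof -
  interpret P: prob_space P by fact
  have m: "(\<lambda>\<omega>. (Z \<omega>, B)) \<in> measurable P (marked M)" "(\<lambda>\<omega>. (c, T \<omega>)) \<in> measurable P (marked M)"
    using ind by (auto dest: P.indep_var_rv1 P.indep_var_rv2)
  have Z [measurable]: "Z \<in> measurable P (count_space UNIV)" and T [measurable]: "T \<in> measurable P (config M)"
    using measurable_compose[OF m(1) measurable_fst] measurable_compose[OF m(2) measurable_snd] by simp_all
  note [measurable] = bmf_measurable[OF \<phi>]
  have "P.indep_var borel ((\<lambda>z. if fst z = k then 1 else 0 :: real) \<circ> (\<lambda>\<omega>. (Z \<omega>, B)))
      borel ((\<lambda>z. \<phi> (snd z)) \<circ> (\<lambda>\<omega>. (c, T \<omega>)))"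
    by (rule P.indep_var_compose[OF ind]) measurable
  then have i: "P.indep_var borel (\<lambda>\<omega>. if Z \<omega> = k then 1 else 0 :: real) borel (\<lambda>\<omega>. \<phi> (T \<omega>))"
    by (simp add: comp_def)
  have int1: "integrable P (\<lambda>\<omega>. if Z \<omega> = k then 1 else 0 :: real)"
    by (rule P.integrable_const_bound[where B = 1]) auto
  note int2 = P.bmf_integrable[OF \<phi> T]
  have "integral\<^sup>L P (\<lambda>\<omega>. if Z \<omega> = k then 1 else 0 :: real) =
      integral\<^sup>L P (indicator {\<omega> \<in> space P. Z \<omega> = k})"
    by (rule Bochner_Integration.integral_cong) (auto simp: indicator_def)
  also have "\<dots> = measure P {\<omega> \<in> space P. Z \<omega> = k}" by simp
  finally show "integral\<^sup>L P (\<lambda>\<omega>. (if Z \<omega> = k then 1 else 0) * \<phi> (T \<omega>)) =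
      measure P {\<omega> \<in> space P. Z \<omega> = k} * integral\<^sup>L P (\<lambda>\<omega>. \<phi> (T \<omega>))"
    using P.indep_var_lebesgue_integral[OF i int1 int2] by simp
  show "integrable P (\<lambda>\<omega>. (if Z \<omega> = k then 1 else 0) * \<phi> (T \<omega>))"
    by (rule P.indep_var_integrable[OF i int1 int2])
qed

lemma expectation_density:
  assumes X: "distributed P M X (\<lambda>x. ennreal (h x))" and h: "\<And>x. x \<in> space M \<Longrightarrow> 0 \<le> h x"
    and \<phi>: "\<phi> \<in> BM"
  shows "integral\<^sup>L P (\<lambda>\<omega>. \<phi> (A + {#X \<omega>#})) = transl_op h \<phi> A"
  using distributed_integral[OF X measurable_transl[OF \<phi>, of A] h]
  unfolding transl_op_def by (simp add: add_mset_commute)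

lemma density_integrable:
  assumes P: "prob_space P"
    and X: "distributed P M X (\<lambda>x. ennreal (h x))" and h: "\<And>x. x \<in> space M \<Longrightarrow> 0 \<le> h x"
  shows "integrable M h" and "(\<integral>x. h x \<partial>M) = 1"
proof -
  interpret P: prob_space P by fact
  show "integrable M h"
    using distributed_integrable[OF X, of "\<lambda>_. 1 :: real"] h by simp
  show "(\<integral>x. h x \<partial>M) = 1"
    using distributed_integral[OF X, of "\<lambda>_. 1 :: real"] h by (simp add: P.prob_space)
qed

lemma transl_op_cmult: "transl_op (\<lambda>x. c * w x) \<phi> = (\<lambda>A. c * transl_op w \<phi> A)"
  unfolding transl_op_def by (simp add: mult.assoc)

lemma expectation_bernoulli:
  assumes P: "prob_space P"
    and ind: "prob_space.indep_var P (marked M) (\<lambda>\<omega>. (Z \<omega>, {#})) (marked M) (\<lambda>\<omega>. (0, {#X \<omega>#}))"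
    and p: "measure P {\<omega> \<in> space P. Z \<omega> = 1} = p" "measure P {\<omega> \<in> space P. Z \<omega> = 0} = 1 - p"
    and X: "distributed P M X (\<lambda>x. ennreal (h x))" and h: "\<And>x. x \<in> space M \<Longrightarrow> 0 \<le> h x"
    and \<phi>: "\<phi> \<in> BM"
  shows "integral\<^sup>L P (\<lambda>\<omega>. \<phi> (A + repeat_mset (Z \<omega>) {#X \<omega>#})) = bernoulli_op (\<lambda>x. p * h x) \<phi> A"
proof -
  interpret P: prob_space P by fact
  let ?\<psi> = "\<lambda>B. \<phi> (A + B)"
  have \<psi>: "?\<psi> \<in> BM" by (rule bmf_config_union[OF \<phi>])
  have Z [measurable]: "Z \<in> measurable P (count_space UNIV)"
    using measurable_compose[OF P.indep_var_rv1[OF ind] measurable_fst] by simp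
  have Zk: "{\<omega> \<in> space P. Z \<omega> = k} \<in> sets P" for k by measurable
  have X' [measurable]: "(\<lambda>\<omega>. {#X \<omega>#}) \<in> measurable P (config M)"
    using measurable_compose[OF P.indep_var_rv2[OF ind] measurable_snd] by simp
  \<comment> \<open>The two given probabilities add up to 1, which excludes all other natural values
    almost surely.\<close>
  have ae: "AE \<omega> in P. Z \<omega> = 0 \<or> Z \<omega> = 1"
  proof -
    have "measure P ({\<omega> \<in> space P. Z \<omega> = 0} \<union> {\<omega> \<in> space P. Z \<omega> = 1}) = 1"
      using p Zk by (subst P.finite_measure_Union) auto
    moreover have "{\<omega> \<in> space P. Z \<omega> = 0} \<union> {\<omega> \<in> space P. Z \<omega> = 1} = {\<omega> \<in> space P. Z \<omega> = 0 \<or> Z \<omega> = 1}" by auto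
    ultimately show ?thesis by (subst P.prob_Collect_eq_1[symmetric]) simp_all
  qed
  let ?i = "\<lambda>k \<omega>. (if Z \<omega> = k then 1 else 0) :: real"
  have c0: "integral\<^sup>L P (\<lambda>\<omega>. ?i 0 \<omega> * \<phi> A) = (1 - p) * \<phi> A" "integrable P (\<lambda>\<omega>. ?i 0 \<omega> * \<phi> A)"
    using expectation_count_indep[OF P ind bmf_const, of 0 "\<phi> A"] p(2) by (simp_all add: P.prob_space)
  have c1: "integral\<^sup>L P (\<lambda>\<omega>. ?i 1 \<omega> * \<phi> (A + {#X \<omega>#})) = p * transl_op h \<phi> A"
    "integrable P (\<lambda>\<omega>. ?i 1 \<omega> * \<phi> (A + {#X \<omega>#}))"
    using expectation_count_indep[OF P ind \<psi>, of 1] p(1) expectation_density[OF X h \<phi>, of A] by simp_all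
  have [measurable]: "(\<lambda>\<omega>. repeat_mset (Z \<omega>) {#X \<omega>#}) \<in> measurable P (config M)"
    by (rule measurable_config_repeat[OF Z X'])
  have "integral\<^sup>L P (\<lambda>\<omega>. \<phi> (A + repeat_mset (Z \<omega>) {#X \<omega>#})) =
      integral\<^sup>L P (\<lambda>\<omega>. ?i 0 \<omega> * \<phi> A + ?i 1 \<omega> * \<phi> (A + {#X \<omega>#}))"
  proof (rule integral_cong_AE)
    show "(\<lambda>\<omega>. \<phi> (A + repeat_mset (Z \<omega>) {#X \<omega>#})) \<in> borel_measurable P"
      by (rule measurable_compose[OF _ bmf_measurable[OF \<psi>]]) measurable
    show "(\<lambda>\<omega>. ?i 0 \<omega> * \<phi> A + ?i 1 \<omega> * \<phi> (A + {#X \<omega>#})) \<in> borel_measurable P"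
      using c0 c1 by simp
    show "AE \<omega> in P. \<phi> (A + repeat_mset (Z \<omega>) {#X \<omega>#}) = ?i 0 \<omega> * \<phi> A + ?i 1 \<omega> * \<phi> (A + {#X \<omega>#})"
      using ae by eventually_elim auto
  qed
  also have "\<dots> = (1 - p) * \<phi> A + p * transl_op h \<phi> A"
    by (subst Bochner_Integration.integral_add) (simp_all only: c0 c1)
  also have "\<dots> = bernoulli_op (\<lambda>x. p * h x) \<phi> A"
    using density_integrable(2)[OF P X h]
    by (simp add: bernoulli_op_def diff_op_def transl_op_cmult algebra_simps)
  finally show ?thesis .
qed

lemma op_prod_const: "op_prod (\<lambda>_. U) n = U ^^ n"
  by (induction n) auto

text \<open>Given \<open>N = m\<close>, the \<open>m\<close> points act as the \<open>m\<close>-th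
  power of translation, and the Poisson probabilities turn these powers into the mixture of
  \<open>exp_op_transl\<close>.\<close>

lemma expectation_poisson:
  assumes P: "prob_space P"
    and ind: "\<And>m. prob_space.indep_var P (marked M) (\<lambda>\<omega>. (N \<omega>, {#})) (marked M) (\<lambda>\<omega>. (0, \<Sum>k<m. {#Y k \<omega>#}))"
    and indY: "\<And>m. prob_space.indep_vars P (\<lambda>_. config M) (\<lambda>k \<omega>. {#Y k \<omega>#}) {..<m}"
    and N: "\<And>m. measure P {\<omega> \<in> space P. N \<omega> = m} = p ^ m / fact m * exp (- p)" and p: "0 \<le> p"
    and Y: "\<And>k. distributed P M (Y k) (\<lambda>x. ennreal (h x))" and h: "\<And>x. x \<in> space M \<Longrightarrow> 0 \<le> h x"
    and \<phi>: "\<phi> \<in> BM"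
  shows "integral\<^sup>L P (\<lambda>\<omega>. \<phi> (A + (\<Sum>k<N \<omega>. {#Y k \<omega>#}))) = exp_op (\<lambda>x. p * h x) \<phi> A"
proof -
  interpret P: prob_space P by fact
  have hi: "integrable M h" "(\<integral>x. h x \<partial>M) = 1"
    using density_integrable[OF P Y h] by auto
  let ?\<psi> = "\<lambda>B. \<phi> (A + B)"
  let ?S = "\<lambda>m \<omega>. \<Sum>k<m. {#Y k \<omega>#}"
  have \<psi>: "?\<psi> \<in> BM" by (rule bmf_config_union[OF \<phi>])
  obtain C where C: "\<And>B. \<bar>\<phi> B\<bar> \<le> C" using bmf_bound[OF \<phi>] by blast
  let ?F = "\<lambda>m \<omega>. (if N \<omega> = m then 1 else 0) * \<phi> (A + ?S m \<omega>)"
  note F = expectation_count_indep[OF P ind \<psi>]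
  have S: "integral\<^sup>L P (\<lambda>\<omega>. \<phi> (A + ?S m \<omega>)) = (transl_op h ^^ m) \<phi> A" for m
    unfolding op_prod_const[symmetric]
  proof (rule P.expectation_op_prod[OF indY _ _ \<phi>])
    fix \<psi> A k assume "\<psi> \<in> BM"
    then show "transl_op h \<psi> \<in> BM"
      by (rule bounded_op_bmf[OF bounded_op_transl[OF hi(1)]])
    show "integral\<^sup>L P (\<lambda>\<omega>. \<psi> (A + {#Y k \<omega>#})) = transl_op h \<psi> A"
      using \<open>\<psi> \<in> BM\<close> by (intro expectation_density[OF Y h])
  qed
  \<comment> \<open>Only the summand with \<open>m = N \<omega>\<close> survives. The random number
    of points is thereby replaced by fixed numbers, for which independence is available.\<close>
  have "(\<Sum>m. ?F m \<omega>) = \<phi> (A + (\<Sum>k<N \<omega>. {#Y k \<omega>#}))" for \<omega>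
    by (subst suminf_finite[of "{N \<omega>}"]) auto
  then have "integral\<^sup>L P (\<lambda>\<omega>. \<phi> (A + (\<Sum>k<N \<omega>. {#Y k \<omega>#}))) = integral\<^sup>L P (\<lambda>\<omega>. \<Sum>m. ?F m \<omega>)"
    by (simp only:)
  also have "\<dots> = (\<Sum>m. integral\<^sup>L P (?F m))"
  proof (rule integral_suminf)
    show "integrable P (?F m)" for m by (rule F(2))
    have "summable (\<lambda>m. norm (?F m \<omega>))" for \<omega>
      by (rule summable_finite[of "{N \<omega>}"]) auto
    then show "AE \<omega> in P. summable (\<lambda>m. norm (?F m \<omega>))" by simp
    have le: "norm (integral\<^sup>L P (\<lambda>\<omega>. norm (?F m \<omega>))) \<le> p ^ m / fact m * (exp (- p) * C)" for m
    proof -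
      have "integral\<^sup>L P (\<lambda>\<omega>. norm (?F m \<omega>)) \<le> integral\<^sup>L P (\<lambda>\<omega>. (if N \<omega> = m then 1 else 0) * C)"
        using F(2)[of m m] expectation_count_indep(2)[OF P ind bmf_const[of C], where k = m] C
        by (intro integral_mono integrable_norm) auto
      also have "\<dots> = p ^ m / fact m * (exp (- p) * C)"
        using expectation_count_indep(1)[OF P ind bmf_const[of C], where k = m] by (simp add: N P.prob_space)
      finally show ?thesis by (simp add: Bochner_Integration.integral_nonneg)
    qed
    have sm: "summable (\<lambda>m. p ^ m / fact m * (exp (- p) * C))"
      using summable_mult2[OF summable_exp_coeff[of p], of "exp (- p) * C"] by simp
    show "summable (\<lambda>m. integral\<^sup>L P (\<lambda>\<omega>. norm (?F m \<omega>)))"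
      by (rule summable_comparison_test[OF _ sm]) (use le in blast)
  qed
  also have "\<dots> = (\<Sum>m. exp (- p) * (1 / fact m * (transl_op (\<lambda>x. p * h x) ^^ m) \<phi> A))"
  proof (rule suminf_cong)
    fix m
    have "(transl_op (\<lambda>x. p * h x) ^^ m) \<phi> = (\<lambda>A. p ^ m * (transl_op h ^^ m) \<phi> A)"
    proof (induction m)
      case (Suc m)
      then show ?case
        using bounded_op_cmult[OF bounded_op_transl[OF hi(1)]
            bounded_op_bmf[OF bounded_op_funpow[OF bounded_op_transl[OF hi(1)]] \<phi>], of "p ^ m" m]
        by (simp add: transl_op_cmult mult.assoc)
    qed simp
    then show "integral\<^sup>L P (?F m) = exp (- p) * (1 / fact m * (transl_op (\<lambda>x. p * h x) ^^ m) \<phi> A)"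
      using F(1)[of m m] by (simp add: N S)
  qed
  also have "\<dots> = exp (- p) * op_exp (transl_op (\<lambda>x. p * h x)) \<phi> A"
    unfolding op_exp_def op_series_def
    by (rule suminf_mult[OF op_series_summable[OF bounded_op_transl summable_exp_coeff \<phi>]])
      (use hi in simp)
  also have "\<dots> = exp_op (\<lambda>x. p * h x) \<phi> A"
    using hi by (subst exp_op_transl[OF _ \<phi>]) auto
  finally show ?thesis .
qed

end

section \<open>Independence of the random variables\<close>

definition marked_rv ::
  "(nat \<Rightarrow> 'w \<Rightarrow> nat) \<Rightarrow> (nat \<Rightarrow> 'w \<Rightarrow> 's) \<Rightarrow> (nat \<Rightarrow> nat \<Rightarrow> 'w \<Rightarrow> 's) \<Rightarrow> (nat \<Rightarrow> 'w \<Rightarrow> nat) \<Rightarrow>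
    rv_index \<Rightarrow> 'w \<Rightarrow> nat \<times> 's multiset" where
  "marked_rv N X XX Z i \<omega> = (case i of IN j \<Rightarrow> (N j \<omega>, {#}) | IX j \<Rightarrow> (0, {#X j \<omega>#})
     | IXX j k \<Rightarrow> (0, {#XX j k \<omega>#}) | IZ j \<Rightarrow> (Z j \<omega>, {#}))"

lemma marked_rv_simps [simp]:
  "marked_rv N X XX Z (IN j) \<omega> = (N j \<omega>, {#})" "marked_rv N X XX Z (IX j) \<omega> = (0, {#X j \<omega>#})"
  "marked_rv N X XX Z (IXX j k) \<omega> = (0, {#XX j k \<omega>#})" "marked_rv N X XX Z (IZ j) \<omega> = (Z j \<omega>, {#})"
  by (simp_all add: marked_rv_def)

text \<open>Embedding a variable into \<open>marked\<close> creates no new events, so independence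
  of the given events passes to the embedded family.\<close>

lemma generated_events_compose:
  assumes f: "f \<in> measurable M K" and e: "e \<in> measurable K L"
  shows "{(\<lambda>\<omega>. e (f \<omega>)) -` A \<inter> space M | A. A \<in> sets L} \<subseteq> generated_events M K f"
proof
  fix E assume "E \<in> {(\<lambda>\<omega>. e (f \<omega>)) -` A \<inter> space M | A. A \<in> sets L}"
  then obtain A where A: "A \<in> sets L" and E: "E = (\<lambda>\<omega>. e (f \<omega>)) -` A \<inter> space M" by blast
  have "E = f -` (e -` A \<inter> space K) \<inter> space M"
    unfolding E using measurable_space[OF f] by auto
  then show "E \<in> generated_events M K f"
    unfolding generated_events_def using measurable_sets[OF e A] by blast
qed

lemma (in prob_space) indep_vars_marked:
  assumes N: "\<And>j. j \<in> {1..n} \<Longrightarrow> N j \<in> measurable M (count_space UNIV)"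
    and X: "\<And>j. j \<in> {1..n} \<Longrightarrow> X j \<in> measurable M S"
    and XX: "\<And>j k. j \<in> {1..n} \<Longrightarrow> 1 \<le> k \<Longrightarrow> XX j k \<in> measurable M S"
    and Z: "\<And>j. j \<in> {1..n} \<Longrightarrow> Z j \<in> measurable M (count_space UNIV)"
    and ind: "indep_sets (rv_events M S N X XX Z) (rv_indices n)"
  shows "indep_vars (\<lambda>_. marked S) (marked_rv N X XX Z) (rv_indices n)"
proof -
  let ?L = "marked S"
  have e1: "(\<lambda>z. (z, {#})) \<in> measurable (count_space UNIV) ?L"
    by (intro measurable_Pair) simp_all
  have e2: "(\<lambda>x. (0, {#x#})) \<in> measurable S ?L" by measurable
  have "{marked_rv N X XX Z i -` A \<inter> space M | A. A \<in> sets ?L} \<subseteq> rv_events M S N X XX Z i \<and>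
      marked_rv N X XX Z i \<in> measurable M ?L" if i: "i \<in> rv_indices n" for i
  proof (cases i)
    case (IN j)
    have eq: "marked_rv N X XX Z (IN j) = (\<lambda>\<omega>. (N j \<omega>, {#}))" by auto
    have "j \<in> {1..n}" using i IN by (auto simp: rv_indices_def)
    then show ?thesis
      unfolding IN eq rv_events.simps
      by (intro conjI generated_events_compose[OF N e1] measurable_compose[OF N e1])
  next
    case (IX j)
    have eq: "marked_rv N X XX Z (IX j) = (\<lambda>\<omega>. (0, {#X j \<omega>#}))" by auto
    have "j \<in> {1..n}" using i IX by (auto simp: rv_indices_def)
    then show ?thesis
      unfolding IX eq rv_events.simps
      by (intro conjI generated_events_compose[OF X e2] measurable_compose[OF X e2])
  next
    case (IXX j k)
    have eq: "marked_rv N X XX Z (IXX j k) = (\<lambda>\<omega>. (0, {#XX j k \<omega>#}))" by auto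
    have "j \<in> {1..n}" "1 \<le> k" using i IXX by (auto simp: rv_indices_def)
    then show ?thesis
      unfolding IXX eq rv_events.simps
      by (intro conjI generated_events_compose[OF XX e2] measurable_compose[OF XX e2])
  next
    case (IZ j)
    have eq: "marked_rv N X XX Z (IZ j) = (\<lambda>\<omega>. (Z j \<omega>, {#}))" by auto
    have "j \<in> {1..n}" using i IZ by (auto simp: rv_indices_def)
    then show ?thesis
      unfolding IZ eq rv_events.simps
      by (intro conjI generated_events_compose[OF Z e1] measurable_compose[OF Z e1])
  qed
  then show ?thesis
    unfolding indep_vars_def2 by (auto intro!: indep_sets_mono_sets[OF ind])
qed

lemma measurable_PiM_component:
  "i \<in> I \<Longrightarrow> (\<lambda>\<eta>. \<eta> i) \<in> measurable (PiM I (\<lambda>_. L)) L"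
  by (rule measurable_component_singleton)

lemma measurable_PiM_fst:
  "i \<in> I \<Longrightarrow> (\<lambda>\<eta>. fst (\<eta> i)) \<in> measurable (PiM I (\<lambda>_. L \<Otimes>\<^sub>M L')) L"
  by (rule measurable_compose[OF measurable_PiM_component measurable_fst])

lemma measurable_PiM_snd:
  "i \<in> I \<Longrightarrow> (\<lambda>\<eta>. snd (\<eta> i)) \<in> measurable (PiM I (\<lambda>_. L \<Otimes>\<^sub>M L')) L'"
  by (rule measurable_compose[OF measurable_PiM_component measurable_snd])

section \<open>Independence of disjoint blocks, and the passage to total variation\<close>

context prob_space
begin

context
  fixes S :: "'s measure" and n :: nat
    and N Z :: "nat \<Rightarrow> 'a \<Rightarrow> nat" and X :: "nat \<Rightarrow> 'a \<Rightarrow> 's" and XX :: "nat \<Rightarrow> nat \<Rightarrow> 'a \<Rightarrow> 's"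
  assumes ind: "indep_vars (\<lambda>_. marked S) (marked_rv N X XX Z) (rv_indices n)"
begin

text \<open>The blocks of indices belonging to different \<open>j\<close> are disjoint, and
  measurable functions of disjoint blocks are independent. The shift \<open>Suc j\<close> matches
  the indices from 1 to \<open>n\<close> with \<open>op_prod\<close>, which starts at 0.\<close>

lemma indep_bernoulli_configs:
  "indep_vars (\<lambda>_. config S) (\<lambda>j \<omega>. repeat_mset (Z (Suc j) \<omega>) {#X (Suc j) \<omega>#}) {..<n}"
proof -
  let ?K = "\<lambda>j. {IZ (Suc j), IX (Suc j)}"
  let ?F = "\<lambda>j \<eta>. repeat_mset (fst (\<eta> (IZ (Suc j)))) (snd (\<eta> (IX (Suc j))))"
  have "indep_vars (\<lambda>j. PiM (?K j) (\<lambda>_. marked S))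
      (\<lambda>j \<omega>. restrict (\<lambda>i. marked_rv N X XX Z i \<omega>) (?K j)) {..<n}"
    by (rule indep_vars_restrict[OF ind]) (auto simp: rv_indices_def disjoint_family_on_def)
  then have "indep_vars (\<lambda>_. config S) (\<lambda>j \<omega>. ?F j (restrict (\<lambda>i. marked_rv N X XX Z i \<omega>) (?K j))) {..<n}"
    by (rule indep_vars_compose2)
      (intro measurable_config_repeat measurable_PiM_fst measurable_PiM_snd; simp)
  then show ?thesis by simp
qed

lemma indep_bernoulli_pair:
  assumes "j \<in> {1..n}"
  shows "indep_var (marked S) (\<lambda>\<omega>. (Z j \<omega>, {#}))
    (marked S) (\<lambda>\<omega>. (0, {#X j \<omega>#}))"
  using indep_var_compose[OF indep_var_restrict[OF ind, of "{IZ j}" "{IX j}"]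
      measurable_PiM_component[of "IZ j"] measurable_PiM_component[of "IX j"]] assms
  by (simp add: comp_def rv_indices_def)

text \<open>Each block is infinite, since the number of points is unbounded. The random sum is
  measurable on the block because it is a fixed finite sum for each value of the count.\<close>

lemma indep_poisson_configs:
  "indep_vars (\<lambda>_. config S) (\<lambda>j \<omega>. \<Sum>k<N (Suc j) \<omega>. {#XX (Suc j) (Suc k) \<omega>#}) {..<n}"
proof -
  let ?K = "\<lambda>j. {IN (Suc j)} \<union> range (\<lambda>k. IXX (Suc j) (Suc k))"
  let ?F = "\<lambda>j \<eta>. \<Sum>k<fst (\<eta> (IN (Suc j))). snd (\<eta> (IXX (Suc j) (Suc k)))"
  have "indep_vars (\<lambda>j. PiM (?K j) (\<lambda>_. marked S))
      (\<lambda>j \<omega>. restrict (\<lambda>i. marked_rv N X XX Z i \<omega>) (?K j)) {..<n}"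
    by (rule indep_vars_restrict[OF ind]) (auto simp: rv_indices_def disjoint_family_on_def)
  then have "indep_vars (\<lambda>_. config S) (\<lambda>j \<omega>. ?F j (restrict (\<lambda>i. marked_rv N X XX Z i \<omega>) (?K j))) {..<n}"
  proof (rule indep_vars_compose2)
    fix j
    show "?F j \<in> measurable (PiM (?K j) (\<lambda>_. marked S)) (config S)"
    proof (rule measurable_compose_countable)
      show "(\<lambda>\<eta>. \<Sum>k<m. snd (\<eta> (IXX (Suc j) (Suc k)))) \<in>
          measurable (PiM (?K j) (\<lambda>_. marked S)) (config S)" for m
        by (intro measurable_config_sum measurable_PiM_snd) auto
    qed (intro measurable_PiM_fst, simp)
  qed
  then show ?thesis by simp
qed

lemma indep_poisson_count:
  assumes "j \<in> {1..n}"
  shows "indep_var (marked S) (\<lambda>\<omega>. (N j \<omega>, {#}))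
    (marked S) (\<lambda>\<omega>. (0, \<Sum>k<m. {#XX j (Suc k) \<omega>#}))"
proof -
  let ?B = "range (\<lambda>k. IXX j (Suc k))"
  have m: "(\<lambda>\<eta>. (0, \<Sum>k<m. snd (\<eta> (IXX j (Suc k))))) \<in>
      measurable (PiM ?B (\<lambda>_. marked S)) (marked S)"
    by (intro measurable_Pair measurable_config_sum measurable_PiM_snd) auto
  have sub: "{IN j} \<inter> ?B = {}" "{IN j} \<subseteq> rv_indices n" "?B \<subseteq> rv_indices n"
    using assms by (auto simp: rv_indices_def)
  show ?thesis
    using indep_var_compose[OF indep_var_restrict[OF ind sub] measurable_PiM_component[of "IN j"] m]
    by (simp add: comp_def)
qed

lemma indep_poisson_points:
  assumes "j \<in> {1..n}"
  shows "indep_vars (\<lambda>_. config S) (\<lambda>k \<omega>. {#XX j (Suc k) \<omega>#}) {..<m}"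
proof -
  let ?K = "\<lambda>k. {IXX j (Suc k)}"
  have "indep_vars (\<lambda>k. PiM (?K k) (\<lambda>_. marked S))
      (\<lambda>k \<omega>. restrict (\<lambda>i. marked_rv N X XX Z i \<omega>) (?K k)) {..<m}"
    by (rule indep_vars_restrict[OF ind]) (use assms in \<open>auto simp: rv_indices_def disjoint_family_on_def\<close>)
  then have "indep_vars (\<lambda>_. config S)
      (\<lambda>k \<omega>. snd (restrict (\<lambda>i. marked_rv N X XX Z i \<omega>) (?K k) (IXX j (Suc k)))) {..<m}"
    by (rule indep_vars_compose2) (intro measurable_PiM_snd, simp)
  then show ?thesis by simp
qed

end

text \<open>The test function is the indicator of an event minus 1/2: centring halves the supremum
  norm, and the constant cancels in the difference of expectations.\<close>

lemma tv_dist_config_le: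
  assumes U: "U \<in> measurable M (config S)" and V: "V \<in> measurable M (config S)"
    and \<xi>: "\<And>\<omega>. \<omega> \<in> space M \<Longrightarrow> \<xi> \<omega> = config_measure S (U \<omega>)"
    and \<zeta>: "\<And>\<omega>. \<omega> \<in> space M \<Longrightarrow> \<zeta> \<omega> = config_measure S (V \<omega>)"
    and le: "\<And>\<phi>. \<phi> \<in> bmf (config S) \<Longrightarrow> (\<And>A. \<bar>\<phi> A\<bar> \<le> 1 / 2) \<Longrightarrow>
      \<bar>expectation (\<lambda>\<omega>. \<phi> (U \<omega>)) - expectation (\<lambda>\<omega>. \<phi> (V \<omega>))\<bar> \<le> e"
  shows "tv_dist (distr M (point_measure_algebra S) \<xi>) (distr M (point_measure_algebra S) \<zeta>) \<le> e"
  unfolding tv_dist_def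
proof (rule cSUP_least)
  let ?A = "point_measure_algebra S"
  show "sets (distr M ?A \<xi>) \<noteq> {}" by auto
  fix B assume "B \<in> sets (distr M ?A \<xi>)"
  then have B: "B \<in> sets ?A" by simp
  define \<phi> where "\<phi> C = indicator B (config_measure S C) - (1 / 2 :: real)" for C
  have [measurable]: "B \<in> sets ?A" by (rule B)
  have \<phi>: "\<phi> \<in> bmf (config S)"
  proof (rule bmfI[where C = "1 / 2"])
    have "(\<lambda>C. indicator B (config_measure S C) - (1 / 2 :: real)) \<in> borel_measurable (config S)"
      by measurable
    then show "\<phi> \<in> borel_measurable (config S)" by (simp add: \<phi>_def[abs_def])
  qed (simp add: \<phi>_def indicator_def)
  have E: "measure (distr M ?A \<eta>) B = expectation (\<lambda>\<omega>. \<phi> (T \<omega>)) + 1 / 2"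
    if T [measurable]: "T \<in> measurable M (config S)" and \<eta>: "\<And>\<omega>. \<omega> \<in> space M \<Longrightarrow> \<eta> \<omega> = config_measure S (T \<omega>)"
    for T \<eta>
  proof -
    have "\<eta> \<in> measurable M ?A"
      by (subst measurable_cong[OF \<eta>]) measurable
    then have "measure (distr M ?A \<eta>) B = prob (\<eta> -` B \<inter> space M)"
      by (rule measure_distr[OF _ B])
    also have "\<dots> = expectation (indicator (\<eta> -` B \<inter> space M))" by simp
    also have "\<dots> = expectation (\<lambda>\<omega>. \<phi> (T \<omega>) + 1 / 2)"
      by (rule Bochner_Integration.integral_cong) (auto simp: \<phi>_def \<eta> indicator_def)
    also have "\<dots> = expectation (\<lambda>\<omega>. \<phi> (T \<omega>)) + 1 / 2"
      using bmf_integrable[OF \<phi> T] by (simp add: prob_space)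
    finally show ?thesis .
  qed
  have "measure (distr M ?A \<xi>) B = expectation (\<lambda>\<omega>. \<phi> (U \<omega>)) + 1 / 2"
    "measure (distr M ?A \<zeta>) B = expectation (\<lambda>\<omega>. \<phi> (V \<omega>)) + 1 / 2"
    by (intro E[OF U] \<xi>, assumption, intro E[OF V] \<zeta>)
  moreover have "\<bar>\<phi> C\<bar> \<le> 1 / 2" for C by (simp add: \<phi>_def indicator_def)
  ultimately show "\<bar>measure (distr M ?A \<xi>) B - measure (distr M ?A \<zeta>) B\<bar> \<le> e"
    using le[OF \<phi>] by simp
qed

end

section \<open>Numerical estimates\<close>

text \<open>The bound \<open>exp y \<le> 1 + y + y\<^sup>2\<close> is sharp enough only for small
  \<open>y\<close>; at \<open>y = 1/32\<close> it gives 1057/1024, which is raised to the power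
  64.\<close>

lemma exp_2_le: "exp (2 :: real) \<le> 7.7"
proof -
  have "exp (2 :: real) = exp (1 / 32) ^ 64" by (simp add: exp_of_nat_mult[symmetric])
  also have "\<dots> \<le> (1057 / 1024) ^ 64"
    using exp_bound[of "1 / 32"] by (intro power_mono) (auto simp: power2_eq_square)
  also have "\<dots> \<le> 7.7" by (simp add: power_divide)
  finally show ?thesis .
qed

text \<open>The coefficient \<open>1 / ((m + 2) m!)\<close> is at most \<open>1 / (3 m!)\<close> for
  \<open>m \<ge> 1\<close>, and for \<open>m = 0\<close> it exceeds this by 1/6. Hence
  \<open>g 2\<close> is at most \<open>2 (exp 2 / 3 + 1 / 6)\<close>.\<close>

lemma g_2_le: "g 2 \<le> 5.5"
proof -
  let ?u = "\<lambda>m. 1 / 3 * (\<bar>1 / fact m\<bar> * 2 ^ m) + (if m = 0 then 1 / 6 else 0) :: real"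
  have s: "summable (\<lambda>m. 1 / 3 * (\<bar>1 / fact m\<bar> * 2 ^ m) :: real)"
    by (rule summable_mult[OF summable_exp_coeff])
  have z: "(\<lambda>m. if m = 0 then 1 / 6 else 0 :: real) sums (1 / 6)"
    using sums_single[of 0 "\<lambda>_. 1 / 6 :: real"] by simp
  have "(\<Sum>m. real (m + 1) / fact (m + 2) * 2 ^ m) \<le> (\<Sum>m. ?u m)"
  proof (rule suminf_le[OF _ summable_g summable_add[OF s sums_summable[OF z]]])
    fix m :: nat
    have eq: "real (m + 1) / fact (m + 2) = 1 / ((real m + 2) * fact m)"
      by (simp add: divide_simps)
    show "real (m + 1) / fact (m + 2) * 2 ^ m \<le> ?u m"
    proof (cases "m = 0")
      case False
      have "1 / ((real m + 2) * fact m) \<le> 1 / (3 * fact m)"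
        using False by (intro divide_left_mono mult_right_mono) auto
      then have "1 / ((real m + 2) * fact m) * 2 ^ m \<le> 1 / (3 * fact m) * 2 ^ m"
        by (rule mult_right_mono) simp
      then show ?thesis unfolding eq using False by simp
    qed simp
  qed simp
  also have "\<dots> = 1 / 3 * exp 2 + 1 / 6"
    using suminf_add[OF s sums_summable[OF z]] suminf_mult[OF summable_exp_coeff[of 2], of "1 / 3"]
      sums_unique[OF z] suminf_exp_coeff[of 2] by simp
  finally show ?thesis unfolding g_def using exp_2_le by simp
qed

text \<open>\<open>\<alpha>\<close> is \<open>x' / (2 sqrt 2) + D\<close>, where
  \<open>x' \<ge> x\<close>. The replacement cost is at most \<open>D\<close>, since
  \<open>g \<ge> 1\<close> gives \<open>\<mu> g + 2 (1 - \<mu>) \<le> 2 g\<close> for each index.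
  Finally \<open>2 sqrt 2 \<alpha> = x' + 2 sqrt 2 D\<close>, so
  \<open>1 - 2 sqrt 2 \<alpha>\<close> is at most \<open>1 - x\<close> and at most 1, and both
  contributions may be divided by it.\<close>

lemma poisson_bound_first:
  fixes p \<mu> \<tau> :: "nat \<Rightarrow> real"
  assumes p: "\<And>j. j \<in> J \<Longrightarrow> 0 \<le> p j \<and> p j \<le> 1" and \<mu>: "\<And>j. j \<in> J \<Longrightarrow> 0 \<le> \<mu> j \<and> \<mu> j \<le> 1"
    and \<tau>: "\<And>j. j \<in> J \<Longrightarrow> 0 \<le> \<tau> j"
  defines "\<alpha> \<equiv> \<Sum>j\<in>J. g (2 * p j) * (p j)\<^sup>2 * (\<tau> j / (2 * sqrt 2) + 2 * \<mu> j)"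
    and "x \<equiv> \<Sum>j\<in>J. (p j)\<^sup>2 * \<tau> j * g (2 * (p j * (1 - \<mu> j)))"
  assumes \<alpha>: "\<alpha> < 1 / (2 * sqrt 2)"
  shows "x < 1"
    and "(\<Sum>j\<in>J. (p j * \<mu> j)\<^sup>2 * g (2 * (p j * \<mu> j)) + 2 * (p j * (1 - \<mu> j)) * (p j * \<mu> j)) +
      1 / (2 * sqrt 2) * (x / (1 - x)) \<le> \<alpha> / (1 - 2 * sqrt 2 * \<alpha>)"
proof -
  let ?s = "2 * sqrt 2 :: real"
  define x' where "x' = (\<Sum>j\<in>J. (p j)\<^sup>2 * \<tau> j * g (2 * p j))"
  define D where "D = (\<Sum>j\<in>J. 2 * g (2 * p j) * (p j)\<^sup>2 * \<mu> j)"
  have s0: "0 < ?s" by simp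
  have \<alpha>_eq: "\<alpha> = x' / ?s + D"
    unfolding \<alpha>_def x'_def D_def sum_divide_distrib sum.distrib[symmetric]
    by (intro sum.cong) (auto simp: algebra_simps)
  have gp: "1 \<le> g (2 * p j)" "g (2 * (p j * t)) \<le> g (2 * p j)" if "j \<in> J" "0 \<le> t" "t \<le> 1" for j t
    using p[OF that(1)] that by (auto intro!: g_ge_1 g_mono mult_left_le)
  have D0: "0 \<le> D"
    unfolding D_def using gp(1)[of _ 0] \<mu> by (intro sum_nonneg) (fastforce intro!: mult_nonneg_nonneg)
  have xx': "x \<le> x'"
    unfolding x_def x'_def using \<mu> \<tau> by (intro sum_mono mult_left_mono gp) auto
  have x0: "0 \<le> x"
    unfolding x_def using \<tau> p \<mu> by (intro sum_nonneg mult_nonneg_nonneg order_trans[OF zero_le_one g_ge_1]) auto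
  have sa: "?s * \<alpha> < 1" using \<alpha> by (simp add: field_simps)
  have sx: "?s * \<alpha> = x' + ?s * D" unfolding \<alpha>_eq by (simp add: field_simps)
  have x'1: "x' < 1" using sa sx D0 by (smt (verit) mult_nonneg_nonneg s0)
  then show x1: "x < 1" using xx' by simp
  have "(p j * \<mu> j)\<^sup>2 * g (2 * (p j * \<mu> j)) + 2 * (p j * (1 - \<mu> j)) * (p j * \<mu> j) \<le>
      2 * g (2 * p j) * (p j)\<^sup>2 * \<mu> j" if j: "j \<in> J" for j
  proof -
    have "\<mu> j * g (2 * (p j * \<mu> j)) + 2 * (1 - \<mu> j) \<le> 2 * g (2 * p j)"
    proof -
      have "\<mu> j * g (2 * (p j * \<mu> j)) + 2 * (1 - \<mu> j) \<le> \<mu> j * (2 * g (2 * p j)) + (1 - \<mu> j) * (2 * g (2 * p j))"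
      proof (rule add_mono)
        show "\<mu> j * g (2 * (p j * \<mu> j)) \<le> \<mu> j * (2 * g (2 * p j))"
          using gp(1)[OF j, of 0] gp(2)[OF j, of "\<mu> j"] \<mu>[OF j] by (intro mult_left_mono) auto
        have "(1 - \<mu> j) * 2 \<le> (1 - \<mu> j) * (2 * g (2 * p j))"
          using gp(1)[OF j, of 0] \<mu>[OF j] by (intro mult_left_mono) auto
        then show "2 * (1 - \<mu> j) \<le> (1 - \<mu> j) * (2 * g (2 * p j))" by (simp only: mult.commute[of 2])
      qed
      then show ?thesis by (simp add: algebra_simps)
    qed
    then have "(p j)\<^sup>2 * \<mu> j * (\<mu> j * g (2 * (p j * \<mu> j)) + 2 * (1 - \<mu> j)) \<le> (p j)\<^sup>2 * \<mu> j * (2 * g (2 * p j))"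
      using \<mu>[OF j] by (intro mult_left_mono) auto
    then show ?thesis by (simp add: algebra_simps power2_eq_square)
  qed
  then have 1: "(\<Sum>j\<in>J. (p j * \<mu> j)\<^sup>2 * g (2 * (p j * \<mu> j)) + 2 * (p j * (1 - \<mu> j)) * (p j * \<mu> j)) \<le> D"
    unfolding D_def by (rule sum_mono)
  have "0 \<le> ?s * D" using D0 by simp
  then have "x / (1 - x) \<le> x' / (1 - ?s * \<alpha>)"
    using x0 xx' sa sx by (intro frac_le) linarith+
  then have "1 / ?s * (x / (1 - x)) \<le> 1 / ?s * (x' / (1 - ?s * \<alpha>))"
    by (intro mult_left_mono) auto
  moreover have "D \<le> D / (1 - ?s * \<alpha>)"
  proof -
    have "0 \<le> ?s * \<alpha>" using sx x0 xx' D0 by simp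
    then have "D * (1 - ?s * \<alpha>) \<le> D * 1" using D0 by (intro mult_left_mono) auto
    then show ?thesis using sa by (simp add: pos_le_divide_eq)
  qed
  moreover have "\<alpha> / (1 - ?s * \<alpha>) = D / (1 - ?s * \<alpha>) + 1 / ?s * (x' / (1 - ?s * \<alpha>))"
    by (subst (1) \<alpha>_eq) (simp add: add_divide_distrib)
  ultimately show "(\<Sum>j\<in>J. (p j * \<mu> j)\<^sup>2 * g (2 * (p j * \<mu> j)) + 2 * (p j * (1 - \<mu> j)) * (p j * \<mu> j)) +
      1 / ?s * (x / (1 - x)) \<le> \<alpha> / (1 - ?s * \<alpha>)"
    using 1 by linarith
qed

text \<open>All arguments of \<open>g\<close> are at most 2, where \<open>g \<le> 5.5\<close>. Hence
  \<open>x \<le> 5.5 b < 5.5 / 7.8\<close>, so \<open>1 - x > 0.29\<close>; the coefficient of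
  \<open>b\<close> becomes \<open>5.5 / (2.8 * 0.29) < 6.8\<close> and that of \<open>D\<close> is
  5.5.\<close>

lemma poisson_bound_second:
  fixes p \<mu> \<tau> :: "nat \<Rightarrow> real"
  assumes p: "\<And>j. j \<in> J \<Longrightarrow> 0 \<le> p j \<and> p j \<le> 1" and \<mu>: "\<And>j. j \<in> J \<Longrightarrow> 0 \<le> \<mu> j \<and> \<mu> j \<le> 1"
    and \<tau>: "\<And>j. j \<in> J \<Longrightarrow> 0 \<le> \<tau> j"
  defines "\<beta> \<equiv> \<Sum>j\<in>J. (p j)\<^sup>2 * (\<tau> j + \<mu> j)"
    and "x \<equiv> \<Sum>j\<in>J. (p j)\<^sup>2 * \<tau> j * g (2 * (p j * (1 - \<mu> j)))"
  assumes \<beta>: "7.8 * \<beta> < 1"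
  shows "x < 1"
    and "(\<Sum>j\<in>J. (p j * \<mu> j)\<^sup>2 * g (2 * (p j * \<mu> j)) + 2 * (p j * (1 - \<mu> j)) * (p j * \<mu> j)) +
      1 / (2 * sqrt 2) * (x / (1 - x)) \<le> 7.8 * \<beta>"
proof -
  define b where "b = (\<Sum>j\<in>J. (p j)\<^sup>2 * \<tau> j)"
  define D where "D = (\<Sum>j\<in>J. (p j)\<^sup>2 * \<mu> j)"
  have \<beta>_eq: "\<beta> = b + D"
    unfolding \<beta>_def b_def D_def sum.distrib[symmetric] by (simp add: distrib_left)
  have gp: "g (2 * (p j * t)) \<le> 5.5" if "j \<in> J" "0 \<le> t" "t \<le> 1" for j t
    using p[OF that(1)] that by (intro order_trans[OF g_mono g_2_le]) (auto intro!: mult_le_one)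
  have D0: "0 \<le> D" unfolding D_def using \<mu> by (intro sum_nonneg) auto
  have b0: "0 \<le> b" unfolding b_def using \<tau> by (intro sum_nonneg) auto
  have x0: "0 \<le> x"
    unfolding x_def using \<tau> p \<mu> by (intro sum_nonneg mult_nonneg_nonneg order_trans[OF zero_le_one g_ge_1]) auto
  have xb: "x \<le> b * 5.5"
    unfolding x_def b_def sum_distrib_right using \<mu> \<tau> by (intro sum_mono mult_left_mono gp) auto
  have b1: "7.8 * b < 1" using \<beta> \<beta>_eq D0 by simp
  show x1: "x < 1" using xb b1 b0 by simp
  have "(p j * \<mu> j)\<^sup>2 * g (2 * (p j * \<mu> j)) + 2 * (p j * (1 - \<mu> j)) * (p j * \<mu> j) \<le>
      (p j)\<^sup>2 * \<mu> j * 5.5" if j: "j \<in> J" for j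
  proof -
    have "\<mu> j * g (2 * (p j * \<mu> j)) + (1 - \<mu> j) * 2 \<le> \<mu> j * 5.5 + (1 - \<mu> j) * 5.5"
      using gp[OF j, of "\<mu> j"] \<mu>[OF j] by (intro add_mono mult_left_mono) auto
    also have "\<dots> = 5.5" by (simp add: field_simps)
    finally have "(p j)\<^sup>2 * \<mu> j * (\<mu> j * g (2 * (p j * \<mu> j)) + (1 - \<mu> j) * 2) \<le> (p j)\<^sup>2 * \<mu> j * 5.5"
      using \<mu>[OF j] by (intro mult_left_mono) simp_all
    then show ?thesis by (simp add: algebra_simps power2_eq_square)
  qed
  then have 1: "(\<Sum>j\<in>J. (p j * \<mu> j)\<^sup>2 * g (2 * (p j * \<mu> j)) + 2 * (p j * (1 - \<mu> j)) * (p j * \<mu> j)) \<le> D * 5.5"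
    unfolding D_def sum_distrib_right by (rule sum_mono)
  have "1.4 \<le> sqrt 2" by (rule real_le_rsqrt) (simp add: power2_eq_square)
  then have "1 / (2 * sqrt 2) \<le> 1 / 2.8" by (intro divide_left_mono) auto
  moreover have "x / (1 - x) \<le> b * 5.5 / 0.29"
    using x0 xb b1 by (intro frac_le) auto
  ultimately have "1 / (2 * sqrt 2) * (x / (1 - x)) \<le> 1 / 2.8 * (b * 5.5 / 0.29)"
    using x0 x1 by (intro mult_mono) auto
  then show "(\<Sum>j\<in>J. (p j * \<mu> j)\<^sup>2 * g (2 * (p j * \<mu> j)) + 2 * (p j * (1 - \<mu> j)) * (p j * \<mu> j)) +
      1 / (2 * sqrt 2) * (x / (1 - x)) \<le> 7.8 * \<beta>"
    using 1 b0 D0 unfolding \<beta>_eq by simp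
qed

section \<open>Splitting the densities\<close>

context sigma_finite_measure
begin

definition small_part :: "('a \<Rightarrow> real) \<Rightarrow> ('a \<Rightarrow> real) \<Rightarrow> real \<Rightarrow> real" where
  "small_part h R c = (\<integral>x. h x * R x * (if R x \<le> c then 1 else 0) \<partial>M)"

definition large_part :: "('a \<Rightarrow> real) \<Rightarrow> ('a \<Rightarrow> real) \<Rightarrow> real \<Rightarrow> real" where
  "large_part h R c = (\<integral>x. h x * (if R x \<le> c then 0 else 1) \<partial>M)"

context
  fixes h R :: "'a \<Rightarrow> real" and c :: real
  assumes h: "h \<in> nonneg_weights" and R: "R \<in> borel_measurable M" "\<And>x. x \<in> space M \<Longrightarrow> 0 \<le> R x"
    and c: "0 \<le> c"
begin

lemma integrable_small: "integrable M (\<lambda>x. h x * R x * (if R x \<le> c then 1 else 0))"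
proof (rule Bochner_Integration.integrable_bound[OF integrable_mult_right[OF nonneg_weightsD(1)[OF h], of c]])
  have [measurable]: "h \<in> borel_measurable M" using nonneg_weightsD(1)[OF h] by simp
  note R(1) [measurable]
  show "(\<lambda>x. h x * R x * (if R x \<le> c then 1 else 0)) \<in> borel_measurable M" by measurable
  show "AE x in M. norm (h x * R x * (if R x \<le> c then 1 else 0)) \<le> norm (c * h x)"
    using nonneg_weightsD(2)[OF h] R(2) c
    by (auto simp: abs_mult mult.commute[of c] intro!: AE_I2 mult_left_mono)
qed

lemma integrable_large: "integrable M (\<lambda>x. h x * (if R x \<le> c then 0 else 1))"
proof (rule Bochner_Integration.integrable_bound[OF nonneg_weightsD(1)[OF h]])
  have [measurable]: "h \<in> borel_measurable M" using nonneg_weightsD(1)[OF h] by simp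
  note R(1) [measurable]
  show "(\<lambda>x. h x * (if R x \<le> c then 0 else 1)) \<in> borel_measurable M" by measurable
qed auto

lemma large_compl_eq: "(\<lambda>x. h x * (if R x \<le> c then 1 else 0)) = (\<lambda>x. h x - h x * (if R x \<le> c then 0 else 1))"
  by auto

lemma integrable_large_compl: "integrable M (\<lambda>x. h x * (if R x \<le> c then 1 else 0))"
  unfolding large_compl_eq by (intro Bochner_Integration.integrable_diff integrable_large nonneg_weightsD(1)[OF h])

lemma integral_large_compl:
  "(\<integral>x. h x * (if R x \<le> c then 1 else 0) \<partial>M) = (\<integral>x. h x \<partial>M) - large_part h R c"
  unfolding large_compl_eq large_part_def
  by (intro Bochner_Integration.integral_diff integrable_large nonneg_weightsD(1)[OF h])

lemma small_part_nonneg: "0 \<le> small_part h R c"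
  unfolding small_part_def
  using nonneg_weightsD(2)[OF h] R(2) by (intro Bochner_Integration.integral_nonneg) auto

lemma large_part_nonneg: "0 \<le> large_part h R c"
  unfolding large_part_def
  using nonneg_weightsD(2)[OF h] by (intro Bochner_Integration.integral_nonneg) auto

lemma large_part_le: "large_part h R c \<le> (\<integral>x. h x \<partial>M)"
  unfolding large_part_def
  using nonneg_weightsD(2)[OF h] by (intro integral_mono integrable_large nonneg_weightsD(1)[OF h]) auto

end

text \<open>The minimum changes branch at \<open>R x = k * C\<close>, which fixes the splitting
  level: the values \<open>k = 2 sqrt 2\<close>, \<open>C = 2\<close> and \<open>k = C = 1\<close>
  are those of the two bounds.\<close>

lemma integral_min_eq:
  assumes h: "h \<in> nonneg_weights" and R: "R \<in> borel_measurable M" "\<And>x. x \<in> space M \<Longrightarrow> 0 \<le> R x"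
    and k: "0 < k" and C: "0 < C"
  shows "(\<integral>x. h x * min (R x / k) C \<partial>M) = small_part h R (k * C) / k + C * large_part h R (k * C)"
proof -
  have kC: "0 \<le> k * C" using k C by simp
  have "h x * min (R x / k) C =
      (1 / k) * (h x * R x * (if R x \<le> k * C then 1 else 0)) + C * (h x * (if R x \<le> k * C then 0 else 1))" for x
  proof (cases "R x \<le> k * C")
    case True
    then have "R x / k \<le> C" using k by (simp add: pos_divide_le_eq mult.commute)
    then show ?thesis using True by simp
  next
    case False
    then have "C \<le> R x / k" using k by (simp add: pos_le_divide_eq mult.commute)
    then show ?thesis using False by (simp add: min_absorb2)
  qed
  then have "(\<integral>x. h x * min (R x / k) C \<partial>M) = (\<integral>x. (1 / k) * (h x * R x * (if R x \<le> k * C then 1 else 0)) +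
      C * (h x * (if R x \<le> k * C then 0 else 1)) \<partial>M)"
    by (simp only:)
  also have "\<dots> = (\<integral>x. (1 / k) * (h x * R x * (if R x \<le> k * C then 1 else 0)) \<partial>M) +
      (\<integral>x. C * (h x * (if R x \<le> k * C then 0 else 1)) \<partial>M)"
    by (intro Bochner_Integration.integral_add integrable_mult_right
        integrable_small[OF h R kC] integrable_large[OF h R kC])
  also have "\<dots> = 1 / k * small_part h R (k * C) + C * large_part h R (k * C)"
    unfolding small_part_def large_part_def by (simp only: integral_mult_right_zero)
  finally show ?thesis by simp
qed

text \<open>\<open>R j\<close> is the ratio of \<open>h j\<close> to the intensity \<open>l\<close>.
  The part with ratio at most \<open>c\<close> has density \<open>f j = p j * R j\<close> relative
  to \<open>l\<close>, and its squared norm is \<open>(p j)\<^sup>2 * \<tau> j\<close>; the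
  remaining mass \<open>p j * \<mu> j\<close> is paid for by Poisson replacement.\<close>

lemma process_operator_bound:
  fixes p :: "nat \<Rightarrow> real" and h R :: "nat \<Rightarrow> 'a \<Rightarrow> real"
  assumes p: "\<And>j. j < n \<Longrightarrow> 0 < p j \<and> p j \<le> 1"
    and h: "\<And>j. j < n \<Longrightarrow> h j \<in> nonneg_weights" and h1: "\<And>j. j < n \<Longrightarrow> (\<integral>x. h j x \<partial>M) = 1"
    and R: "\<And>j. j < n \<Longrightarrow> R j \<in> borel_measurable M"
    and Rh: "\<And>j x. j < n \<Longrightarrow> x \<in> space M \<Longrightarrow> R j x * (\<Sum>i<n. p i * h i x) = h j x"
    and R0: "\<And>j x. j < n \<Longrightarrow> x \<in> space M \<Longrightarrow> 0 \<le> R j x \<and> p j * R j x \<le> 1"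
    and c: "0 \<le> c" and \<phi>: "\<phi> \<in> BM" "\<And>A. \<bar>\<phi> A\<bar> \<le> 1 / 2"
  defines "\<mu> \<equiv> \<lambda>j. large_part (h j) (R j) c" and "\<tau> \<equiv> \<lambda>j. small_part (h j) (R j) c"
  defines "x \<equiv> \<Sum>j<n. (p j)\<^sup>2 * \<tau> j * g (2 * (p j * (1 - \<mu> j)))"
  assumes x: "x < 1"
  shows "\<bar>op_prod (\<lambda>j. bernoulli_op (\<lambda>x. p j * h j x)) n \<phi> A - op_prod (\<lambda>j. exp_op (\<lambda>x. p j * h j x)) n \<phi> A\<bar> \<le>
    (\<Sum>j<n. (p j * \<mu> j)\<^sup>2 * g (2 * (p j * \<mu> j)) + 2 * (p j * (1 - \<mu> j)) * (p j * \<mu> j)) +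
    1 / (2 * sqrt 2) * (x / (1 - x))"
proof -
  define a where "a j x = p j * (h j x * (if R j x \<le> c then 1 else 0))" for j x
  define b where "b j x = p j * (h j x * (if R j x \<le> c then 0 else 1))" for j x
  \<comment> \<open>The truncation enforces the bound 1 on the whole type, as
    \<open>unit_weights\<close> demands; on \<open>space M\<close> it changes nothing.\<close>
  define f where "f j x = (if R j x \<le> c then max (- 1) (min 1 (p j * R j x)) else 0)" for j x
  define l where "l x = (\<Sum>j<n. p j * h j x)" for x
  have R0': "x \<in> space M \<Longrightarrow> 0 \<le> R j x" if "j < n" for j x using R0[OF that] by blast
  have p0: "0 \<le> p j" if "j < n" for j using p[OF that] by simp
  have ab: "(\<lambda>x. a j x + b j x) = (\<lambda>x. p j * h j x)" for j unfolding a_def b_def by auto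
  have a: "a j \<in> nonneg_weights" if "j < n" for j
    unfolding a_def nonneg_weights_def
    using integrable_large_compl[OF h R R0' c, of j] nonneg_weightsD(2)[OF h] p0 that
    by (auto intro!: integrable_mult_right)
  have b: "b j \<in> nonneg_weights" if "j < n" for j
    unfolding b_def nonneg_weights_def
    using integrable_large[OF h R R0' c, of j] nonneg_weightsD(2)[OF h] p0 that
    by (auto intro!: integrable_mult_right)
  have f: "f j \<in> unit_weights" if "j < n" for j
  proof -
    note R[OF that, measurable]
    have "f j \<in> borel_measurable M" unfolding f_def[abs_def] by measurable
    then show ?thesis unfolding unit_weights_def f_def by auto
  qed
  have f_eq: "f j x = (if R j x \<le> c then p j * R j x else 0)" if "j < n" "x \<in> space M" for j x
  proof -
    have "0 \<le> p j * R j x" using R0[OF that] p0[OF that(1)] by simp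
    then show ?thesis using R0[OF that] unfolding f_def by simp
  qed
  have l_eq: "(\<Sum>j<n. a j x + b j x) = l x" for x
    unfolding l_def using ab[THEN fun_cong] by simp
  have af: "a j x = f j x * l x" if "j < n" "x \<in> space M" for j x
    unfolding f_eq[OF that] a_def l_def using Rh[OF that] by simp
  have m: "(\<integral>x. a j x \<partial>M) = p j * (1 - \<mu> j)" if "j < n" for j
    unfolding a_def \<mu>_def using integral_large_compl[OF h R R0' c, of j] h1[OF that] that by simp
  have m': "(\<integral>x. b j x \<partial>M) = p j * \<mu> j" for j
    unfolding b_def \<mu>_def large_part_def by simp
  have Q: "(\<integral>x. (f j x)\<^sup>2 * l x \<partial>M) = (p j)\<^sup>2 * \<tau> j" if j: "j < n" for j
  proof -
    have "(\<integral>x. (f j x)\<^sup>2 * l x \<partial>M) = (\<integral>x. (p j)\<^sup>2 * (h j x * R j x * (if R j x \<le> c then 1 else 0)) \<partial>M)"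
    proof (rule Bochner_Integration.integral_cong[OF refl])
      fix x assume x: "x \<in> space M"
      have "(f j x)\<^sup>2 * l x = f j x * a j x" unfolding af[OF j x] by (simp add: power2_eq_square)
      also have "\<dots> = (p j)\<^sup>2 * (h j x * R j x * (if R j x \<le> c then 1 else 0))"
        unfolding f_eq[OF j x] a_def by (simp add: power2_eq_square)
      finally show "(f j x)\<^sup>2 * l x = (p j)\<^sup>2 * (h j x * R j x * (if R j x \<le> c then 1 else 0))" .
    qed
    then show ?thesis unfolding \<tau>_def small_part_def by simp
  qed
  have x_eq: "(\<Sum>j<n. (\<integral>x. (f j x)\<^sup>2 * l x \<partial>M) * g (2 * (\<integral>x. a j x \<partial>M))) = x"
    unfolding x_def by (intro sum.cong) (auto simp: Q m)
  have sum_eq: "(\<Sum>j<n. (p j * \<mu> j)\<^sup>2 * g (2 * (p j * \<mu> j)) + 2 * (p j * (1 - \<mu> j)) * (p j * \<mu> j)) =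
      (\<Sum>j<n. (\<integral>x. b j x \<partial>M)\<^sup>2 * g (2 * (\<integral>x. b j x \<partial>M)) + 2 * (\<integral>x. a j x \<partial>M) * (\<integral>x. b j x \<partial>M))"
    by (intro sum.cong) (auto simp: m m')
  have le1: "(\<integral>x. a j x \<partial>M) + (\<integral>x. b j x \<partial>M) \<le> 1" if "j < n" for j
    unfolding m[OF that] m' using p[OF that] by (simp add: algebra_simps)
  show ?thesis
    using bernoulli_poisson_bound[of n a b f \<phi> A, unfolded l_eq ab x_eq, OF a b f af le1 \<phi> x]
    unfolding sum_eq by simp
qed

end

theorem proposition3p1:
  fixes M :: "'w measure" and S \<nu> :: "'s measure" and n :: nat
    and N Z :: "nat \<Rightarrow> 'w \<Rightarrow> nat" and X :: "nat \<Rightarrow> 'w \<Rightarrow> 's" and XX :: "nat \<Rightarrow> nat \<Rightarrow> 'w \<Rightarrow> 's"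
    and p :: "nat \<Rightarrow> real" and h :: "nat \<Rightarrow> 's \<Rightarrow> real"
    and lam alpha beta :: real and hbar :: "'s \<Rightarrow> real"
    and \<xi> \<zeta> :: "'w \<Rightarrow> 's measure"
  assumes "prob_space M"
    and "1 \<le> n"
    and "\<And>j. j \<in> {1..n} \<Longrightarrow> N j \<in> measurable M (count_space UNIV)"
    and "\<And>j. j \<in> {1..n} \<Longrightarrow> X j \<in> measurable M S"
    and "\<And>j k. j \<in> {1..n} \<Longrightarrow> 1 \<le> k \<Longrightarrow> XX j k \<in> measurable M S"
    and "\<And>j. j \<in> {1..n} \<Longrightarrow> Z j \<in> measurable M (count_space UNIV)"
    and "prob_space.indep_sets M (rv_events M S N X XX Z) (rv_indices n)"
    and "\<And>j k. j \<in> {1..n} \<Longrightarrow> 1 \<le> k \<Longrightarrow> distr M S (XX j k) = distr M S (X j)"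
    and "\<And>j. j \<in> {1..n} \<Longrightarrow> 0 < p j \<and> p j \<le> 1"
    and "\<And>j. j \<in> {1..n} \<Longrightarrow> measure M {\<omega> \<in> space M. Z j \<omega> = 1} = p j"
    and "\<And>j. j \<in> {1..n} \<Longrightarrow> measure M {\<omega> \<in> space M. Z j \<omega> = 0} = 1 - p j"
    and "\<And>j. j \<in> {1..n} \<Longrightarrow>
           distr M (count_space UNIV) (N j) = measure_pmf (poisson_pmf (p j))"
    and "sigma_finite_measure \<nu>" and "sets \<nu> = sets S"
    and "\<And>j x. j \<in> {1..n} \<Longrightarrow> x \<in> space S \<Longrightarrow> 0 \<le> h j x"
    and "\<And>j. j \<in> {1..n} \<Longrightarrow> distributed M \<nu> (X j) (\<lambda>x. ennreal (h j x))"
    and "lam = (\<Sum>j=1..n. p j)"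
    and "hbar = (\<lambda>x. 1 / lam * (\<Sum>j=1..n. p j * h j x))"
    and "\<xi> = (\<lambda>\<omega>. sum_measure S {1..n}
                   (\<lambda>j. scale_measure (of_nat (Z j \<omega>)) (return S (X j \<omega>))))"
    and "\<zeta> = (\<lambda>\<omega>. sum_measure S {1..n}
                   (\<lambda>j. sum_measure S {1..N j \<omega>} (\<lambda>k. return S (XX j k \<omega>))))"
    and "alpha = (\<Sum>j=1..n. g (2 * p j) * (p j)\<^sup>2 *
           (LINT x:{x \<in> space \<nu>. 0 < hbar x}|\<nu>.
              h j x * min (h j x / (2 powr (3/2) * lam * hbar x)) 2))"
    and "beta = (\<Sum>j=1..n. (p j)\<^sup>2 *
           (LINT x:{x \<in> space \<nu>. 0 < hbar x}|\<nu>. h j x * min (h j x / (lam * hbar x)) 1))"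
  shows "(alpha < 1 / 2 powr (3/2) \<longrightarrow>
            tv_dist (distr M (point_measure_algebra S) \<xi>) (distr M (point_measure_algebra S) \<zeta>)
              \<le> alpha / (1 - 2 powr (3/2) * alpha))
       \<and> tv_dist (distr M (point_measure_algebra S) \<xi>) (distr M (point_measure_algebra S) \<zeta>)
              \<le> 7.8 * beta"
proof -
  interpret prob_space M by fact
  interpret V: sigma_finite_measure \<nu> by fact
  note XX_meas = assms(5) and XX_distr = assms(8) and Z1 = assms(10) and Z0 = assms(11)
    and N_distr = assms(12) and sets_\<nu> = assms(14) and h_nonneg = assms(15) and X_dens = assms(16)
  have space_\<nu>: "space \<nu> = space S" by (rule sets_eq_imp_space_eq[OF sets_\<nu>])
  have config_\<nu>: "config \<nu> = config S" by (rule sets_config_cong[OF sets_\<nu>])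
  have Suc_in: "Suc j \<in> {1..n}" if "j < n" for j using that by auto
  have p: "0 < p (Suc j) \<and> p (Suc j) \<le> 1" if "j < n" for j by (rule assms(9)[OF Suc_in[OF that]])
  have h0: "0 \<le> h (Suc j) x" if "j < n" "x \<in> space \<nu>" for j x
    using h_nonneg[OF Suc_in[OF that(1)]] that(2) space_\<nu> by simp
  have XX_dens: "distributed M \<nu> (XX j k) (\<lambda>x. ennreal (h j x))" if "j \<in> {1..n}" "1 \<le> k" for j k
  proof -
    have "distr M \<nu> (XX j k) = distr M S (XX j k)" by (rule distr_cong) (simp_all add: sets_\<nu>)
    also have "\<dots> = distr M \<nu> (X j)"
      unfolding XX_distr[OF that] by (rule distr_cong) (simp_all add: sets_\<nu>)
    finally show ?thesis
      using X_dens[OF that(1)] XX_meas[OF that] unfolding distributed_def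
      by (simp add: measurable_cong_sets[OF refl sets_\<nu>])
  qed
  have indep: "indep_vars (\<lambda>_. marked S) (marked_rv N X XX Z) (rv_indices n)"
    by (rule indep_vars_marked) (use assms(3-7) in auto)
  define p' where "p' j = p (Suc j)" for j
  define h' where "h' j = h (Suc j)" for j
  \<comment> \<open>The value 0 is consistent: where \<open>hbar\<close> vanishes on the space,
    every \<open>h' j\<close> vanishes as well, because the summands of the intensity are
    nonnegative and \<open>p' j > 0\<close>.\<close>
  define R where "R j x = (if 0 < hbar x then h' j x / (lam * hbar x) else 0)" for j x
  have sum_shift: "(\<Sum>j=1..n. F j) = (\<Sum>j<n. F (Suc j))" for F :: "nat \<Rightarrow> real"
    by (simp add: sum.atLeast1_atMost_eq)
  have lam: "lam = (\<Sum>j<n. p' j)" unfolding assms(17) sum_shift p'_def ..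
  have lam0: "0 < lam"
    unfolding lam p'_def using p assms(2) by (intro sum_pos) (auto simp: lessThan_empty_iff)
  have l_eq: "(\<Sum>j<n. p' j * h' j x) = lam * hbar x" for x
    unfolding assms(18) sum_shift p'_def h'_def using lam0 by simp
  have hw: "h' j \<in> V.nonneg_weights" and h1: "(\<integral>x. h' j x \<partial>\<nu>) = 1" if "j < n" for j
    using V.density_integrable[OF assms(1) X_dens[OF Suc_in[OF that]]] h0[OF that]
    unfolding V.nonneg_weights_def h'_def by auto
  have h_meas [measurable]: "h' j \<in> borel_measurable \<nu>" if "j < n" for j
    using V.nonneg_weightsD(1)[OF hw[OF that]] by simp
  have hbar_meas [measurable]: "hbar \<in> borel_measurable \<nu>"
  proof -
    have "hbar = (\<lambda>x. (\<Sum>j<n. p' j * h' j x) / lam)" unfolding l_eq using lam0 by simp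
    then show ?thesis by simp
  qed
  have R_meas: "R j \<in> borel_measurable \<nu>" if "j < n" for j
    using h_meas[OF that] unfolding R_def[abs_def] by measurable
  have term_le: "p' j * h' j x \<le> lam * hbar x" if "j < n" "x \<in> space \<nu>" for j x
    unfolding l_eq[symmetric]
  proof (rule member_le_sum)
    show "0 \<le> p' i * h' i x" if "i \<in> {..<n} - {j}" for i
      using that p[of i] h0[of i] \<open>x \<in> space \<nu>\<close> by (auto simp: p'_def h'_def)
  qed (use that in auto)
  have Rh: "R j x * (\<Sum>i<n. p' i * h' i x) = h' j x" if "j < n" "x \<in> space \<nu>" for j x
  proof (cases "0 < hbar x")
    case False
    then have "lam * hbar x \<le> 0" using lam0 by (simp add: mult_le_0_iff)
    then have "p' j * h' j x \<le> 0" using term_le[OF that] by simp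
    moreover have "0 \<le> h' j x" "0 < p' j" using h0[OF that] p[OF that(1)] by (auto simp: h'_def p'_def)
    ultimately have "h' j x = 0" by (simp add: mult_le_0_iff)
    then show ?thesis using False unfolding R_def by simp
  qed (use lam0 in \<open>simp add: l_eq R_def\<close>)
  have R0: "0 \<le> R j x \<and> p' j * R j x \<le> 1" if "j < n" "x \<in> space \<nu>" for j x
    using term_le[OF that] h0[OF that] lam0 unfolding R_def by (auto simp: h'_def)
  have R_nonneg: "x \<in> space \<nu> \<Longrightarrow> 0 \<le> R j x" if "j < n" for j x using R0[OF that] by blast
  \<comment> \<open>Off the set where \<open>hbar\<close> is positive the ratio is 0, and the
    minimum of 0 and the positive \<open>C\<close> is 0, so the restricted integral equals the
    unrestricted one.\<close>
  have lint: "(LINT x:{x \<in> space \<nu>. 0 < hbar x}|\<nu>. h (Suc j) x * min (h (Suc j) x / (k * lam * hbar x)) C) =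
      V.small_part (h' j) (R j) (k * C) / k + C * V.large_part (h' j) (R j) (k * C)"
    if j: "j < n" and k: "0 < k" and C: "0 < C" for j k C
  proof -
    have "(LINT x:{x \<in> space \<nu>. 0 < hbar x}|\<nu>. h (Suc j) x * min (h (Suc j) x / (k * lam * hbar x)) C) =
        (\<integral>x. h' j x * min (R j x / k) C \<partial>\<nu>)"
      unfolding set_lebesgue_integral_def using C
      by (intro Bochner_Integration.integral_cong) (auto simp: R_def h'_def indicator_def mult_ac)
    then show ?thesis using V.integral_min_eq[OF hw R_meas R_nonneg k C, of j] j by simp
  qed
  let ?U = "\<lambda>\<omega>. \<Sum>j<n. repeat_mset (Z (Suc j) \<omega>) {#X (Suc j) \<omega>#}"
  let ?V = "\<lambda>\<omega>. \<Sum>j<n. \<Sum>k<N (Suc j) \<omega>. {#XX (Suc j) (Suc k) \<omega>#}"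
  have U: "?U \<in> measurable M (config S)"
    using indep_bernoulli_configs[OF indep] unfolding indep_vars_def
    by (intro measurable_config_sum) auto
  have V: "?V \<in> measurable M (config S)"
    using indep_poisson_configs[OF indep] unfolding indep_vars_def
    by (intro measurable_config_sum) auto
  have mset_shift: "(\<Sum>j=1..m. F j) = (\<Sum>j<m. F (Suc j))" for F :: "nat \<Rightarrow> 's multiset" and m
    by (simp add: sum.atLeast1_atMost_eq)
  have \<xi>: "\<xi> \<omega> = config_measure S (?U \<omega>)" if "\<omega> \<in> space M" for \<omega>
  proof -
    have "X j \<omega> \<in> space S" if "j \<in> {1..n}" for j
      using measurable_space[OF assms(4)[OF that] \<open>\<omega> \<in> space M\<close>] .
    then have "\<xi> \<omega> = config_measure S (\<Sum>j=1..n. repeat_mset (Z j \<omega>) {#X j \<omega>#})"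
      unfolding assms(19) by (intro bernoulli_process_eq_config_measure) auto
    then show ?thesis by (simp only: mset_shift)
  qed
  have \<zeta>: "\<zeta> \<omega> = config_measure S (?V \<omega>)" if "\<omega> \<in> space M" for \<omega>
  proof -
    have "XX j k \<omega> \<in> space S" if "j \<in> {1..n}" "k \<in> {1..N j \<omega>}" for j k
      using measurable_space[OF XX_meas[OF that(1)] \<open>\<omega> \<in> space M\<close>] that(2) by simp
    then have "\<zeta> \<omega> = config_measure S (\<Sum>j=1..n. \<Sum>k=1..N j \<omega>. {#XX j k \<omega>#})"
      unfolding assms(20) by (intro poisson_process_eq_config_measure) auto
    then show ?thesis by (simp only: mset_shift)
  qed
  let ?BO = "\<lambda>j. V.bernoulli_op (\<lambda>x. p' j * h' j x)" and ?EO = "\<lambda>j. op_exp (V.diff_op (\<lambda>x. p' j * h' j x))"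
  have whi: "(\<lambda>x. p' j * h' j x) \<in> V.nonneg_weights" if "j < n" for j
    using hw[OF that] p[OF that] unfolding V.nonneg_weights_def p'_def by auto
  have EU: "expectation (\<lambda>\<omega>. \<phi> (?U \<omega>)) = op_prod ?BO n \<phi> {#}" if \<phi>: "\<phi> \<in> bmf (config S)" for \<phi>
  proof -
    \<comment> \<open>The operators act on functions of a base configuration; the law of the process
      itself is read off at the empty one.\<close>
    have "expectation (\<lambda>\<omega>. \<phi> ({#} + ?U \<omega>)) = op_prod ?BO n \<phi> {#}"
    proof (rule expectation_op_prod[OF indep_bernoulli_configs[OF indep] _ _ \<phi>])
      fix j \<psi> A assume j: "j < n" and \<psi>: "\<psi> \<in> bmf (config S)"
      have "(\<integral>x. p' j * h' j x \<partial>\<nu>) \<le> 1" using h1[OF j] p[OF j] by (simp add: p'_def)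
      from bounded_op_bmf[OF V.bounded_op_bernoulli[OF whi[OF j] this]]
      show "?BO j \<psi> \<in> bmf (config S)" using \<psi> unfolding config_\<nu> by blast
      show "expectation (\<lambda>\<omega>. \<psi> (A + repeat_mset (Z (Suc j) \<omega>) {#X (Suc j) \<omega>#})) = ?BO j \<psi> A"
        unfolding p'_def h'_def
        by (rule V.expectation_bernoulli[OF assms(1)])
          (use indep_bernoulli_pair[OF indep Suc_in[OF j]] Z1[OF Suc_in[OF j]] Z0[OF Suc_in[OF j]]
            X_dens[OF Suc_in[OF j]] h0[OF j] \<psi> in \<open>simp_all add: config_\<nu>\<close>)
    qed
    then show ?thesis by simp
  qed
  have EV: "expectation (\<lambda>\<omega>. \<phi> (?V \<omega>)) = op_prod ?EO n \<phi> {#}" if \<phi>: "\<phi> \<in> bmf (config S)" for \<phi>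
  proof -
    have "expectation (\<lambda>\<omega>. \<phi> ({#} + ?V \<omega>)) = op_prod ?EO n \<phi> {#}"
    proof (rule expectation_op_prod[OF indep_poisson_configs[OF indep] _ _ \<phi>])
      fix j \<psi> A assume j: "j < n" and \<psi>: "\<psi> \<in> bmf (config S)"
      from bounded_op_bmf[OF V.bounded_op_exp_op[OF V.nonneg_weightsD(1)[OF whi[OF j]]]]
      show "?EO j \<psi> \<in> bmf (config S)" using \<psi> unfolding config_\<nu> by blast
      have Nm: "measure M {\<omega> \<in> space M. N (Suc j) \<omega> = m} = p (Suc j) ^ m / fact m * exp (- p (Suc j))" for m
      proof -
        have "measure M {\<omega> \<in> space M. N (Suc j) \<omega> = m} = measure (distr M (count_space UNIV) (N (Suc j))) {m}"
          using assms(3)[OF Suc_in[OF j]] by (subst measure_distr) (auto intro!: arg_cong[where f = prob])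
        then show ?thesis
          using p[OF j] unfolding N_distr[OF Suc_in[OF j]] by (simp add: measure_pmf_single)
      qed
      show "expectation (\<lambda>\<omega>. \<psi> (A + (\<Sum>k<N (Suc j) \<omega>. {#XX (Suc j) (Suc k) \<omega>#}))) = ?EO j \<psi> A"
        unfolding p'_def h'_def
        by (rule V.expectation_poisson[OF assms(1) _ _ Nm])
          (use indep_poisson_count[OF indep Suc_in[OF j]] indep_poisson_points[OF indep Suc_in[OF j]]
            XX_dens[OF Suc_in[OF j]] h0[OF j] p[OF j] \<psi> in \<open>simp_all add: config_\<nu>\<close>)
    qed
    then show ?thesis by simp
  qed
  let ?tv = "tv_dist (distr M (point_measure_algebra S) \<xi>) (distr M (point_measure_algebra S) \<zeta>)"
  have tv_le: "?tv \<le> e"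
    if "\<And>\<phi>. \<phi> \<in> bmf (config \<nu>) \<Longrightarrow> (\<And>A. \<bar>\<phi> A\<bar> \<le> 1 / 2) \<Longrightarrow>
      \<bar>op_prod ?BO n \<phi> {#} - op_prod ?EO n \<phi> {#}\<bar> \<le> e" for e
    using that EU EV unfolding config_\<nu> by (intro tv_dist_config_le[OF U V \<xi> \<zeta>]) auto
  define \<mu> where "\<mu> c j = V.large_part (h' j) (R j) c" for c j
  define \<tau> where "\<tau> c j = V.small_part (h' j) (R j) c" for c j
  define x where "x c = (\<Sum>j<n. (p' j)\<^sup>2 * \<tau> c j * g (2 * (p' j * (1 - \<mu> c j))))" for c
  have bound: "?tv \<le> (\<Sum>j<n. (p' j * \<mu> c j)\<^sup>2 * g (2 * (p' j * \<mu> c j)) + 2 * (p' j * (1 - \<mu> c j)) * (p' j * \<mu> c j)) +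
      1 / (2 * sqrt 2) * (x c / (1 - x c))" if c: "0 \<le> c" and "x c < 1" for c
    by (rule tv_le, unfold \<mu>_def \<tau>_def x_def)
      (rule V.process_operator_bound[where R = R], (use p in \<open>simp add: p'_def\<close>), (rule hw h1 R_meas Rh R0 c; assumption?)+,
        use \<open>x c < 1\<close> in \<open>simp_all add: x_def \<mu>_def \<tau>_def\<close>)
  have p01: "j \<in> {..<n} \<Longrightarrow> 0 \<le> p' j \<and> p' j \<le> 1" for j using p[of j] by (auto simp: p'_def)
  have \<mu>01: "j \<in> {..<n} \<Longrightarrow> 0 \<le> \<mu> c j \<and> \<mu> c j \<le> 1" if "0 \<le> c" for j c
    using V.large_part_nonneg[OF hw R_meas R_nonneg that, of j] V.large_part_le[OF hw R_meas R_nonneg that, of j] h1[of j]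
    by (auto simp: \<mu>_def)
  have \<tau>0: "j \<in> {..<n} \<Longrightarrow> 0 \<le> \<tau> c j" if "0 \<le> c" for j c
    using V.small_part_nonneg[OF hw R_meas R_nonneg that, of j] by (auto simp: \<tau>_def)
  have s: "2 powr (3 / 2) = 2 * sqrt (2 :: real)"
    using powr_add[of 2 1 "1 / 2 :: real"] by (simp add: powr_half_sqrt)
  have alpha_eq: "alpha = (\<Sum>j<n. g (2 * p' j) * (p' j)\<^sup>2 * (\<tau> (2 * sqrt 2 * 2) j / (2 * sqrt 2) + 2 * \<mu> (2 * sqrt 2 * 2) j))"
    unfolding assms(21) sum_shift s \<mu>_def \<tau>_def p'_def by (intro sum.cong) (auto simp: lint)
  have beta_eq: "beta = (\<Sum>j<n. (p' j)\<^sup>2 * (\<tau> 1 j + \<mu> 1 j))"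
    unfolding assms(22) sum_shift \<mu>_def \<tau>_def p'_def
    using lint[of _ 1 1] by (intro sum.cong) auto
  have first: "?tv \<le> alpha / (1 - 2 powr (3/2) * alpha)" if "alpha < 1 / 2 powr (3/2)"
  proof -
    note * = poisson_bound_first[of "{..<n}" p' "\<mu> (2 * sqrt 2 * 2)" "\<tau> (2 * sqrt 2 * 2)",
        OF p01 \<mu>01 \<tau>0, folded alpha_eq x_def]
    show ?thesis
      using bound[of "2 * sqrt 2 * 2"] * that unfolding s by fastforce
  qed
  have second: "?tv \<le> 7.8 * beta"
  proof (cases "7.8 * beta < 1")
    case True
    note * = poisson_bound_second[of "{..<n}" p' "\<mu> 1" "\<tau> 1", OF p01 \<mu>01 \<tau>0, folded beta_eq x_def]
    show ?thesis using bound[of 1] * True by fastforce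
  next
    case False
    \<comment> \<open>Two expectations of a function bounded by 1/2 differ by at most 1, which
      settles the case of a right-hand side of at least 1.\<close>
    have "?tv \<le> 1"
    proof (rule tv_dist_config_le[OF U V \<xi> \<zeta>])
      fix \<phi> :: "'s multiset \<Rightarrow> real" assume \<phi>: "\<phi> \<in> bmf (config S)" "\<And>A. \<bar>\<phi> A\<bar> \<le> 1 / 2"
      have "\<bar>expectation (\<lambda>\<omega>. \<phi> (T \<omega>))\<bar> \<le> 1 / 2" if "T \<in> measurable M (config S)" for T
        by (rule order_trans[OF integral_abs_bound])
          (intro integral_le_const integrable_abs bmf_integrable[OF \<phi>(1) that] AE_I2 \<phi>(2))
      from this[OF U] this[OF V]
      show "\<bar>expectation (\<lambda>\<omega>. \<phi> (?U \<omega>)) - expectation (\<lambda>\<omega>. \<phi> (?V \<omega>))\<bar> \<le> 1" by linarith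
    qed
    then show ?thesis using False by simp
  qed
  from first second show ?thesis by blast
qed

end
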